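(* Consider the Sinkhorn bridges associated with $(\mu,\eta,\mathcal{K}_0)=(\lambda_U,\lambda_V,K_W)$. (1) Assume that for every $n\ge1$ condition $A_0(\mathcal{K}_{2n})$ holds for some parameters $(\kappa_{2n},\rho_{2n})$, and that $\mu=\lambda_U$ satisfies the $\mathbb{T}_2(\|u_+\|_2)$ inequality for some positive definite matrix $u_+$. Set $\epsilon_{2n}:=\kappa_{2n}^2\,\rho_{2n}\,\|u_+\|_2$. Then for every $n\ge1$ $$\mathcal{H}(P_{\mu,\eta}|\mathcal{P}_{2n})\le\left(1+\epsilon_{2n}^{-1}\right)^{-1}\mathcal{H}(P_{\mu,\eta}|\mathcal{P}_{2(n-1)}).$$ (2) Assume condition $(\mathcal{W})$ holds with parameters $(\kappa,\widehat u,\widehat v)$ and condition $C_U^-(V)$ holds with positive definite $u_+$ and $v_+$, $0<v_+<\widehat v$, positive semi-definite $\overline v_+$ and $\delta\ge0$. Then there is a constant $\widetilde\rho_v>0$ depending only on $(v_+,\widehat v,\overline v_+,\delta)$ such that the estimate in (1) holds for every $n\ge1$ with $\epsilon_{2n}=\kappa^2\,\widetilde\rho_v\,\|u_+\|_2$.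
   Context: $\lambda$ is Lebesgue measure on $\mathbb{R}^d$. $\lambda_U(dx)=e^{-U(x)}\lambda(dx)$ and $K_W(x,dy)=e^{-W(x,y)}\lambda(dy)$ for smooth $U,V,W$; $\mu=\lambda_U$, $\eta=\lambda_V$ are probability measures and $K_W$ is a Markov transition. $W^\flat(y,x):=W(x,y)$. $(\mu\times\mathcal{K})(d(x,y))=\mu(dx)\mathcal{K}(x,dy)$; $\mathcal{H}$ is relative entropy; $\Pi(\mu,\eta)$ is the set of couplings. The reference is $P=\mu\times K_W$; it is assumed that some $Q\in\Pi(\mu,\eta)$ has $\mathcal{H}(Q|P)<\infty$, and $P_{\mu,\eta}=\arg\min_{Q\in\Pi(\mu,\eta)}\mathcal{H}(Q|P)$. Sinkhorn: $\mathcal{K}_0=K_W$. Given $\mathcal{K}_{2n}$, put $\pi_{2n}=\mu\mathcal{K}_{2n}$, $\mathcal{P}_{2n}=\mu\times\mathcal{K}_{2n}$, and let $\mathcal{K}_{2n+1}$ be defined by $\mu(dx)\mathcal{K}_{2n}(x,dy)=\pi_{2n}(dy)\mathcal{K}_{2n+1}(y,dx)$. Then $\pi_{2n+1}=\eta\mathcal{K}_{2n+1}$, $\mathcal{P}_{2n+1}(d(x,y))=\eta(dy)\mathcal{K}_{2n+1}(y,dx)$, and $\mathcal{K}_{2(n+1)}$ is defined by $\eta(dy)\mathcal{K}_{2n+1}(y,dx)=\pi_{2n+1}(dx)\mathcal{K}_{2(n+1)}(x,dy)$. The log-densities of the Sinkhorn transitions are assumed smooth, with differentiation under the integral sign allowed.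 $\mathcal{D}_2$ is the $2$-Wasserstein distance (Euclidean norm), $\|\cdot\|_2$ the Euclidean/spectral norm. A probability measure $\mu$ satisfies $\mathbb{T}_2(\rho)$ if $\frac12\mathcal{D}_2(\nu,\mu)^2\le\rho\,\mathcal{H}(\nu|\mu)$ for all probability measures $\nu$. $\mathcal{J}(\nu|\mu)=\nu(\|\nabla\log(d\nu/d\mu)\|_2^2)$ (and $+\infty$ if $\nu\not\ll\mu$). $A_0(\mathcal{K})$ with parameters $(\kappa,\rho)$, $\kappa,\rho>0$: for all $x_1,x_2$, $\mathcal{H}(\delta_{x_1}\mathcal{K}|\delta_{x_2}\mathcal{K})\le\frac\rho2\mathcal{J}(\delta_{x_1}\mathcal{K}|\delta_{x_2}\mathcal{K})$ and $\mathcal{J}(\delta_{x_1}\mathcal{K}|\delta_{x_2}\mathcal{K})\le\kappa^2\|x_1-x_2\|_2^2$. Matrix inequalities are in the Loewner order; $\nabla_1,\nabla_2$ are gradients in the first/second variable. Condition $(\mathcal{W})$ with $\kappa>0$ and positive definite $\widehat u,\widehat v$: for all arguments, $\|\nabla_2W(x_1,y)-\nabla_2W(x_2,y)\|_2\le\kappa\|x_1-x_2\|_2$, $\|\nabla_2W^\flat(y_1,x)-\nabla_2W^\flat(y_2,x)\|_2\le\kappa\|y_1-y_2\|_2$, $\nabla_1^2W(x,y_1)-\nabla_1^2W(x,y_2)\le\widehat u^{-1}$, and $\nabla_1^2W^\flat(y,x_1)-\nabla_1^2W^\flat(y,x_2)\le\widehat v^{-1}$. Condition $C_U^-(V)$: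 $\nabla^2V(y)\ge v_+^{-1}1_{\|y\|_2\ge\delta}-\overline v_+1_{\|y\|_2<\delta}$ for all $y$, and $\lambda_U$ satisfies $\mathbb{T}_2(\|u_+\|_2)$. *)

theory Defs
  imports "HOL-Probability.Probability"
begin

section \<open>Differential calculus\<close>

primrec iterated_dderiv ::
  "'a list \<Rightarrow> ('a::euclidean_space \<Rightarrow> real) \<Rightarrow> 'a \<Rightarrow> real" where
  "iterated_dderiv [] f = f"
| "iterated_dderiv (v # vs) f = (\<lambda>x. frechet_derivative (iterated_dderiv vs f) (at x) v)"

text \<open>Class \<open>C\<^sup>\<infinity>\<close>: a differentiable function is continuous, so all iterated
  directional derivatives exist and are continuous.\<close>

definition smooth :: "('a::euclidean_space \<Rightarrow> real) \<Rightarrow> bool" where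
  "smooth f \<longleftrightarrow> (\<forall>vs x. iterated_dderiv vs f differentiable (at x))"

text \<open>Differentiation under the integral sign, for the first- and second-order derivatives
  (the only ones that enter gradients and Hessians).\<close>

definition diff_under_integral ::
  "('a::euclidean_space \<Rightarrow> 'b::euclidean_space \<Rightarrow> real) \<Rightarrow> bool" where
  "diff_under_integral F \<longleftrightarrow> (\<forall>vs y. length vs \<le> 2 \<longrightarrow>
     integrable lborel (\<lambda>x. iterated_dderiv vs (F x) y) \<and>
     iterated_dderiv vs (\<lambda>z. \<integral>x. F x z \<partial>lborel) y = (\<integral>x. iterated_dderiv vs (F x) y \<partial>lborel))"

definition gradient :: "('a::euclidean_space \<Rightarrow> real) \<Rightarrow> 'a \<Rightarrow> 'a" where
  "gradient f x = (THE D. GDERIV f x :> D)"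

definition hessian :: "(real^'d \<Rightarrow> real) \<Rightarrow> real^'d \<Rightarrow> real^'d^'d" where
  "hessian f x = jacobian (gradient f) (at x)"


section \<open>Matrices\<close>

definition pos_semidef :: "real^'d^'d \<Rightarrow> bool" where
  "pos_semidef A \<longleftrightarrow> transpose A = A \<and> (\<forall>x. 0 \<le> x \<bullet> (A *v x))"

definition pos_def :: "real^'d^'d \<Rightarrow> bool" where
  "pos_def A \<longleftrightarrow> transpose A = A \<and> (\<forall>x. x \<noteq> 0 \<longrightarrow> 0 < x \<bullet> (A *v x))"

definition loewner_le :: "real^'d^'d \<Rightarrow> real^'d^'d \<Rightarrow> bool" where
  "loewner_le A B \<longleftrightarrow> pos_semidef (B - A)"

definition loewner_less :: "real^'d^'d \<Rightarrow> real^'d^'d \<Rightarrow> bool" where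
  "loewner_less A B \<longleftrightarrow> pos_def (B - A)"

definition spectral_norm :: "real^'d^'d \<Rightarrow> real" where
  "spectral_norm A = onorm (\<lambda>x. A *v x)"


section \<open>Entropy, Fisher information and transport distance\<close>

text \<open>In \<open>rel_entropy \<nu> \<mu>\<close> the second argument is the reference measure; \<open>KL_divergence\<close> takes
  it first.  For probability measures the negative part of \<open>log (d\<nu>/d\<mu>)\<close> is always
  \<open>\<nu>\<close>-integrable, so a failure of integrability means that the entropy is infinite.\<close>

definition rel_entropy :: "'a measure \<Rightarrow> 'a measure \<Rightarrow> ereal" where
  "rel_entropy \<nu> \<mu> =
     (if sets \<nu> = sets \<mu> \<and> absolutely_continuous \<mu> \<nu> \<and>
         integrable \<nu> (entropy_density (exp 1) \<mu> \<nu>)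
      then ereal (KL_divergence (exp 1) \<mu> \<nu>) else \<infinity>)"

text \<open>\<open>RN_deriv\<close> is only an almost-everywhere representative, so the gradient is taken of a
  differentiable version \<open>f\<close> of \<open>d\<nu>/d\<mu>\<close>.  If \<open>\<mu>\<close> has full support there is at most one such
  version; if there is none, in particular if \<open>\<nu>\<close> is not absolutely continuous, the infimum
  of the empty set gives \<open>\<infinity>\<close>.\<close>

definition fisher_information :: "'a::euclidean_space measure \<Rightarrow> 'a measure \<Rightarrow> ereal" where
  "fisher_information \<nu> \<mu> = enn2ereal (Inf
     {(\<integral>\<^sup>+x. ennreal ((norm (gradient (\<lambda>z. ln (f z)) x))\<^sup>2) \<partial>\<nu>) | f.
        (\<forall>x. 0 \<le> f x) \<and> (\<forall>x. f differentiable (at x)) \<and> \<nu> = density \<mu> (\<lambda>x. ennreal (f x))})"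

definition couplings ::
  "'a::euclidean_space measure \<Rightarrow> 'a measure \<Rightarrow> ('a \<times> 'a) measure set" where
  "couplings \<mu> \<eta> =
     {Q. sets Q = sets (borel \<Otimes>\<^sub>M borel) \<and> distr Q borel fst = \<mu> \<and> distr Q borel snd = \<eta>}"

definition transport_cost2 :: "'a::euclidean_space measure \<Rightarrow> 'a measure \<Rightarrow> ennreal" where
  "transport_cost2 \<nu> \<mu> =
     (INF Q\<in>couplings \<nu> \<mu>. \<integral>\<^sup>+p. ennreal ((norm (fst p - snd p))\<^sup>2) \<partial>Q)"

definition wasserstein2 :: "'a::euclidean_space measure \<Rightarrow> 'a measure \<Rightarrow> ereal" where
  "wasserstein2 \<nu> \<mu> =
     (if transport_cost2 \<nu> \<mu> = \<infinity> then \<infinity>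
      else ereal (sqrt (enn2real (transport_cost2 \<nu> \<mu>))))"

definition talagrand2 :: "'a::euclidean_space measure \<Rightarrow> real \<Rightarrow> bool" where
  "talagrand2 \<mu> \<rho> \<longleftrightarrow> (\<forall>\<nu>. prob_space \<nu> \<and> sets \<nu> = sets borel \<longrightarrow>
     ereal (1 / 2) * (wasserstein2 \<nu> \<mu>)\<^sup>2 \<le> ereal \<rho> * rel_entropy \<nu> \<mu>)"


section \<open>Gibbs measures and Markov transitions\<close>

definition gibbs :: "('a::euclidean_space \<Rightarrow> real) \<Rightarrow> 'a measure" where
  "gibbs U = density lborel (\<lambda>x. ennreal (exp (- U x)))"

definition gibbs_transition ::
  "('a::euclidean_space \<Rightarrow> 'a \<Rightarrow> real) \<Rightarrow> 'a \<Rightarrow> 'a measure" where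
  "gibbs_transition W x = density lborel (\<lambda>y. ennreal (exp (- W x y)))"

definition markov_transition :: "('a::euclidean_space \<Rightarrow> 'a measure) \<Rightarrow> bool" where
  "markov_transition K \<longleftrightarrow> K \<in> borel \<rightarrow>\<^sub>M prob_algebra borel"

text \<open>The measure \<open>\<mu>(dx) K(x,dy)\<close>.\<close>

definition joint ::
  "'a::euclidean_space measure \<Rightarrow> ('a \<Rightarrow> 'a measure) \<Rightarrow> ('a \<times> 'a) measure" where
  "joint \<mu> K = Giry_Monad.bind \<mu> (\<lambda>x. distr (K x) (borel \<Otimes>\<^sub>M borel) (Pair x))"

definition flip_measure :: "('a::euclidean_space \<times> 'a) measure \<Rightarrow> ('a \<times> 'a) measure" where
  "flip_measure Q = distr Q (borel \<Otimes>\<^sub>M borel) prod.swap"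

definition flip :: "('a \<Rightarrow> 'a \<Rightarrow> real) \<Rightarrow> 'a \<Rightarrow> 'a \<Rightarrow> real" where
  "flip W y x = W x y"

text \<open>The probability measure \<open>K x\<close> is \<open>\<delta>\<^sub>x K\<close>.\<close>

definition cond_A0 :: "('a::euclidean_space \<Rightarrow> 'a measure) \<Rightarrow> real \<Rightarrow> real \<Rightarrow> bool" where
  "cond_A0 K \<kappa> \<rho> \<longleftrightarrow> \<kappa> > 0 \<and> \<rho> > 0 \<and>
     (\<forall>x1 x2. rel_entropy (K x1) (K x2) \<le> ereal (\<rho> / 2) * fisher_information (K x1) (K x2) \<and>
              fisher_information (K x1) (K x2) \<le> ereal (\<kappa>\<^sup>2 * (norm (x1 - x2))\<^sup>2))"


section \<open>Sinkhorn and Schroedinger bridges\<close>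

definition schroedinger_bridge ::
  "'a::euclidean_space measure \<Rightarrow> 'a measure \<Rightarrow> ('a \<times> 'a) measure \<Rightarrow> ('a \<times> 'a) measure" where
  "schroedinger_bridge \<mu> \<eta> P = (ARG_MIN (\<lambda>Q. rel_entropy Q P) Q. Q \<in> couplings \<mu> \<eta>)"

definition sinkhorn_marginal ::
  "'a::euclidean_space measure \<Rightarrow> 'a measure \<Rightarrow> (nat \<Rightarrow> 'a \<Rightarrow> 'a measure) \<Rightarrow> nat \<Rightarrow> 'a measure"
  where
  "sinkhorn_marginal \<mu> \<eta> K n =
     (if even n then Giry_Monad.bind \<mu> (K n) else Giry_Monad.bind \<eta> (K n))"

text \<open>Sinkhorn bridges are measures in \<open>(x,y)\<close>, whereas the transitions of odd index go
  from \<open>y\<close> to \<open>x\<close>.\<close>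

definition sinkhorn_bridge ::
  "'a::euclidean_space measure \<Rightarrow> 'a measure \<Rightarrow> (nat \<Rightarrow> 'a \<Rightarrow> 'a measure) \<Rightarrow> nat \<Rightarrow>
   ('a \<times> 'a) measure" where
  "sinkhorn_bridge \<mu> \<eta> K n =
     (if even n then joint \<mu> (K n) else flip_measure (joint \<eta> (K n)))"

text \<open>Disintegration determines a transition only up to null sets; the versions meant here are
  those with smooth log-densities \<open>- w n\<close>, which are unique.  The integrals in
  \<open>marginal_diff\<close> are the Lebesgue densities of the Sinkhorn marginals.\<close>

locale sinkhorn =
  fixes U V :: "real^'d \<Rightarrow> real"
    and W :: "real^'d \<Rightarrow> real^'d \<Rightarrow> real"
    and K :: "nat \<Rightarrow> real^'d \<Rightarrow> (real^'d) measure"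
  assumes smooth_U: "smooth U"
    and smooth_V: "smooth V"
    and smooth_W: "smooth (\<lambda>p. W (fst p) (snd p))"
    and prob_U: "prob_space (gibbs U)"
    and prob_V: "prob_space (gibbs V)"
    and markov_W: "markov_transition (gibbs_transition W)"
    and finite_entropy: "\<exists>Q\<in>couplings (gibbs U) (gibbs V).
          rel_entropy Q (joint (gibbs U) (gibbs_transition W)) < \<infinity>"
    and transition_0: "K 0 = gibbs_transition W"
    and markov: "\<And>n. markov_transition (K n)"
    and transition_odd: "\<And>n. even n \<Longrightarrow>
          sinkhorn_bridge (gibbs U) (gibbs V) K n =
          flip_measure (joint (sinkhorn_marginal (gibbs U) (gibbs V) K n) (K (Suc n)))"
    and transition_even: "\<And>n. odd n \<Longrightarrow>
          sinkhorn_bridge (gibbs U) (gibbs V) K n =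
          joint (sinkhorn_marginal (gibbs U) (gibbs V) K n) (K (Suc n))"
    and regularity: "\<exists>w. \<forall>n. K n = gibbs_transition (w n) \<and>
          smooth (\<lambda>p. w n (fst p) (snd p)) \<and>
          diff_under_integral (\<lambda>x y. exp (- (if even n then U x else V x)) * exp (- w n x y))"


section \<open>Conditions on the potentials\<close>

definition cond_W ::
  "(real^'d \<Rightarrow> real^'d \<Rightarrow> real) \<Rightarrow> real \<Rightarrow> real^'d^'d \<Rightarrow> real^'d^'d \<Rightarrow> bool" where
  "cond_W W \<kappa> u_hat v_hat \<longleftrightarrow>
     \<kappa> > 0 \<and> pos_def u_hat \<and> pos_def v_hat \<and>
     (\<forall>x1 x2 y. norm (gradient (W x1) y - gradient (W x2) y) \<le> \<kappa> * norm (x1 - x2)) \<and>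
     (\<forall>y1 y2 x. norm (gradient (flip W y1) x - gradient (flip W y2) x) \<le> \<kappa> * norm (y1 - y2)) \<and>
     (\<forall>x y1 y2. loewner_le (hessian (\<lambda>z. W z y1) x - hessian (\<lambda>z. W z y2) x)
                  (matrix_inv u_hat)) \<and>
     (\<forall>y x1 x2. loewner_le (hessian (\<lambda>z. flip W z x1) y - hessian (\<lambda>z. flip W z x2) y)
                  (matrix_inv v_hat))"

definition cond_C_minus ::
  "(real^'d \<Rightarrow> real) \<Rightarrow> (real^'d \<Rightarrow> real) \<Rightarrow> real^'d^'d \<Rightarrow> real^'d^'d \<Rightarrow> real^'d^'d \<Rightarrow> real \<Rightarrow> bool"
  where
  "cond_C_minus U V u_plus v_plus v_bar \<delta> \<longleftrightarrow>
     (\<forall>y. loewner_le (indicat_real {z. norm z \<ge> \<delta>} y *\<^sub>R matrix_inv v_plus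
                      - indicat_real {z. norm z < \<delta>} y *\<^sub>R v_bar)
            (hessian V y)) \<and>
     talagrand2 (gibbs U) (spectral_norm u_plus)"

end

theory Submission
  imports Defs "HOL-Real_Asymp.Real_Asymp"
begin

text \<open>
  Write \<open>P\<^sub>n\<close> for the Sinkhorn bridges, \<open>\<pi>\<^sub>n\<close> for their marginals and \<open>P\<close> for the Schroedinger
  bridge.  One half step of the Sinkhorn algorithm multiplies \<open>P\<^sub>n\<close> by a function of a single
  coordinate, the ratio of the prescribed marginal to the present one.  For every coupling \<open>Q\<close> of
  \<open>\<mu>\<close> and \<open>\<eta>\<close> the entropy \<open>H(Q|P\<^sub>n)\<close> therefore decreases by an amount \<open>d\<^sub>n\<close> that does not depend on
  \<open>Q\<close>, namely the entropy of the prescribed marginal relative to the present one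
  (\<open>entropy_step\<close>).  It follows that \<open>P\<close> minimises \<open>H(\<cdot>|P\<^sub>n)\<close> over the couplings for every \<open>n\<close>, and
  that \<open>H(P|P\<^sub>2\<^sub>n\<^sub>-\<^sub>2) = H(P|P\<^sub>2\<^sub>n) + d\<^sub>2\<^sub>n\<^sub>-\<^sub>1 + d\<^sub>2\<^sub>n\<^sub>-\<^sub>2\<close>.  The contraction
  thus follows from the bound \<open>H(P|P\<^sub>2\<^sub>n) \<le> \<epsilon> d\<^sub>2\<^sub>n\<^sub>-\<^sub>2\<close>.

  By minimality, this bound only asks for one coupling \<open>Q\<close> of \<open>\<mu>\<close> and \<open>\<eta>\<close> that is close to \<open>P\<^sub>2\<^sub>n\<close>.
  Since \<open>P\<^sub>2\<^sub>n\<^sub>-\<^sub>1\<close> has second marginal \<open>\<eta>\<close> and transition \<open>K\<^sub>2\<^sub>n\<close>, one has \<open>\<pi>\<^sub>2\<^sub>n\<^sub>-\<^sub>1 K\<^sub>2\<^sub>n = \<eta>\<close>.  Couple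
  \<open>x'\<close> with law \<open>\<pi>\<^sub>2\<^sub>n\<^sub>-\<^sub>1\<close> to \<open>x\<close> with law \<open>\<mu>\<close>, draw \<open>y\<close> from \<open>K\<^sub>2\<^sub>n(x')\<close>, and let \<open>Q\<close> be the law of
  \<open>(x,y)\<close>.  Data processing bounds \<open>H(Q|P\<^sub>2\<^sub>n)\<close> by the mean of \<open>H(K\<^sub>2\<^sub>n(x')|K\<^sub>2\<^sub>n(x))\<close>
  (\<open>coupled_transition_entropy\<close>), which is at most half of \<open>C\<close> times the transport cost if
  \<open>H(K\<^sub>2\<^sub>n(x')|K\<^sub>2\<^sub>n(x)) \<le> C |x' - x|\<^sup>2 / 2\<close>.  Talagrand's inequality turns the cost into
  \<open>H(\<pi>\<^sub>2\<^sub>n\<^sub>-\<^sub>1|\<mu>)\<close>, and data processing for \<open>H(P\<^sub>2\<^sub>n\<^sub>-\<^sub>1|P\<^sub>2\<^sub>n\<^sub>-\<^sub>2) = d\<^sub>2\<^sub>n\<^sub>-\<^sub>2\<close> bounds the latter by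
  \<open>d\<^sub>2\<^sub>n\<^sub>-\<^sub>2\<close> (\<open>marginal_entropy_le_drop\<close>).  The existence of \<open>P\<close> comes from the strict convexity of the
  entropy: a minimising sequence of densities is Cauchy in \<open>L\<^sup>1\<close> (\<open>exists_minimal_entropy\<close>).

  In the first part of the theorem \<open>C = \<kappa>\<^sup>2 \<rho>\<close> is immediate from \<open>cond_A0\<close>.  In the second part
  the estimate on \<open>H(K\<^sub>2\<^sub>n(x')|K\<^sub>2\<^sub>n(x))\<close> rests on Gaussian concentration of \<open>K\<^sub>2\<^sub>n(x)\<close>.  The
  log-ratio of the two measures is, up to a constant, \<open>W(x,\<cdot>) - W(x',\<cdot>)\<close>, hence Lipschitz with
  constant \<open>\<kappa> |x - x'|\<close>, and the entropy of such a tilt is controlled by an exponential moment of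
  \<open>|y - y'|\<^sup>2\<close> for two independent draws (\<open>lipschitz_tilt_entropy\<close>).  The potential of \<open>K\<^sub>2\<^sub>n(x)\<close> is
  \<open>V\<close> plus the logarithm of an integral of \<open>exp (W(x,\<cdot>) - W(x',\<cdot>))\<close> over \<open>x'\<close>; log-integral-exp
  preserves convexity, so the potential minus \<open>V\<close> becomes convex when the quadratic form of half of
  the inverse of \<open>v_hat\<close> is added (\<open>convex_on_log_integral_exp\<close>).  The potential therefore is at
  least as convex as \<open>V\<close> minus that quadratic form: uniformly convex outside a ball, with Hessian
  bounded below inside.  In the coordinates \<open>y = s + r\<close>, \<open>y' = s - r\<close> the sum of the potentials at
  \<open>y\<close> and \<open>y'\<close> is even in \<open>r\<close>, and every line spends length at most \<open>2 \<delta>\<close> in the ball; so the sum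
  grows quadratically in \<open>r\<close>, uniformly in \<open>s\<close> (\<open>two_point_growth\<close>), wherever the potential has its
  minimum.  Comparing the integrands at \<open>r\<close> and \<open>2 r\<close> by a change of variables gives the
  exponential moment (\<open>two_point_exponential_moment\<close>), with constants that come only from \<open>v_plus\<close>,
  \<open>v_hat\<close>, \<open>v_bar\<close>, \<open>\<delta>\<close> and the dimension.
\<close>

section \<open>Relative entropy\<close>

text \<open>The affine correction makes the integrand of the entropy nonnegative without changing its integral
  between probability measures; entropies become nonnegative integrals, to which Fatou and Tonelli
  apply.\<close>

definition entropy_fun :: "real \<Rightarrow> real" where
  "entropy_fun q = q * ln q - q + 1"

lemma entropy_fun_measurable [measurable]: "entropy_fun \<in> borel_measurable borel"
  unfolding entropy_fun_def by measurable

lemma entropy_fun_nonneg: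
  assumes "q \<ge> 0" shows "entropy_fun q \<ge> 0"
proof (cases "q = 0")
  case False
  then have q: "q > 0" using assms by simp
  have "ln (1 / q) \<le> 1 / q - 1" using q by (intro ln_le_minus_one) simp
  then have "q * (- ln q) \<le> q * (1 / q - 1)"
    using q by (intro mult_left_mono) (simp_all add: ln_div)
  then show ?thesis using q by (simp add: entropy_fun_def algebra_simps)
qed (simp add: entropy_fun_def)

text \<open>Frees the entropy from the Radon-Nikodym derivative: any density represents it.\<close>

lemma rel_entropy_density_ln:
  assumes R: "prob_space R" and Q: "prob_space (density R (\<lambda>x. ennreal (q x)))"
    and q [measurable]: "q \<in> borel_measurable R" and q0: "\<And>x. q x \<ge> 0"
  defines "Q \<equiv> density R (\<lambda>x. ennreal (q x))"
  shows "rel_entropy Q R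
       = (if integrable Q (\<lambda>x. ln (q x)) then ereal (\<integral>x. ln (q x) \<partial>Q) else \<infinity>)"
proof -
  interpret R: prob_space R by fact
  let ?e = "entropy_density (exp 1) R Q"
  have [measurable_cong]: "sets Q = sets R" by (simp add: Q_def)
  have "AE x in R. ennreal (q x) = RN_deriv R Q x"
    unfolding Q_def by (rule R.RN_deriv_unique) auto
  then have "AE x in R. ?e x = ln (q x)"
  proof eventually_elim
    case (elim x)
    then have "enn2real (RN_deriv R Q x) = q x" using q0[of x] by (metis enn2real_ennreal)
    then show ?case by (simp add: entropy_density_def log_def)
  qed
  moreover have ac: "absolutely_continuous R Q"
    unfolding Q_def by (rule absolutely_continuousI_density) auto
  ultimately have AEe: "AE x in Q. ?e x = ln (q x)"
    by (intro absolutely_continuous_AE[OF _ ac]) (auto simp: Q_def)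
  have "integrable Q ?e \<longleftrightarrow> integrable Q (\<lambda>x. ln (q x))"
    using AEe by (intro integrable_cong_AE) auto
  moreover have "(\<integral>x. ?e x \<partial>Q) = (\<integral>x. ln (q x) \<partial>Q)"
    using AEe by (intro integral_cong_AE) auto
  ultimately show ?thesis
    using ac by (simp add: rel_entropy_def KL_divergence_def Q_def)
qed

lemma rel_entropy_density:
  assumes R: "prob_space R" and Q: "prob_space (density R (\<lambda>x. ennreal (q x)))"
    and q [measurable]: "q \<in> borel_measurable R" and q0: "\<And>x. q x \<ge> 0"
  shows "rel_entropy (density R (\<lambda>x. ennreal (q x))) R
       = enn2ereal (\<integral>\<^sup>+x. ennreal (entropy_fun (q x)) \<partial>R)"
proof -
  interpret R: prob_space R by fact
  let ?Q = "density R (\<lambda>x. ennreal (q x))"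
  interpret Q: prob_space ?Q by fact
  have nn1: "(\<integral>\<^sup>+x. ennreal (q x) \<partial>R) = 1"
    using Q.emeasure_space_1 by (simp add: emeasure_density cong: nn_integral_cong)
  have iq: "integrable R q" using q0 nn1 by (intro integrableI_nonneg) auto
  have q1: "(\<integral>x. q x \<partial>R) = 1"
    using integral_eq_nn_integral[of q R] q0 nn1 by (auto simp: iq)
  have I1: "integrable ?Q (\<lambda>x. ln (q x)) \<longleftrightarrow> integrable R (\<lambda>x. q x * ln (q x))"
    using q0 by (subst integrable_density) auto
  show ?thesis
  proof (cases "integrable R (\<lambda>x. q x * ln (q x))")
    case True
    then have If: "integrable R (\<lambda>x. entropy_fun (q x))" using iq by (simp add: entropy_fun_def)
    have "(\<integral>x. ln (q x) \<partial>?Q) = (\<integral>x. q x * ln (q x) \<partial>R)"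
      using q0 by (subst integral_density) auto
    also have "\<dots> = (\<integral>x. entropy_fun (q x) \<partial>R)"
      using True iq q1 by (simp add: entropy_fun_def R.prob_space)
    finally have KL: "(\<integral>x. ln (q x) \<partial>?Q) = (\<integral>x. entropy_fun (q x) \<partial>R)" .
    have "(\<integral>\<^sup>+x. ennreal (entropy_fun (q x)) \<partial>R) = ennreal (\<integral>x. entropy_fun (q x) \<partial>R)"
      by (rule nn_integral_eq_integral[OF If]) (simp add: entropy_fun_nonneg q0)
    moreover have "(\<integral>x. entropy_fun (q x) \<partial>R) \<ge> 0"
      by (intro integral_nonneg_AE) (simp add: entropy_fun_nonneg q0)
    ultimately show ?thesis
      using rel_entropy_density_ln[OF R Q q q0] True I1 KL by (simp add: enn2ereal_ennreal)
  next
    case False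
    have "\<not> integrable R (\<lambda>x. entropy_fun (q x))"
    proof
      assume "integrable R (\<lambda>x. entropy_fun (q x))"
      then have "integrable R (\<lambda>x. entropy_fun (q x) + q x - 1)" using iq by simp
      then show False using False by (simp add: entropy_fun_def)
    qed
    then have "\<not> (\<integral>\<^sup>+x. ennreal (entropy_fun (q x)) \<partial>R) < \<infinity>"
      using integrableI_nonneg[of "\<lambda>x. entropy_fun (q x)" R] q0
      by (metis (no_types, lifting) AE_I2 entropy_fun_nonneg measurable_compose[OF q entropy_fun_measurable])
    then have "(\<integral>\<^sup>+x. ennreal (entropy_fun (q x)) \<partial>R) = \<infinity>" by (auto simp: less_top[symmetric])
    then show ?thesis using False rel_entropy_density_ln[OF R Q q q0] I1 by simp
  qed
qed

lemma absolutely_continuous_real_density: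
  assumes "prob_space R" "prob_space Q" "absolutely_continuous R Q" "sets Q = sets R"
  obtains q :: "'a \<Rightarrow> real" where "q \<in> borel_measurable R" "\<And>x. q x \<ge> 0"
    "Q = density R (\<lambda>x. ennreal (q x))"
proof -
  interpret R: prob_space R by fact
  interpret Q: prob_space Q by fact
  obtain D where D: "D \<in> borel_measurable R" "AE x in R. RN_deriv R Q x = ennreal (D x)"
      "\<And>x. 0 \<le> D x"
    using R.real_RN_deriv[OF Q.finite_measure_axioms assms(3,4)] by metis
  have "Q = density R (RN_deriv R Q)" using R.density_RN_deriv[OF assms(3,4)] by simp
  also have "\<dots> = density R (\<lambda>x. ennreal (D x))"
    using D by (intro density_cong) auto
  finally show ?thesis using that D by blast
qed

lemma rel_entropy_nonneg:
  assumes "prob_space R" "prob_space Q"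
  shows "rel_entropy Q R \<ge> 0"
proof (cases "rel_entropy Q R = \<infinity>")
  case False
  then have "absolutely_continuous R Q" "sets Q = sets R"
    by (auto simp: rel_entropy_def split: if_splits)
  then obtain q where "q \<in> borel_measurable R" "\<And>x. q x \<ge> 0" "Q = density R (\<lambda>x. ennreal (q x))"
    using absolutely_continuous_real_density assms by blast
  then show ?thesis using rel_entropy_density[of R q] assms by simp
qed simp

lemma rel_entropy_finiteE:
  assumes "prob_space R" "prob_space Q" "rel_entropy Q R < \<infinity>"
  obtains q :: "'a \<Rightarrow> real" where "q \<in> borel_measurable R" "\<And>x. q x \<ge> 0"
    "Q = density R (\<lambda>x. ennreal (q x))" "integrable Q (\<lambda>x. ln (q x))"
    "rel_entropy Q R = ereal (\<integral>x. ln (q x) \<partial>Q)"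
proof -
  have "absolutely_continuous R Q" "sets Q = sets R"
    using assms(3) by (auto simp: rel_entropy_def split: if_splits)
  then obtain q where q: "q \<in> borel_measurable R" "\<And>x. q x \<ge> 0" "Q = density R (\<lambda>x. ennreal (q x))"
    using absolutely_continuous_real_density assms by blast
  then have "rel_entropy Q R
       = (if integrable Q (\<lambda>x. ln (q x)) then ereal (\<integral>x. ln (q x) \<partial>Q) else \<infinity>)"
    using rel_entropy_density_ln[of R q] assms by simp
  then show ?thesis using that q assms(3) by (auto split: if_splits)
qed

lemma AE_density_pos:
  assumes [measurable]: "q \<in> borel_measurable R" and "Q = density R (\<lambda>x. ennreal (q x))"
  shows "AE x in Q. 0 < q x"
  unfolding assms(2) by (subst AE_density) auto

text \<open>The data processing inequality.  With \<open>g\<close> the density of the image measures, \<open>ln t \<le> t - 1\<close> at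
  \<open>t = g (T x) / q x\<close> compares the two logarithms up to a term whose integral is at most \<open>1\<close>.  The
  same inequality at \<open>t = 1 / g (T x)\<close> controls the negative part, so that finiteness is inherited.\<close>

lemma rel_entropy_distr_le:
  assumes R: "prob_space R" and Q: "prob_space Q" and sQ: "sets Q = sets R"
    and T [measurable]: "T \<in> R \<rightarrow>\<^sub>M N"
  shows "rel_entropy (distr Q N T) (distr R N T) \<le> rel_entropy Q R"
proof (cases "rel_entropy Q R < \<infinity>")
  case True
  interpret R: prob_space R by fact
  interpret Q: prob_space Q by fact
  have TQ: "T \<in> Q \<rightarrow>\<^sub>M N" using T sQ by (simp cong: measurable_cong_sets)
  note [measurable_cong] = sQ
  let ?R = "distr R N T" and ?Q = "distr Q N T"
  interpret R': prob_space ?R by (rule R.prob_space_distr) fact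
  interpret Q': prob_space ?Q by (rule Q.prob_space_distr) fact
  obtain q where q [measurable]: "q \<in> borel_measurable R" and q0: "\<And>x. q x \<ge> 0"
    and Qq: "Q = density R (\<lambda>x. ennreal (q x))" and il: "integrable Q (\<lambda>x. ln (q x))"
    and H: "rel_entropy Q R = ereal (\<integral>x. ln (q x) \<partial>Q)"
    using rel_entropy_finiteE[OF R Q True] by metis
  have "absolutely_continuous R Q" unfolding Qq by (rule absolutely_continuousI_density) auto
  then have "absolutely_continuous ?R ?Q"
    unfolding absolutely_continuous_def
    by (auto simp: null_sets_distr_iff[OF T] null_sets_distr_iff[OF TQ] sets_eq_imp_space_eq[OF sQ])
  then obtain g where g: "g \<in> borel_measurable ?R" and g0: "\<And>x. g x \<ge> 0"
    and Qg: "?Q = density ?R (\<lambda>x. ennreal (g x))"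
    using absolutely_continuous_real_density[of ?R ?Q] R'.prob_space_axioms Q'.prob_space_axioms
    by auto
  have [measurable]: "g \<in> borel_measurable N" using g by simp
  have posq: "AE x in Q. 0 < q x" using Qq by (intro AE_density_pos) auto
  have "AE y in ?Q. 0 < g y" using Qg g by (intro AE_density_pos) auto
  then have posg: "AE x in Q. 0 < g (T x)" by (subst (asm) AE_distr_iff) auto
  have n1: "(\<integral>\<^sup>+x. ennreal (g (T x) / q x) \<partial>Q) \<le> 1"
  proof -
    have "(\<integral>\<^sup>+x. ennreal (g (T x) / q x) \<partial>Q) = (\<integral>\<^sup>+x. ennreal (q x) * ennreal (g (T x) / q x) \<partial>R)"
      unfolding Qq by (subst nn_integral_density) auto
    also have "\<dots> \<le> (\<integral>\<^sup>+x. ennreal (g (T x)) \<partial>R)"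
    proof (rule nn_integral_mono)
      fix x show "ennreal (q x) * ennreal (g (T x) / q x) \<le> ennreal (g (T x))"
        using q0[of x] g0[of "T x"] by (cases "q x = 0") (auto simp: ennreal_mult[symmetric])
    qed
    also have "\<dots> = (\<integral>\<^sup>+y. ennreal (g y) \<partial>?R)" by (subst nn_integral_distr) auto
    also have "\<dots> = emeasure (density ?R (\<lambda>x. ennreal (g x))) (space N)"
      by (subst emeasure_density) (auto intro!: nn_integral_cong simp: space_distr)
    also have "\<dots> = 1" using Q'.emeasure_space_1 Qg by simp
    finally show ?thesis .
  qed
  have n2: "(\<integral>\<^sup>+x. ennreal (1 / g (T x)) \<partial>Q) \<le> 1"
  proof -
    have "(\<integral>\<^sup>+x. ennreal (1 / g (T x)) \<partial>Q) = (\<integral>\<^sup>+y. ennreal (1 / g y) \<partial>?Q)"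
      by (subst nn_integral_distr) auto
    also have "\<dots> = (\<integral>\<^sup>+y. ennreal (g y) * ennreal (1 / g y) \<partial>?R)"
      unfolding Qg by (subst nn_integral_density) auto
    also have "\<dots> \<le> (\<integral>\<^sup>+y. 1 \<partial>?R)"
    proof (rule nn_integral_mono)
      fix y show "ennreal (g y) * ennreal (1 / g y) \<le> 1"
        using g0[of y] by (cases "g y = 0") (auto simp: ennreal_mult[symmetric])
    qed
    also have "\<dots> = 1" using R'.emeasure_space_1 by simp
    finally show ?thesis .
  qed
  have i1: "integrable Q (\<lambda>x. g (T x) / q x)"
    using n1 g0 q0 by (intro integrableI_nonneg) (auto intro: le_less_trans)
  have i2: "integrable Q (\<lambda>x. 1 / g (T x))"
    using n2 g0 by (intro integrableI_nonneg) (auto intro: le_less_trans)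
  \<comment> \<open>the two applications of \<open>ln t \<le> t - 1\<close>\<close>
  have up: "AE x in Q. ln (g (T x)) \<le> ln (q x) + g (T x) / q x - 1"
    using posq posg
  proof eventually_elim
    case (elim x)
    then have "ln (g (T x) / q x) \<le> g (T x) / q x - 1" by (intro ln_le_minus_one) simp
    then show ?case using elim by (simp add: ln_div)
  qed
  have lo: "AE x in Q. 1 - 1 / g (T x) \<le> ln (g (T x))"
    using posg
  proof eventually_elim
    case (elim x)
    then have "ln (1 / g (T x)) \<le> 1 / g (T x) - 1" by (intro ln_le_minus_one) simp
    then show ?case using elim by (simp add: ln_div)
  qed
  have ilg: "integrable Q (\<lambda>x. ln (g (T x)))"
  proof (rule Bochner_Integration.integrable_bound)
    show "integrable Q (\<lambda>x. \<bar>ln (q x)\<bar> + g (T x) / q x + 1 / g (T x) + 1)"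
      using il i1 i2 by auto
    show "AE x in Q. norm (ln (g (T x))) \<le> norm (\<bar>ln (q x)\<bar> + g (T x) / q x + 1 / g (T x) + 1)"
      using up lo posg posq
    proof eventually_elim
      case (elim x)
      have "g (T x) / q x \<ge> 0" "1 / g (T x) \<ge> 0" using elim by simp_all
      then show ?case unfolding real_norm_def using elim(1,2) by linarith
    qed
  qed auto
  have "(\<integral>x. ln (g (T x)) \<partial>Q) \<le> (\<integral>x. ln (q x) + g (T x) / q x - 1 \<partial>Q)"
    using up il i1 ilg by (intro integral_mono_AE) auto
  also have "\<dots> = (\<integral>x. ln (q x) \<partial>Q) + (\<integral>x. g (T x) / q x \<partial>Q) - 1"
    using il i1 by (simp add: Q.prob_space)
  also have "(\<integral>x. g (T x) / q x \<partial>Q) \<le> 1"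
    using nn_integral_eq_integral[OF i1] n1 g0 q0 by simp
  finally have le: "(\<integral>x. ln (g (T x)) \<partial>Q) \<le> (\<integral>x. ln (q x) \<partial>Q)" by simp
  have "rel_entropy ?Q ?R = (if integrable ?Q (\<lambda>x. ln (g x)) then ereal (\<integral>x. ln (g x) \<partial>?Q) else \<infinity>)"
    using rel_entropy_density_ln[of ?R g] R'.prob_space_axioms Q'.prob_space_axioms g g0 Qg by simp
  also have "\<dots> = ereal (\<integral>x. ln (g (T x)) \<partial>Q)"
    using ilg by (simp add: integrable_distr_eq integral_distr)
  finally show ?thesis using H le by simp
qed simp

text \<open>Changing the reference measure by an integrable log-density adds a linear term to the entropy.
  Applied to functions \<open>k\<close> of one coordinate, this is the Pythagorean identity behind the Sinkhorn
  iteration.\<close>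

lemma rel_entropy_shift:
  assumes R: "prob_space R" and R': "prob_space (density R (\<lambda>x. ennreal (exp (k x))))"
    and Q: "prob_space Q" and sQ: "sets Q = sets R"
    and k [measurable]: "k \<in> borel_measurable R" and ik: "integrable Q k"
  shows "rel_entropy Q R
       = rel_entropy Q (density R (\<lambda>x. ennreal (exp (k x)))) + ereal (\<integral>x. k x \<partial>Q)"
proof (cases "absolutely_continuous R Q")
  case True
  let ?R = "density R (\<lambda>x. ennreal (exp (k x)))"
  note [measurable_cong] = sQ
  obtain q where q [measurable]: "q \<in> borel_measurable R" and q0: "\<And>x. q x \<ge> 0"
    and Qq: "Q = density R (\<lambda>x. ennreal (q x))"
    using absolutely_continuous_real_density[OF R Q True sQ] by metis
  have Qq': "Q = density ?R (\<lambda>x. ennreal (q x * exp (- k x)))"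
    unfolding Qq by (subst density_density_eq)
      (auto simp: ennreal_mult[symmetric] q0 exp_minus field_simps intro!: density_cong)
  have posq: "AE x in Q. 0 < q x" using Qq by (intro AE_density_pos) auto
  have 1: "rel_entropy Q R = (if integrable Q (\<lambda>x. ln (q x)) then ereal (\<integral>x. ln (q x) \<partial>Q) else \<infinity>)"
    using rel_entropy_density_ln[OF R _ q q0] Qq Q by simp
  have 2: "rel_entropy Q ?R = (if integrable Q (\<lambda>x. ln (q x * exp (- k x)))
      then ereal (\<integral>x. ln (q x * exp (- k x)) \<partial>Q) else \<infinity>)"
    using rel_entropy_density_ln[OF R', of "\<lambda>x. q x * exp (- k x)"] Qq' q0 Q by simp
  have AE: "AE x in Q. ln (q x * exp (- k x)) = ln (q x) - k x"
    using posq by eventually_elim (simp add: ln_mult)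
  have "integrable Q (\<lambda>x. ln (q x * exp (- k x))) \<longleftrightarrow> integrable Q (\<lambda>x. ln (q x) - k x)"
    using AE by (intro integrable_cong_AE) auto
  also have "\<dots> \<longleftrightarrow> integrable Q (\<lambda>x. ln (q x))"
    using Bochner_Integration.integrable_add[OF _ ik, of "\<lambda>x. ln (q x) - k x"] ik by auto
  finally have i: "integrable Q (\<lambda>x. ln (q x * exp (- k x))) \<longleftrightarrow> integrable Q (\<lambda>x. ln (q x))" .
  have "(\<integral>x. ln (q x * exp (- k x)) \<partial>Q) = (\<integral>x. ln (q x) - k x \<partial>Q)"
    using AE by (intro integral_cong_AE) auto
  then show ?thesis using 1 2 i ik by auto
next
  case False
  let ?R = "density R (\<lambda>x. ennreal (exp (k x)))"
  have "\<not> absolutely_continuous ?R Q"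
  proof
    assume "absolutely_continuous ?R Q"
    moreover have "absolutely_continuous R ?R" by (rule absolutely_continuousI_density) auto
    ultimately show False using False by (auto simp: absolutely_continuous_def)
  qed
  then show ?thesis using False by (simp add: rel_entropy_def)
qed

text \<open>The second form is a nonnegative integral against the first measure, which is what can be
  disintegrated along a transition.\<close>

lemma rel_entropy_exp_density:
  assumes R: "prob_space R" and Q: "prob_space (density R (\<lambda>x. ennreal (exp (k x))))"
    and k [measurable]: "k \<in> borel_measurable R"
  defines "Q \<equiv> density R (\<lambda>x. ennreal (exp (k x)))"
  shows "rel_entropy Q R = (if integrable Q k then ereal (\<integral>x. k x \<partial>Q) else \<infinity>)"
    and "rel_entropy Q R = enn2ereal (\<integral>\<^sup>+x. ennreal (k x - 1 + exp (- k x)) \<partial>Q)"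
proof -
  show "rel_entropy Q R = (if integrable Q k then ereal (\<integral>x. k x \<partial>Q) else \<infinity>)"
    using rel_entropy_density_ln[OF R, of "\<lambda>x. exp (k x)"] Q by (simp add: Q_def)
  have "ennreal (entropy_fun (exp (k x))) = ennreal (exp (k x)) * ennreal (k x - 1 + exp (- k x))" for x
  proof -
    have "0 \<le> k x - 1 + exp (- k x)" using exp_ge_add_one_self[of "- k x"] by simp
    then show ?thesis
      by (simp add: ennreal_mult[symmetric] entropy_fun_def algebra_simps exp_minus)
  qed
  then show "rel_entropy Q R = enn2ereal (\<integral>\<^sup>+x. ennreal (k x - 1 + exp (- k x)) \<partial>Q)"
    using rel_entropy_density[OF R, of "\<lambda>x. exp (k x)"] Q
    by (simp add: Q_def nn_integral_density)
qed

section \<open>Existence of the entropy minimising coupling\<close>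

text \<open>A pointwise lower bound of the relative entropy by the Hellinger distance, from
  \<open>ln t \<le> t - 1\<close> at \<open>t = sqrt (m / a)\<close>.\<close>

lemma entropy_fun_diff_ge:
  assumes "a \<ge> 0" "m > 0"
  shows "a * (ln a - ln m) \<ge> a - m + (sqrt a - sqrt m)\<^sup>2"
proof (cases "a = 0")
  case False
  then have a: "a > 0" using assms by simp
  have "ln (sqrt (m / a)) \<le> sqrt (m / a) - 1" using a assms by (intro ln_le_minus_one) simp
  then have "ln m - ln a \<le> 2 * (sqrt m / sqrt a) - 2"
    using a assms by (simp add: ln_sqrt ln_div real_sqrt_divide)
  then have "a * (ln m - ln a) \<le> a * (2 * (sqrt m / sqrt a) - 2)"
    using a by (intro mult_left_mono) auto
  also have "\<dots> = 2 * (sqrt a * sqrt a) * sqrt m / sqrt a - 2 * a"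
    using a by (simp add: algebra_simps)
  also have "\<dots> = 2 * (sqrt a * sqrt m) - 2 * a" using a by (simp add: field_simps)
  finally show ?thesis using a assms by (simp add: power2_diff algebra_simps)
qed (use assms in simp)

text \<open>Quantitative strict convexity: the gap is the sum of the divergences of \<open>a\<close> and \<open>b\<close> from their
  midpoint, and each dominates a squared Hellinger distance.\<close>

lemma entropy_fun_midpoint_gap:
  assumes "a \<ge> 0" "b \<ge> 0"
  shows "(sqrt a - sqrt b)\<^sup>2 / 4
       \<le> (entropy_fun a + entropy_fun b) / 2 - entropy_fun ((a + b) / 2)"
proof (cases "a + b = 0")
  case False
  define m where "m = (a + b) / 2"
  have m: "m > 0" using False assms by (auto simp: m_def)
  have ab: "a + b = 2 * m" by (simp add: m_def)
  have "a * (ln a - ln m) + b * (ln b - ln m) \<ge> (sqrt a - sqrt m)\<^sup>2 + (sqrt b - sqrt m)\<^sup>2"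
    using entropy_fun_diff_ge[OF assms(1) m] entropy_fun_diff_ge[OF assms(2) m] ab by linarith
  moreover have "(entropy_fun a + entropy_fun b) / 2 - entropy_fun m
      = (a * (ln a - ln m) + b * (ln b - ln m)) / 2"
  proof -
    have "a * ln m + b * ln m = 2 * (m * ln m)" using ab by (metis distrib_right mult.assoc)
    then show ?thesis unfolding entropy_fun_def right_diff_distrib using ab by argo
  qed
  moreover have "(sqrt a - sqrt m)\<^sup>2 + (sqrt b - sqrt m)\<^sup>2 \<ge> (sqrt a - sqrt b)\<^sup>2 / 2"
  proof -
    have "2 * ((x - z)\<^sup>2 + (y - z)\<^sup>2) = (x - y)\<^sup>2 + (x + y - 2 * z)\<^sup>2" for x y z :: real
      by (simp add: power2_eq_square algebra_simps)
    from this[of "sqrt a" "sqrt m" "sqrt b"] show ?thesis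
      using zero_le_power2[of "sqrt a + sqrt b - 2 * sqrt m"] by argo
  qed
  ultimately show ?thesis unfolding m_def[symmetric] by argo
next
  case True
  then have "a = 0" "b = 0" using assms by auto
  then show ?thesis by (simp add: entropy_fun_def)
qed

text \<open>Pinsker's inequality in a form that integrates pointwise: the free parameter \<open>t\<close> replaces the
  Cauchy-Schwarz inequality for the product of \<open>sqrt a - sqrt b\<close> and \<open>sqrt a + sqrt b\<close>.\<close>

lemma abs_diff_le_entropy_gap:
  assumes "a \<ge> 0" "b \<ge> 0" "t > 0"
  shows "\<bar>a - b\<bar> \<le> t * (a + b)
       + 2 / t * ((entropy_fun a + entropy_fun b) / 2 - entropy_fun ((a + b) / 2))"
proof -
  define s d where "s = sqrt a + sqrt b" and "d = \<bar>sqrt a - sqrt b\<bar>"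
  have sd: "s \<ge> 0" "d \<ge> 0" using assms by (auto simp: s_def d_def)
  have "a - b = (sqrt a - sqrt b) * s" using assms by (simp add: s_def algebra_simps)
  then have "\<bar>a - b\<bar> = d * s" using sd by (simp add: abs_mult d_def)
  also have "d * s \<le> t / 2 * s\<^sup>2 + 1 / (2 * t) * d\<^sup>2"
  proof -
    \<comment> \<open>Young's inequality\<close>
    have "0 \<le> (t * s - d)\<^sup>2 / (2 * t)" using assms by simp
    then show ?thesis using assms by (simp add: power2_eq_square field_simps)
  qed
  also have "s\<^sup>2 \<le> 2 * (a + b)"
  proof -
    have "0 \<le> (sqrt a - sqrt b)\<^sup>2" by simp
    then show ?thesis using assms by (simp add: s_def power2_eq_square algebra_simps)
  qed
  also have "d\<^sup>2 \<le> 4 * ((entropy_fun a + entropy_fun b) / 2 - entropy_fun ((a + b) / 2))"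
    using entropy_fun_midpoint_gap[OF assms(1,2)] unfolding d_def power2_abs by argo
  finally show ?thesis using assms by (simp add: field_simps)
qed

text \<open>Continuity at \<open>0\<close> matters because limits of densities may vanish.\<close>

lemma continuous_on_entropy_fun: "continuous_on {0..} entropy_fun"
proof -
  have lim: "((\<lambda>x::real. x * ln x) \<longlongrightarrow> 0) (at_right 0)" by real_asymp
  have "continuous_on {0..} (\<lambda>x::real. x * ln x)"
    unfolding continuous_on_def
  proof
    fix x :: real assume "x \<in> {0..}"
    show "((\<lambda>x. x * ln x) \<longlongrightarrow> x * ln x) (at x within {0..})"
    proof (cases "x = 0")
      case True
      have "at (0::real) within {0..} = at_right 0"
        unfolding at_within_def by (intro arg_cong[where f = "\<lambda>s. inf (nhds 0) (principal s)"]) auto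
      then show ?thesis using lim True by simp
    next
      case False
      then show ?thesis using \<open>x \<in> {0..}\<close> by (auto intro!: tendsto_intros)
    qed
  qed
  then have "continuous_on {0..} (\<lambda>x::real. x * ln x - x + 1)"
    by (intro continuous_on_add continuous_on_diff continuous_on_id continuous_on_const)
  then show ?thesis by (simp add: entropy_fun_def[abs_def])
qed

locale coupling_projection =
  fixes P :: "('a::euclidean_space \<times> 'a) measure" and \<mu> \<eta> :: "'a measure"
  assumes P: "prob_space P" and \<mu>: "prob_space \<mu>" and \<eta>: "prob_space \<eta>"
    and sP [measurable_cong]: "sets P = sets (borel \<Otimes>\<^sub>M borel)"
    and s\<mu> [measurable_cong]: "sets \<mu> = sets borel" and s\<eta> [measurable_cong]: "sets \<eta> = sets borel"
begin

interpretation P: prob_space P by (rule P)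
interpretation \<mu>: prob_space \<mu> by (rule \<mu>)
interpretation \<eta>: prob_space \<eta> by (rule \<eta>)

text \<open>Densities of couplings with respect to \<open>P\<close>.  The marginal conditions are tested on Borel sets by
  real integrals, which are visibly stable under convex combinations and \<open>L\<^sup>1\<close> limits.\<close>

definition coupling_density :: "('a \<times> 'a \<Rightarrow> real) \<Rightarrow> bool" where
  "coupling_density q \<longleftrightarrow> q \<in> borel_measurable P \<and> (\<forall>x. 0 \<le> q x) \<and> integrable P q \<and>
     (\<forall>B\<in>sets borel. (\<integral>x. q x * indicat_real B (fst x) \<partial>P) = measure \<mu> B \<and>
                      (\<integral>x. q x * indicat_real B (snd x) \<partial>P) = measure \<eta> B)"

lemma emeasure_distr_density:
  assumes q [measurable]: "integrable P q" and q0: "\<And>x. 0 \<le> q x"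
    and T [measurable]: "T \<in> borel \<Otimes>\<^sub>M borel \<rightarrow>\<^sub>M borel" and B [measurable]: "B \<in> sets borel"
  shows "emeasure (distr (density P (\<lambda>x. ennreal (q x))) borel T) B
       = ennreal (\<integral>x. q x * indicat_real B (T x) \<partial>P)"
proof -
  have [measurable]: "T \<in> P \<rightarrow>\<^sub>M borel" using T by simp
  have "integrable P (\<lambda>x. q x * indicat_real B (T x))"
    using q q0 by (intro Bochner_Integration.integrable_bound[OF q]) (auto simp: indicator_def)
  then have *: "(\<integral>\<^sup>+x. ennreal (q x * indicat_real B (T x)) \<partial>P)
      = ennreal (\<integral>x. q x * indicat_real B (T x) \<partial>P)"
    using q0 by (intro nn_integral_eq_integral) auto
  have "emeasure (distr (density P (\<lambda>x. ennreal (q x))) borel T) B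
      = emeasure (density P (\<lambda>x. ennreal (q x))) (T -` B \<inter> space P)"
    by (subst emeasure_distr) auto
  also have "\<dots> = (\<integral>\<^sup>+x. ennreal (q x) * indicator (T -` B \<inter> space P) x \<partial>P)"
    by (subst emeasure_density) auto
  also have "\<dots> = (\<integral>\<^sup>+x. ennreal (q x * indicat_real B (T x)) \<partial>P)"
    by (intro nn_integral_cong) (auto simp: indicator_def)
  finally show ?thesis using * by simp
qed

lemma prob_space_coupling:
  assumes "Q \<in> couplings \<mu> \<eta>" shows "prob_space Q"
proof -
  have s: "sets Q = sets (borel \<Otimes>\<^sub>M borel)" and d: "distr Q borel fst = \<mu>"
    using assms by (auto simp: couplings_def)
  have [measurable]: "fst \<in> Q \<rightarrow>\<^sub>M borel" using s by (simp cong: measurable_cong_sets)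
  show ?thesis using \<mu> d by (intro prob_space_distrD[of fst Q borel]) auto
qed

lemma coupling_density_iff:
  assumes q [measurable]: "q \<in> borel_measurable P" and q0: "\<And>x. 0 \<le> q x"
  shows "density P (\<lambda>x. ennreal (q x)) \<in> couplings \<mu> \<eta> \<longleftrightarrow> coupling_density q"
proof
  let ?Q = "density P (\<lambda>x. ennreal (q x))"
  assume Q: "?Q \<in> couplings \<mu> \<eta>"
  interpret Q: prob_space ?Q by (rule prob_space_coupling[OF Q])
  have "(\<integral>\<^sup>+x. ennreal (q x) \<partial>P) = 1"
    using Q.emeasure_space_1 by (simp add: emeasure_density cong: nn_integral_cong)
  then have iq: "integrable P q" using q0 by (intro integrableI_nonneg) auto
  have nn: "0 \<le> (\<integral>x. q x * indicat_real B (T x) \<partial>P)" for B :: "'a set" and T :: "'a \<times> 'a \<Rightarrow> 'a"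
    using q0 by (intro integral_nonneg_AE) auto
  show "coupling_density q"
    unfolding coupling_density_def
  proof (intro conjI ballI allI)
    fix B :: "'a set" assume B: "B \<in> sets borel"
    have "distr ?Q borel fst = \<mu>" "distr ?Q borel snd = \<eta>" using Q by (auto simp: couplings_def)
    then have "ennreal (measure \<mu> B) = ennreal (\<integral>x. q x * indicat_real B (fst x) \<partial>P)"
      "ennreal (measure \<eta> B) = ennreal (\<integral>x. q x * indicat_real B (snd x) \<partial>P)"
      using emeasure_distr_density[OF iq q0 _ B, of fst] emeasure_distr_density[OF iq q0 _ B, of snd]
      by (simp_all add: \<mu>.emeasure_eq_measure \<eta>.emeasure_eq_measure)
    then show "(\<integral>x. q x * indicat_real B (fst x) \<partial>P) = measure \<mu> B"
        "(\<integral>x. q x * indicat_real B (snd x) \<partial>P) = measure \<eta> B"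
      using nn by (auto simp: ennreal_inj)
  qed (use iq q0 in auto)
next
  let ?Q = "density P (\<lambda>x. ennreal (q x))"
  assume Q: "coupling_density q"
  then have iq: "integrable P q" by (simp add: coupling_density_def)
  show "?Q \<in> couplings \<mu> \<eta>"
    unfolding couplings_def
  proof (intro CollectI conjI)
    show "distr ?Q borel fst = \<mu>"
    proof (rule measure_eqI)
      fix B :: "'a set" assume "B \<in> sets (distr ?Q borel fst)"
      then have B: "B \<in> sets borel" by simp
      show "emeasure (distr ?Q borel fst) B = emeasure \<mu> B"
        using Q B emeasure_distr_density[OF iq q0 _ B, of fst]
        by (simp add: coupling_density_def \<mu>.emeasure_eq_measure)
    qed (simp add: s\<mu>)
    show "distr ?Q borel snd = \<eta>"
    proof (rule measure_eqI)
      fix B :: "'a set" assume "B \<in> sets (distr ?Q borel snd)"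
      then have B: "B \<in> sets borel" by simp
      show "emeasure (distr ?Q borel snd) B = emeasure \<eta> B"
        using Q B emeasure_distr_density[OF iq q0 _ B, of snd]
        by (simp add: coupling_density_def \<eta>.emeasure_eq_measure)
    qed (simp add: s\<eta>)
  qed (simp add: sP)
qed

lemma coupling_density_integral:
  assumes "coupling_density q" shows "(\<integral>x. q x \<partial>P) = 1"
proof -
  have "(\<integral>x. q x * indicat_real UNIV (fst x) \<partial>P) = measure \<mu> UNIV"
    using assms unfolding coupling_density_def by (metis borel_open open_UNIV)
  moreover have "space \<mu> = UNIV" using sets_eq_imp_space_eq[OF s\<mu>] by simp
  ultimately show ?thesis using \<mu>.prob_space by simp
qed

lemma coupling_density_midpoint:
  assumes a: "coupling_density a" and b: "coupling_density b"
  shows "coupling_density (\<lambda>x. (a x + b x) / 2)"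
  unfolding coupling_density_def
proof (intro conjI ballI allI)
  have [measurable]: "a \<in> borel_measurable P" "b \<in> borel_measurable P"
    and i: "integrable P a" "integrable P b" and n: "\<And>x. 0 \<le> a x" "\<And>x. 0 \<le> b x"
    using a b by (auto simp: coupling_density_def)
  show "(\<lambda>x. (a x + b x) / 2) \<in> borel_measurable P" by measurable
  show "integrable P (\<lambda>x. (a x + b x) / 2)" using i by simp
  show "0 \<le> (a x + b x) / 2" for x using n by simp
  fix B :: "'a set" assume B [measurable]: "B \<in> sets borel"
  have mean: "(\<integral>x. (a x + b x) / 2 * indicat_real B (T x) \<partial>P)
      = ((\<integral>x. a x * indicat_real B (T x) \<partial>P) + (\<integral>x. b x * indicat_real B (T x) \<partial>P)) / 2"
    if [measurable]: "T \<in> borel \<Otimes>\<^sub>M borel \<rightarrow>\<^sub>M borel" for T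
  proof -
    have ia: "integrable P (\<lambda>x. a x * indicat_real B (T x))"
      using n i by (intro Bochner_Integration.integrable_bound[OF i(1)]) (auto simp: indicator_def)
    have ib: "integrable P (\<lambda>x. b x * indicat_real B (T x))"
      using n i by (intro Bochner_Integration.integrable_bound[OF i(2)]) (auto simp: indicator_def)
    have "(\<lambda>x. (a x + b x) / 2 * indicat_real B (T x))
        = (\<lambda>x. (a x * indicat_real B (T x) + b x * indicat_real B (T x)) / 2)"
      by (auto simp: field_simps)
    then show ?thesis using ia ib by simp
  qed
  show "(\<integral>x. (a x + b x) / 2 * indicat_real B (fst x) \<partial>P) = measure \<mu> B"
    using a b B by (subst mean) (simp_all add: coupling_density_def)
  show "(\<integral>x. (a x + b x) / 2 * indicat_real B (snd x) \<partial>P) = measure \<eta> B"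
    using a b B by (subst mean) (simp_all add: coupling_density_def)
qed

lemma coupling_density_L1_limit:
  assumes f: "\<And>n. coupling_density (f n)" and q: "integrable P q" "\<And>x. 0 \<le> q x"
    and L1: "\<And>e. e > 0 \<Longrightarrow> \<exists>n. (\<integral>x. \<bar>f n x - q x\<bar> \<partial>P) \<le> e"
  shows "coupling_density q"
  unfolding coupling_density_def
proof (intro conjI ballI allI)
  fix B :: "'a set" assume B [measurable]: "B \<in> sets borel"
  have eq: "(\<integral>x. q x * indicat_real B (T x) \<partial>P) = m"
    if T [measurable]: "T \<in> borel \<Otimes>\<^sub>M borel \<rightarrow>\<^sub>M borel"
      and m: "\<And>n. (\<integral>x. f n x * indicat_real B (T x) \<partial>P) = m" for T m
  proof -
    let ?i = "\<lambda>x. indicat_real B (T x)"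
    let ?I = "\<lambda>q. \<integral>x. q x * ?i x \<partial>P"
    have "\<bar>?I q - m\<bar> \<le> e" if "e > 0" for e
    proof -
      obtain n where n: "(\<integral>x. \<bar>f n x - q x\<bar> \<partial>P) \<le> e" using L1 \<open>e > 0\<close> by blast
      have fi: "integrable P (f n)" using f by (simp add: coupling_density_def)
      note [measurable] = borel_measurable_integrable[OF fi] borel_measurable_integrable[OF q(1)]
      have iq: "integrable P (\<lambda>x. q x * ?i x)"
        by (intro Bochner_Integration.integrable_bound[OF q(1)]) (auto simp: indicator_def)
      have ifn: "integrable P (\<lambda>x. f n x * ?i x)"
        by (intro Bochner_Integration.integrable_bound[OF fi]) (auto simp: indicator_def)
      have "\<bar>?I q - m\<bar>
          = \<bar>\<integral>x. q x * ?i x - f n x * ?i x \<partial>P\<bar>"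
        using iq ifn m[of n] by simp
      also have "\<dots> \<le> (\<integral>x. \<bar>q x * ?i x - f n x * ?i x\<bar> \<partial>P)"
        using integral_norm_bound[of P "\<lambda>x. q x * ?i x - f n x * ?i x"]
        by simp
      also have "\<dots> \<le> (\<integral>x. \<bar>f n x - q x\<bar> \<partial>P)"
        using iq ifn fi q(1) by (intro integral_mono) (auto simp: indicator_def)
      finally show ?thesis using n by simp
    qed
    then have "\<bar>?I q - m\<bar> \<le> 0" 
      using field_le_epsilon[of "\<bar>?I q - m\<bar>" 0] by simp
    then show ?thesis by simp
  qed
  show "(\<integral>x. q x * indicat_real B (fst x) \<partial>P) = measure \<mu> B"
    "(\<integral>x. q x * indicat_real B (snd x) \<partial>P) = measure \<eta> B"
    using f B by (auto intro!: eq simp: coupling_density_def)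
qed (use q in auto)

text \<open>A Cauchy sequence has an almost everywhere convergent subsequence; by Fatou the sequence also
  converges to that limit in \<open>L\<^sup>1\<close>, so the marginals pass to the limit.\<close>

lemma coupling_density_L1_complete:
  fixes s :: "nat \<Rightarrow> 'a \<times> 'a \<Rightarrow> real"
  assumes s: "\<And>n. coupling_density (s n)"
    and Cauchy: "\<And>e. e > 0 \<Longrightarrow> \<exists>N. \<forall>i\<ge>N. \<forall>j\<ge>N. (LINT x|P. norm (s i x - s j x)) < e"
  obtains q r where "coupling_density q" "strict_mono r" "AE x in P. (\<lambda>i. s (r i) x) \<longlonglongrightarrow> q x"
proof -
  have si: "\<And>n. integrable P (s n)" and s0: "\<And>n x. 0 \<le> s n x"
    using s by (auto simp: coupling_density_def)
  note [measurable] = borel_measurable_integrable[OF si]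
  obtain r where r: "strict_mono r" and AEC: "AE x in P. Cauchy (\<lambda>i. s (r i) x)"
    using cauchy_L1_AE_cauchy_subseq[OF si Cauchy] by blast
  \<comment> \<open>the maximum with \<open>0\<close> guards the points where the limit does not exist\<close>
  define q where "q x = max 0 (lim (\<lambda>i. s (r i) x))" for x
  let ?N = "\<lambda>i. \<integral>\<^sup>+x. ennreal \<bar>s (r i) x - q x\<bar> \<partial>P"
  have [measurable]: "q \<in> borel_measurable P" unfolding q_def by measurable
  have q0: "0 \<le> q x" for x by (simp add: q_def)
  have AEq: "AE x in P. (\<lambda>i. s (r i) x) \<longlonglongrightarrow> q x"
    using AEC
  proof eventually_elim
    case (elim x)
    then have l: "(\<lambda>i. s (r i) x) \<longlonglongrightarrow> lim (\<lambda>i. s (r i) x)"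
      by (simp add: Cauchy_convergent_iff convergent_LIMSEQ_iff)
    then have "0 \<le> lim (\<lambda>i. s (r i) x)" by (rule LIMSEQ_le_const) (simp add: s0)
    then show ?case using l by (simp add: q_def)
  qed
  have L1: "\<exists>N. \<forall>i\<ge>N. ?N i \<le> ennreal e" if "e > 0" for e
  proof -
    obtain N where N: "\<And>i j. i \<ge> N \<Longrightarrow> j \<ge> N \<Longrightarrow> (LINT x|P. norm (s i x - s j x)) < e"
      using Cauchy[OF \<open>e > 0\<close>] by blast
    have "?N i \<le> ennreal e" if i: "i \<ge> N" for i
    proof -
      have "?N i
          = (\<integral>\<^sup>+x. liminf (\<lambda>j. ennreal \<bar>s (r i) x - s (r j) x\<bar>) \<partial>P)"
      proof (rule nn_integral_cong_AE, use AEq in eventually_elim)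
        case (elim x)
        then have "(\<lambda>j. ennreal \<bar>s (r i) x - s (r j) x\<bar>) \<longlonglongrightarrow> ennreal \<bar>s (r i) x - q x\<bar>"
          by (intro tendsto_ennrealI tendsto_intros)
        then show ?case using lim_imp_Liminf[OF sequentially_bot] by force
      qed
      also have "\<dots> \<le> liminf (\<lambda>j. \<integral>\<^sup>+x. ennreal \<bar>s (r i) x - s (r j) x\<bar> \<partial>P)"
        by (rule nn_integral_liminf) measurable
      also have "\<dots> \<le> ennreal e"
      proof (rule Liminf_le)
        show "\<forall>\<^sub>F j in sequentially. (\<integral>\<^sup>+x. ennreal \<bar>s (r i) x - s (r j) x\<bar> \<partial>P) \<le> ennreal e"
        proof (rule eventually_sequentiallyI[of N])
          fix j assume "j \<ge> N"
          have "r i \<ge> N" "r j \<ge> N"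
            using seq_suble[OF r, of i] seq_suble[OF r, of j] i \<open>j \<ge> N\<close> by simp_all
          then have "(\<integral>x. \<bar>s (r i) x - s (r j) x\<bar> \<partial>P) < e" using N by simp
          moreover have "(\<integral>\<^sup>+x. ennreal \<bar>s (r i) x - s (r j) x\<bar> \<partial>P)
              = ennreal (\<integral>x. \<bar>s (r i) x - s (r j) x\<bar> \<partial>P)"
            using si by (intro nn_integral_eq_integral) auto
          ultimately show "(\<integral>\<^sup>+x. ennreal \<bar>s (r i) x - s (r j) x\<bar> \<partial>P) \<le> ennreal e"
            by (simp add: ennreal_leI)
        qed
      qed simp
      finally show ?thesis .
    qed
    then show ?thesis by blast
  qed
  have diff: "integrable P (\<lambda>x. s (r i) x - q x)"
    if "?N i \<le> ennreal e" for i e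
    using that by (intro integrableI_bounded) (auto intro: le_less_trans)
  obtain N1 where "?N N1 \<le> ennreal 1"
    using L1[of 1] by auto
  then have "integrable P (\<lambda>x. s (r N1) x - (s (r N1) x - q x))"
    by (intro Bochner_Integration.integrable_diff[OF si diff])
  then have iq: "integrable P q" by simp
  have "coupling_density q"
  proof (rule coupling_density_L1_limit[of "\<lambda>i. s (r i)", OF s iq q0])
    fix e :: real assume "e > 0"
    then obtain i where i: "?N i \<le> ennreal e" using L1 by blast
    have "?N i = ennreal (\<integral>x. \<bar>s (r i) x - q x\<bar> \<partial>P)"
      using diff[OF i] by (intro nn_integral_eq_integral) auto
    then show "\<exists>n. (\<integral>x. \<bar>s (r n) x - q x\<bar> \<partial>P) \<le> e" using i \<open>e > 0\<close> by auto
  qed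
  then show ?thesis using that r AEq by blast
qed

text \<open>Along a minimising sequence the midpoints are couplings as well, so their entropies cannot
  fall below the infimum.  The convexity gap then forces the sequence to be Cauchy in \<open>L\<^sup>1\<close>, and the
  limit is a minimiser by Fatou.\<close>

lemma exists_minimal_entropy:
  assumes fin: "Q0 \<in> couplings \<mu> \<eta>" "rel_entropy Q0 P < \<infinity>"
  shows "\<exists>Q\<in>couplings \<mu> \<eta>. \<forall>Q'\<in>couplings \<mu> \<eta>. rel_entropy Q P \<le> rel_entropy Q' P"
proof -
  define J where "J q = (\<integral>\<^sup>+x. ennreal (entropy_fun (q x)) \<partial>P)" for q :: "'a \<times> 'a \<Rightarrow> real"
  have Jq: "rel_entropy (density P (\<lambda>x. ennreal (q x))) P = enn2ereal (J q)"
    if "coupling_density q" for q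
    unfolding J_def using that coupling_density_iff[of q]
    by (intro rel_entropy_density[OF P] prob_space_coupling) (auto simp: coupling_density_def)
  have ex: "\<exists>q. coupling_density q \<and> Q = density P (\<lambda>x. ennreal (q x))"
    if Q: "Q \<in> couplings \<mu> \<eta>" "rel_entropy Q P < \<infinity>" for Q
  proof -
    obtain q where "q \<in> borel_measurable P" "\<And>x. q x \<ge> 0" "Q = density P (\<lambda>x. ennreal (q x))"
      using rel_entropy_finiteE[OF P prob_space_coupling[OF Q(1)] Q(2)] by metis
    then show ?thesis using coupling_density_iff[of q] Q by auto
  qed
  define m where "m = (INF q\<in>Collect coupling_density. J q)"
  have mle: "m \<le> J q" if "coupling_density q" for q
    unfolding m_def using that by (intro INF_lower) auto
  obtain q0 where q0: "coupling_density q0" "Q0 = density P (\<lambda>x. ennreal (q0 x))"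
    using ex[OF fin] by auto
  have "J q0 < \<infinity>" using Jq[OF q0(1)] q0(2) fin(2) by (cases "J q0") auto
  then have mfin: "m < \<infinity>" using mle[OF q0(1)] by (rule le_less_trans[rotated])
  have "\<exists>q. coupling_density q \<and> J q < m + ennreal (1 / (real n + 1))" for n
  proof -
    have "m < m + ennreal (1 / (real n + 1))"
      using mfin by (cases m) (auto simp: ennreal_plus[symmetric] ennreal_less_iff simp del: ennreal_plus)
    then show ?thesis unfolding m_def by (subst (asm) INF_less_iff) auto
  qed
  then obtain s where s: "\<And>n. coupling_density (s n)"
    and sm: "\<And>n. J (s n) < m + ennreal (1 / (real n + 1))" by metis
  have si: "\<And>n. integrable P (s n)" and s0: "\<And>n x. 0 \<le> s n x"
    using s by (auto simp: coupling_density_def)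
  note [measurable] = borel_measurable_integrable[OF si]
  define M where "M = enn2real m"
  have mM: "m = ennreal M" using mfin by (simp add: M_def)
  have M0: "M \<ge> 0" by (simp add: M_def)
  define \<Phi> where "\<Phi> q = (\<integral>x. entropy_fun (q x) \<partial>P)" for q :: "'a \<times> 'a \<Rightarrow> real"
  have I: "integrable P (\<lambda>x. entropy_fun (q x))" and JPhi: "J q = ennreal (\<Phi> q)"
    if q: "coupling_density q" "J q < \<infinity>" for q
  proof -
    have [measurable]: "q \<in> borel_measurable P" and n: "\<And>x. 0 \<le> q x"
      using q by (auto simp: coupling_density_def)
    show i: "integrable P (\<lambda>x. entropy_fun (q x))"
      using q(2) n unfolding J_def by (intro integrableI_nonneg) (auto simp: entropy_fun_nonneg)
    show "J q = ennreal (\<Phi> q)"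
      unfolding J_def \<Phi>_def using i n
      by (intro nn_integral_eq_integral) (auto simp: entropy_fun_nonneg)
  qed
  have sfin: "J (s n) < \<infinity>" for n
    using sm[of n] mfin by (auto intro: less_trans simp: less_top)
  have Phis: "\<Phi> (s n) \<le> M + 1 / (real n + 1)" for n
  proof -
    have "ennreal (\<Phi> (s n)) < ennreal (M + 1 / (real n + 1))"
      using sm[of n] JPhi[OF s sfin] M0 by (simp add: mM ennreal_plus[symmetric] del: ennreal_plus)
    then show ?thesis using M0 by (subst (asm) ennreal_less_iff[OF _]) (auto simp: \<Phi>_def entropy_fun_nonneg s0)
  qed
  have L1: "(\<integral>x. \<bar>s i x - s j x\<bar> \<partial>P) \<le> 2 * t + (1 / (real i + 1) + 1 / (real j + 1)) / t"
    if t: "t > 0" for i j t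
  proof -
    let ?m = "\<lambda>x. (s i x + s j x) / 2"
    have cm: "coupling_density ?m" by (rule coupling_density_midpoint[OF s s])
    have le: "entropy_fun (?m x) \<le> (entropy_fun (s i x) + entropy_fun (s j x)) / 2" for x
      using entropy_fun_midpoint_gap[OF s0 s0, of i x j x] zero_le_power2[of "sqrt (s i x) - sqrt (s j x)"]
      by linarith
    have Ii: "integrable P (\<lambda>x. entropy_fun (s n x))" for n using I[OF s sfin] .
    have im: "integrable P (\<lambda>x. entropy_fun (?m x))"
    proof (rule Bochner_Integration.integrable_bound)
      show "integrable P (\<lambda>x. (entropy_fun (s i x) + entropy_fun (s j x)) / 2)" using Ii by simp
      have "0 \<le> entropy_fun (?m x)" for x using s0 by (intro entropy_fun_nonneg) simp
      then show "AE x in P. norm (entropy_fun (?m x)) \<le> norm ((entropy_fun (s i x) + entropy_fun (s j x)) / 2)"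
        using le by (intro AE_I2) (smt (verit) real_norm_def)
    qed measurable
    then have "J ?m = ennreal (\<Phi> ?m)"
      unfolding J_def \<Phi>_def using s0 by (intro nn_integral_eq_integral) (auto simp: entropy_fun_nonneg)
    then have "ennreal M \<le> ennreal (\<Phi> ?m)" using mle[OF cm] mM by simp
    moreover have "\<Phi> ?m \<ge> 0" unfolding \<Phi>_def using s0 by (intro integral_nonneg_AE) (simp add: entropy_fun_nonneg)
    ultimately have Mm: "M \<le> \<Phi> ?m" by simp
    have "(\<integral>x. \<bar>s i x - s j x\<bar> \<partial>P) \<le> (\<integral>x. t * (s i x + s j x)
       + 2 / t * ((entropy_fun (s i x) + entropy_fun (s j x)) / 2 - entropy_fun (?m x)) \<partial>P)"
      using abs_diff_le_entropy_gap[OF s0 s0 t] si Ii im by (intro integral_mono) auto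
    also have "\<dots> = t * 2 + 2 / t * ((\<Phi> (s i) + \<Phi> (s j)) / 2 - \<Phi> ?m)"
      using si Ii im coupling_density_integral[OF s] by (simp add: \<Phi>_def)
    also have "\<dots> \<le> t * 2 + 2 / t * ((1 / (real i + 1) + 1 / (real j + 1)) / 2)"
    proof -
      have "(\<Phi> (s i) + \<Phi> (s j)) / 2 - \<Phi> ?m \<le> (1 / (real i + 1) + 1 / (real j + 1)) / 2"
        using Phis[of i] Phis[of j] Mm by argo
      then show ?thesis using t by (intro add_left_mono mult_left_mono) auto
    qed
    also have "\<dots> = 2 * t + (1 / (real i + 1) + 1 / (real j + 1)) / t"
    proof -
      have "2 / t * (X / 2) = X / t" for X by simp
      then show ?thesis by (simp only: mult.commute[of t 2])
    qed
    finally show ?thesis .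
  qed
  have Cauchy: "\<exists>N. \<forall>i\<ge>N. \<forall>j\<ge>N. (LINT x|P. norm (s i x - s j x)) < e" if e: "e > 0" for e
  proof -
    \<comment> \<open>with this \<open>t\<close> the first term of \<open>L1\<close> is \<open>e / 2\<close>; the second is made at most \<open>e / 4\<close>\<close>
    define t where "t = e / 4"
    have t: "t > 0" using e by (simp add: t_def)
    obtain N :: nat where N: "8 / (t * e) < real N" using reals_Archimedean2 by blast
    have "(LINT x|P. norm (s i x - s j x)) < e" if ij: "i \<ge> N" "j \<ge> N" for i j
    proof -
      have small: "1 / (real k + 1) < t * e / 8" if "k \<ge> N" for k
      proof -
        have "8 / (t * e) < real k + 1" using N that by linarith
        then show ?thesis using t e by (simp add: field_simps)
      qed
      have "(1 / (real i + 1) + 1 / (real j + 1)) / t \<le> (t * e / 4) / t"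
        using small[OF ij(1)] small[OF ij(2)] t by (intro divide_right_mono) auto
      also have "\<dots> = e / 4" using t by simp
      finally show ?thesis using L1[OF t, of i j] e t_def unfolding real_norm_def by linarith
    qed
    then show ?thesis by blast
  qed
  obtain q r where q: "coupling_density q" and r: "strict_mono r"
    and lim: "AE x in P. (\<lambda>i. s (r i) x) \<longlonglongrightarrow> q x"
    by (rule coupling_density_L1_complete[OF s Cauchy])
  have qn: "0 \<le> q x" for x using q unfolding coupling_density_def by blast
  have "J q = (\<integral>\<^sup>+x. liminf (\<lambda>i. ennreal (entropy_fun (s (r i) x))) \<partial>P)"
    unfolding J_def
  proof (rule nn_integral_cong_AE, use lim in eventually_elim)
    case (elim x)
    have "(\<lambda>i. entropy_fun (s (r i) x)) \<longlonglongrightarrow> entropy_fun (q x)"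
      by (rule continuous_on_tendsto_compose[OF continuous_on_entropy_fun elim]) (auto simp: qn s0)
    then have "(\<lambda>i. ennreal (entropy_fun (s (r i) x))) \<longlonglongrightarrow> ennreal (entropy_fun (q x))"
      by (rule tendsto_ennrealI)
    then show ?case using lim_imp_Liminf[OF sequentially_bot] by force
  qed
  also have "\<dots> \<le> liminf (\<lambda>i. J (s (r i)))"
    unfolding J_def by (rule nn_integral_liminf) measurable
  also have "\<dots> \<le> liminf (\<lambda>i. m + ennreal (1 / (real (r i) + 1)))"
    by (rule Liminf_mono) (intro always_eventually allI less_imp_le[OF sm])
  also have "\<dots> = m"
  proof -
    have "(\<lambda>n. 1 / (real n + 1)) \<longlonglongrightarrow> 0" by real_asymp
    then have "(\<lambda>i. 1 / (real (r i) + 1)) \<longlonglongrightarrow> 0"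
      using LIMSEQ_subseq_LIMSEQ[OF _ r] by (force simp: comp_def)
    then have "(\<lambda>i. m + ennreal (1 / (real (r i) + 1))) \<longlonglongrightarrow> m + ennreal 0"
      by (intro tendsto_add tendsto_const tendsto_ennrealI)
    then show ?thesis using lim_imp_Liminf[OF sequentially_bot] by force
  qed
  finally have min: "J q \<le> m" .
  show ?thesis
  proof (intro bexI ballI)
    show "density P (\<lambda>x. ennreal (q x)) \<in> couplings \<mu> \<eta>"
      using coupling_density_iff[of q] q by (auto simp: coupling_density_def)
    fix Q' assume Q': "Q' \<in> couplings \<mu> \<eta>"
    show "rel_entropy (density P (\<lambda>x. ennreal (q x))) P \<le> rel_entropy Q' P"
    proof (cases "rel_entropy Q' P < \<infinity>")
      case True
      then obtain q' where q': "coupling_density q'" "Q' = density P (\<lambda>x. ennreal (q' x))"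
        using ex[OF Q'] by auto
      have "J q \<le> J q'" using min mle[OF q'(1)] by simp
      then show ?thesis using Jq[OF q] Jq[OF q'(1)] q'(2) by (simp add: less_eq_ennreal.rep_eq)
    qed simp
  qed
qed

end

section \<open>Disintegration of measures with continuous log-densities\<close>

text \<open>Nonempty open sets have positive Lebesgue measure.\<close>

lemma AE_lborel_continuous_eq:
  fixes f g :: "'a::euclidean_space \<Rightarrow> real"
  assumes f: "continuous_on UNIV f" and g: "continuous_on UNIV g"
    and AE: "AE x in lborel. f x = g x"
  shows "f x = g x"
proof (rule ccontr)
  assume ne: "f x \<noteq> g x"
  let ?S = "{x. f x \<noteq> g x}"
  have op: "open ?S" by (rule open_Collect_neq[OF f g])
  then have S: "?S \<in> sets lborel" by simp
  have "?S \<in> null_sets lborel" using AE S by (subst AE_iff_null_sets) auto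
  then have "negligible ?S"
    by (simp add: negligible_iff_null_sets null_sets_completionI)
  then show False using op ne open_not_negligible by blast
qed

lemma nn_integral_joint:
  assumes K: "markov_transition K" and \<mu>: "sets \<mu> = sets borel"
    and f [measurable]: "f \<in> borel_measurable (borel \<Otimes>\<^sub>M borel)"
  shows "(\<integral>\<^sup>+p. f p \<partial>joint \<mu> K) = (\<integral>\<^sup>+x. \<integral>\<^sup>+y. f (x, y) \<partial>K x \<partial>\<mu>)"
proof -
  have K': "K \<in> borel \<rightarrow>\<^sub>M subprob_algebra borel"
    using K by (intro measurable_prob_algebraD) (simp add: markov_transition_def)
  have N: "(\<lambda>x. distr (K x) (borel \<Otimes>\<^sub>M borel) (Pair x)) \<in> \<mu> \<rightarrow>\<^sub>M subprob_algebra (borel \<Otimes>\<^sub>M borel)"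
    using measurable_distr2[of Pair borel borel "borel \<Otimes>\<^sub>M borel" K] K' \<mu>
    by (simp cong: measurable_cong_sets)
  have "(\<integral>\<^sup>+y. f y \<partial>distr (K x) (borel \<Otimes>\<^sub>M borel) (Pair x)) = (\<integral>\<^sup>+y. f (x, y) \<partial>K x)" for x
  proof -
    have "sets (K x) = sets borel" using K' by (auto dest: sets_kernel)
    then have "Pair x \<in> K x \<rightarrow>\<^sub>M borel \<Otimes>\<^sub>M borel" by (simp cong: measurable_cong_sets)
    then show ?thesis by (subst nn_integral_distr) auto
  qed
  then show ?thesis unfolding joint_def by (subst nn_integral_bind[OF f N]) simp
qed

lemma sets_joint:
  assumes K: "markov_transition K" and \<mu>: "sets \<mu> = sets borel"
  shows "sets (joint \<mu> K) = sets (borel \<Otimes>\<^sub>M borel)"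
  unfolding joint_def using sets_eq_imp_space_eq[OF \<mu>] by (intro sets_bind) auto

lemma markov_transition_kernel:
  assumes "markov_transition K"
  shows "K \<in> borel \<rightarrow>\<^sub>M subprob_algebra borel" "prob_space (K x)" "sets (K x) = sets borel"
proof -
  have K: "K \<in> borel \<rightarrow>\<^sub>M prob_algebra borel" using assms by (simp add: markov_transition_def)
  then show "K \<in> borel \<rightarrow>\<^sub>M subprob_algebra borel" by (rule measurable_prob_algebraD)
  have "K x \<in> space (prob_algebra borel)" by (rule measurable_space[OF K]) simp
  then show "prob_space (K x)" "sets (K x) = sets borel" by (auto simp: space_prob_algebra)
qed

lemma borel_measurable_compose2:
  fixes w :: "'a::euclidean_space \<Rightarrow> 'a \<Rightarrow> 'b::topological_space"
  assumes w: "(\<lambda>z. w (fst z) (snd z)) \<in> borel_measurable (borel \<Otimes>\<^sub>M borel)"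
    and f: "f \<in> borel_measurable M" and g: "g \<in> borel_measurable M"
  shows "(\<lambda>x. w (f x) (g x)) \<in> borel_measurable M"
  using measurable_compose[OF measurable_Pair[OF f g] w] by simp

lemma joint_density:
  fixes w :: "'a::euclidean_space \<Rightarrow> 'a \<Rightarrow> real"
  assumes w [measurable]: "(\<lambda>z. w (fst z) (snd z)) \<in> borel_measurable (borel \<Otimes>\<^sub>M borel)"
    and K: "markov_transition (gibbs_transition w)"
    and p [measurable]: "p \<in> borel_measurable borel"
  shows "joint (density lborel p) (gibbs_transition w)
       = density (lborel \<Otimes>\<^sub>M lborel) (\<lambda>z. p (fst z) * ennreal (exp (- w (fst z) (snd z))))" (is "?J = ?D")
proof (rule measure_eqI)
  show "sets ?J
      = sets ?D"
    by (simp add: sets_joint[OF K])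
  note [measurable (raw)] = borel_measurable_compose2[OF w]
  fix A assume "A \<in> sets ?J"
  then have A [measurable]: "A \<in> sets (borel \<Otimes>\<^sub>M borel)" by (simp add: sets_joint[OF K])
  have "emeasure ?J A
      = (\<integral>\<^sup>+z. indicator A z \<partial>?J)"
    using A by (subst nn_integral_indicator) (auto simp: sets_joint[OF K])
  also have "\<dots> = (\<integral>\<^sup>+x. \<integral>\<^sup>+y. indicator A (x, y) \<partial>gibbs_transition w x \<partial>density lborel p)"
    by (subst nn_integral_joint[OF K]) auto
  also have "\<dots> = (\<integral>\<^sup>+x. \<integral>\<^sup>+y. ennreal (exp (- w x y)) * indicator A (x, y) \<partial>lborel \<partial>density lborel p)"
    unfolding gibbs_transition_def
    by (intro nn_integral_cong) (subst nn_integral_density, auto)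
  also have "\<dots> = (\<integral>\<^sup>+x. p x * (\<integral>\<^sup>+y. ennreal (exp (- w x y)) * indicator A (x, y) \<partial>lborel) \<partial>lborel)"
    by (subst nn_integral_density) auto
  also have "\<dots> = (\<integral>\<^sup>+x. \<integral>\<^sup>+y. p x * ennreal (exp (- w x y)) * indicator A (x, y) \<partial>lborel \<partial>lborel)"
    by (intro nn_integral_cong) (subst nn_integral_cmult[symmetric], auto simp: mult.assoc)
  also have "\<dots> = (\<integral>\<^sup>+z. p (fst z) * ennreal (exp (- w (fst z) (snd z))) * indicator A z \<partial>(lborel \<Otimes>\<^sub>M lborel))"
    by (subst lborel.nn_integral_fst[symmetric]) auto
  also have "\<dots> = emeasure ?D A"
    by (subst emeasure_density) auto
  finally show "emeasure ?J A
      = emeasure ?D A" .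
qed

lemma bind_density:
  fixes w :: "'a::euclidean_space \<Rightarrow> 'a \<Rightarrow> real"
  assumes w [measurable]: "(\<lambda>z. w (fst z) (snd z)) \<in> borel_measurable (borel \<Otimes>\<^sub>M borel)"
    and K: "markov_transition (gibbs_transition w)"
    and p [measurable]: "p \<in> borel_measurable borel"
  shows "Giry_Monad.bind (density lborel p) (gibbs_transition w)
       = density lborel (\<lambda>y. \<integral>\<^sup>+x. p x * ennreal (exp (- w x y)) \<partial>lborel)" (is "?B = ?D")
proof (rule measure_eqI)
  note K' = markov_transition_kernel[OF K]
  have K'': "gibbs_transition w \<in> density lborel p \<rightarrow>\<^sub>M subprob_algebra borel"
    using K'(1) by (simp cong: measurable_cong_sets)
  show *: "sets ?B
      = sets ?D"
    using K'(3) by (subst sets_bind[where N = borel]) auto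
  note [measurable (raw)] = borel_measurable_compose2[OF w]
  fix A assume "A \<in> sets ?B"
  then have A [measurable]: "A \<in> sets borel" using * by simp
  have "emeasure ?B A
      = (\<integral>\<^sup>+x. emeasure (gibbs_transition w x) A \<partial>density lborel p)"
    by (rule emeasure_bind[OF _ K'']) auto
  also have "\<dots> = (\<integral>\<^sup>+x. \<integral>\<^sup>+y. ennreal (exp (- w x y)) * indicator A y \<partial>lborel \<partial>density lborel p)"
    unfolding gibbs_transition_def by (intro nn_integral_cong) (subst emeasure_density, auto)
  also have "\<dots> = (\<integral>\<^sup>+x. p x * (\<integral>\<^sup>+y. ennreal (exp (- w x y)) * indicator A y \<partial>lborel) \<partial>lborel)"
    by (subst nn_integral_density) auto
  also have "\<dots> = (\<integral>\<^sup>+x. \<integral>\<^sup>+y. p x * ennreal (exp (- w x y)) * indicator A y \<partial>lborel \<partial>lborel)"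
    by (intro nn_integral_cong) (subst nn_integral_cmult[symmetric], auto simp: mult.assoc)
  also have "\<dots> = (\<integral>\<^sup>+y. \<integral>\<^sup>+x. p x * ennreal (exp (- w x y)) * indicator A y \<partial>lborel \<partial>lborel)"
    by (rule lborel_pair.Fubini') auto
  also have "\<dots> = (\<integral>\<^sup>+y. (\<integral>\<^sup>+x. p x * ennreal (exp (- w x y)) \<partial>lborel) * indicator A y \<partial>lborel)"
    by (intro nn_integral_cong) (subst nn_integral_multc[symmetric], auto)
  also have "\<dots> = emeasure ?D A"
    by (subst emeasure_density) auto
  finally show "emeasure ?B A
      = emeasure ?D A" .
qed

lemma flip_measure_density:
  fixes f :: "'a::euclidean_space \<times> 'a \<Rightarrow> ennreal"
  assumes f [measurable]: "f \<in> borel_measurable (borel \<Otimes>\<^sub>M borel)"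
  shows "flip_measure (density (lborel \<Otimes>\<^sub>M lborel) f)
       = density (lborel \<Otimes>\<^sub>M lborel) (\<lambda>z. f (prod.swap z))"
proof -
  let ?L = "lborel \<Otimes>\<^sub>M lborel :: ('a \<times> 'a) measure"
  have swap: "prod.swap = (\<lambda>(x, y). (y, x) :: 'a \<times> 'a)" by (auto simp: fun_eq_iff)
  have sw: "prod.swap \<in> ?L \<rightarrow>\<^sub>M ?L" unfolding swap by measurable
  have "density ?L (\<lambda>z. f (prod.swap z)) = density (distr ?L ?L prod.swap) (\<lambda>z. f (prod.swap z))"
    using lborel_pair.distr_pair_swap[where 'a = 'a and 'b = 'a] unfolding swap[symmetric] by simp
  also have "\<dots> = distr (density ?L (\<lambda>z. f (prod.swap (prod.swap z)))) ?L prod.swap"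
    using sw measurable_compose[OF sw, of f borel] by (intro density_distr) simp_all
  also have "\<dots> = flip_measure (density ?L f)"
    unfolding flip_measure_def by (intro distr_cong sets_pair_measure_cong) auto
  finally show ?thesis by simp
qed

text \<open>Disintegration only gives equality of densities almost everywhere.  Freezing \<open>x\<close> at a generic
  point \<open>x0\<close> exhibits the log-density of the second marginal as a difference of continuous functions;
  with this version both sides are continuous and agree everywhere.\<close>

lemma disintegration_potential:
  fixes A :: "'a::euclidean_space \<Rightarrow> real" and w w' :: "'a \<Rightarrow> 'a \<Rightarrow> real"
  assumes A: "continuous_on UNIV A"
    and w: "continuous_on UNIV (\<lambda>z. w (fst z) (snd z))"
    and w': "continuous_on UNIV (\<lambda>z. w' (fst z) (snd z))"
    and K: "markov_transition (gibbs_transition w)" and K': "markov_transition (gibbs_transition w')"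
    and dis: "joint (gibbs A) (gibbs_transition w)
      = flip_measure (joint (Giry_Monad.bind (gibbs A) (gibbs_transition w)) (gibbs_transition w'))"
  obtains b where "continuous_on UNIV b"
    "Giry_Monad.bind (gibbs A) (gibbs_transition w) = gibbs b"
    "\<And>x y. A x + w x y = b y + w' y x"
proof -
  have Am [measurable]: "A \<in> borel_measurable borel" using A by (rule borel_measurable_continuous_onI)
  have wm [measurable]: "(\<lambda>z. w (fst z) (snd z)) \<in> borel_measurable (borel \<Otimes>\<^sub>M borel)"
    using borel_measurable_continuous_onI[OF w] by (simp add: borel_prod)
  have wm' [measurable]: "(\<lambda>z. w' (fst z) (snd z)) \<in> borel_measurable (borel \<Otimes>\<^sub>M borel)"
    using borel_measurable_continuous_onI[OF w'] by (simp add: borel_prod)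
  note [measurable (raw)] = borel_measurable_compose2[OF wm] borel_measurable_compose2[OF wm']
  let ?L = "lborel \<Otimes>\<^sub>M lborel :: ('a \<times> 'a) measure"
  have sf: "sigma_finite_measure ?L" by (simp add: lborel_prod sigma_finite_lborel)
  define p where "p y = (\<integral>\<^sup>+x. ennreal (exp (- A x)) * ennreal (exp (- w x y)) \<partial>lborel)" for y
  have [measurable]: "p \<in> borel_measurable borel" unfolding p_def by measurable
  have bp: "Giry_Monad.bind (gibbs A) (gibbs_transition w) = density lborel p"
    unfolding gibbs_def by (subst bind_density[OF wm K]) (auto simp: p_def[abs_def])
  have J1: "joint (gibbs A) (gibbs_transition w)
      = density ?L (\<lambda>z. ennreal (exp (- A (fst z))) * ennreal (exp (- w (fst z) (snd z))))"
    unfolding gibbs_def by (subst joint_density[OF wm K]) auto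
  have J2: "flip_measure (joint (density lborel q) (gibbs_transition w'))
      = density ?L (\<lambda>z. q (snd z) * ennreal (exp (- w' (snd z) (fst z))))"
    if [measurable]: "q \<in> borel_measurable borel" for q
    by (subst joint_density[OF wm' K'], simp, subst flip_measure_density) auto
  have AE_eq: "AE z in ?L. ennreal (exp (- A (fst z))) * ennreal (exp (- w (fst z) (snd z)))
      = q (snd z) * ennreal (exp (- w' (snd z) (fst z)))"
    if [measurable]: "q \<in> borel_measurable borel" and "density lborel p = density lborel q" for q
    using dis unfolding bp that(2) J1 J2[OF that(1)]
    by (subst (asm) sigma_finite_measure.density_unique_iff[OF sf]) auto
  from AE_eq[of p] have "AE x in lborel. AE y in lborel.
      ennreal (exp (- A x)) * ennreal (exp (- w x y)) = p y * ennreal (exp (- w' y x))"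
    using lborel_pair.AE_pair by force
  moreover have "ae_filter (lborel :: 'a measure) \<noteq> bot" by (simp add: ae_filter_eq_bot_iff)
  ultimately obtain x0 where x0: "AE y in lborel.
      ennreal (exp (- A x0)) * ennreal (exp (- w x0 y)) = p y * ennreal (exp (- w' y x0))"
    using eventually_happens' by blast
  \<comment> \<open>the value that disintegration forces at the frozen point \<open>x0\<close>\<close>
  define b where "b y = A x0 + w x0 y - w' y x0" for y
  have b: "continuous_on UNIV b"
  proof -
    have "continuous_on UNIV (\<lambda>y. w x0 y)" "continuous_on UNIV (\<lambda>y. w' y x0)"
      using continuous_on_compose2[OF w, of UNIV "\<lambda>y. (x0, y)"]
        continuous_on_compose2[OF w', of UNIV "\<lambda>y. (y, x0)"]
      by (simp_all add: continuous_on_Pair)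
    then show ?thesis unfolding b_def by (intro continuous_intros)
  qed
  have [measurable]: "b \<in> borel_measurable borel" using b by (rule borel_measurable_continuous_onI)
  have AEp: "AE y in lborel. p y = ennreal (exp (- b y))"
    using x0
  proof eventually_elim
    case (elim y)
    have "p y = p y * ennreal (exp (- w' y x0)) * ennreal (exp (w' y x0))"
      by (simp add: mult.assoc ennreal_mult[symmetric] exp_add[symmetric])
    also have "\<dots> = ennreal (exp (- b y))"
      unfolding elim[symmetric] b_def
      by (simp add: ennreal_mult[symmetric] exp_add[symmetric] algebra_simps)
    finally show ?case .
  qed
  have pb: "density lborel p = density lborel (\<lambda>y. ennreal (exp (- b y)))"
    using AEp by (intro density_cong) auto
  have "AE z in ?L. A (fst z) + w (fst z) (snd z) = b (snd z) + w' (snd z) (fst z)"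
    using AE_eq[OF _ pb]
  proof (rule AE_mp)
    show "AE z in ?L. ennreal (exp (- A (fst z))) * ennreal (exp (- w (fst z) (snd z)))
        = ennreal (exp (- b (snd z))) * ennreal (exp (- w' (snd z) (fst z)))
        \<longrightarrow> A (fst z) + w (fst z) (snd z) = b (snd z) + w' (snd z) (fst z)"
      by (intro AE_I2) (auto simp: ennreal_mult[symmetric] exp_add[symmetric])
  qed measurable
  then have "A (fst z) + w (fst z) (snd z) = b (snd z) + w' (snd z) (fst z)" for z
    unfolding lborel_prod
  proof (rule AE_lborel_continuous_eq[rotated 2])
    show "continuous_on UNIV (\<lambda>z. A (fst z) + w (fst z) (snd z))"
      using w continuous_on_compose2[OF A continuous_on_fst[OF continuous_on_id]]
      by (intro continuous_intros) auto
    show "continuous_on UNIV (\<lambda>z. b (snd z) + w' (snd z) (fst z))"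
      using continuous_on_compose2[OF w' continuous_on_swap] continuous_on_compose2[OF b continuous_on_snd[OF continuous_on_id]]
      by (intro continuous_intros) auto
  qed
  then have "A x + w x y = b y + w' y x" for x y by (metis fst_conv snd_conv)
  with b show ?thesis using that bp pb by (simp add: gibbs_def)
qed

lemma smooth_imp_continuous_on:
  fixes f :: "'a::euclidean_space \<Rightarrow> real"
  assumes "smooth f" shows "continuous_on UNIV f"
proof -
  have "f differentiable (at x)" for x
    using assms[unfolded smooth_def, rule_format, of "[]" x] by simp
  then show ?thesis
    by (intro continuous_at_imp_continuous_on ballI differentiable_imp_continuous_within)
qed

section \<open>Entropy of coupled transitions\<close>

lemma nn_integral_exp_transition:
  assumes K: "markov_transition (gibbs_transition w)" and w: "w x \<in> borel_measurable borel"
  shows "(\<integral>\<^sup>+y. ennreal (exp (- w x y)) \<partial>lborel) = 1"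
proof -
  interpret prob_space "gibbs_transition w x" using markov_transition_kernel[OF K] by simp
  show ?thesis
    using emeasure_space_1 w by (simp add: gibbs_transition_def emeasure_density)
qed

lemma gibbs_transition_density:
  assumes w: "w x1 \<in> borel_measurable borel" "w x2 \<in> borel_measurable borel"
  shows "gibbs_transition w x1
    = density (gibbs_transition w x2) (\<lambda>y. ennreal (exp (w x2 y - w x1 y)))"
  unfolding gibbs_transition_def using w
  by (subst density_density_eq)
    (auto simp: ennreal_mult[symmetric] exp_add[symmetric] intro!: density_cong)

text \<open>Tonelli's theorem for a source \<open>\<gamma>\<close> that carries more information than the point \<open>s p\<close> from which the
  transition starts.\<close>

lemma nn_integral_density_transition:
  fixes w :: "'a::euclidean_space \<Rightarrow> 'a \<Rightarrow> real"
  assumes w: "(\<lambda>z. w (fst z) (snd z)) \<in> borel_measurable (borel \<Otimes>\<^sub>M borel)"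
    and G: "sigma_finite_measure \<gamma>" and s [measurable]: "s \<in> \<gamma> \<rightarrow>\<^sub>M borel"
    and f [measurable]: "f \<in> borel_measurable (\<gamma> \<Otimes>\<^sub>M borel)"
  shows "(\<integral>\<^sup>+z. f z \<partial>density (\<gamma> \<Otimes>\<^sub>M lborel) (\<lambda>z. ennreal (exp (- w (s (fst z)) (snd z)))))
       = (\<integral>\<^sup>+p. \<integral>\<^sup>+y. f (p, y) \<partial>gibbs_transition w (s p) \<partial>\<gamma>)"
proof -
  note [measurable (raw)] = borel_measurable_compose2[OF w]
  interpret sigma_finite_measure \<gamma> by fact
  have [measurable]: "f \<in> borel_measurable (\<gamma> \<Otimes>\<^sub>M lborel)"
    using f by (simp cong: measurable_cong_sets)
  have "(\<integral>\<^sup>+z. f z \<partial>density (\<gamma> \<Otimes>\<^sub>M lborel) (\<lambda>z. ennreal (exp (- w (s (fst z)) (snd z)))))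
      = (\<integral>\<^sup>+z. ennreal (exp (- w (s (fst z)) (snd z))) * f z \<partial>(\<gamma> \<Otimes>\<^sub>M lborel))"
    by (rule nn_integral_density) measurable
  also have "\<dots> = (\<integral>\<^sup>+p. \<integral>\<^sup>+y. ennreal (exp (- w (s p) y)) * f (p, y) \<partial>lborel \<partial>\<gamma>)"
    by (subst lborel.nn_integral_fst[symmetric]) (simp_all, measurable)
  also have "\<dots> = (\<integral>\<^sup>+p. \<integral>\<^sup>+y. f (p, y) \<partial>gibbs_transition w (s p) \<partial>\<gamma>)"
    unfolding gibbs_transition_def
    by (intro nn_integral_cong) (subst nn_integral_density, auto)
  finally show ?thesis .
qed

text \<open>Given a pair \<open>p = (x', x)\<close> of law \<open>\<gamma>\<close>, draw \<open>y\<close> once from the transition at \<open>x'\<close> and once from the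
  transition at \<open>x\<close>.  The laws of \<open>(p, y)\<close> have relative entropy equal to the mean entropy of the two
  transitions; forgetting \<open>x'\<close> turns the second law into the joint measure started from \<open>\<mu>\<close> and the
  first into a coupling of \<open>\<mu>\<close> with \<open>\<nu> K\<close>.\<close>

lemma coupled_transition_entropy:
  fixes w :: "'a::euclidean_space \<Rightarrow> 'a \<Rightarrow> real"
  assumes w: "(\<lambda>z. w (fst z) (snd z)) \<in> borel_measurable (borel \<Otimes>\<^sub>M borel)"
    and K: "markov_transition (gibbs_transition w)"
    and \<nu>: "prob_space \<nu>" "sets \<nu> = sets borel" and \<mu>: "prob_space \<mu>" "sets \<mu> = sets borel"
    and \<gamma>: "\<gamma> \<in> couplings \<nu> \<mu>"
    and c: "\<And>x1 x2. rel_entropy (gibbs_transition w x1) (gibbs_transition w x2) \<le> enn2ereal (c x1 x2)"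
  shows "\<exists>Q\<in>couplings \<mu> (Giry_Monad.bind \<nu> (gibbs_transition w)).
    rel_entropy Q (joint \<mu> (gibbs_transition w)) \<le> enn2ereal (\<integral>\<^sup>+p. c (fst p) (snd p) \<partial>\<gamma>)"
proof -
  note [measurable (raw)] = borel_measurable_compose2[OF w]
  note K' = markov_transition_kernel[OF K]
  let ?K = "gibbs_transition w"
  have s\<gamma> [measurable_cong]: "sets \<gamma> = sets (borel \<Otimes>\<^sub>M borel)"
    and g1: "distr \<gamma> borel fst = \<nu>" and g2: "distr \<gamma> borel snd = \<mu>"
    using \<gamma> by (auto simp: couplings_def)
  have [measurable]: "fst \<in> \<gamma> \<rightarrow>\<^sub>M borel" "snd \<in> \<gamma> \<rightarrow>\<^sub>M borel" by measurable
  interpret g: prob_space \<gamma>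
    using g1 \<nu> by (intro prob_space_distrD[of fst \<gamma> borel]) auto
  define D where "D s = density (\<gamma> \<Otimes>\<^sub>M lborel) (\<lambda>z. ennreal (exp (- w (s (fst z)) (snd z))))" for s
  have sD [measurable_cong]: "sets (D s) = sets (\<gamma> \<Otimes>\<^sub>M borel)" for s
    by (simp add: D_def)
  have nnD: "(\<integral>\<^sup>+z. f z \<partial>D s) = (\<integral>\<^sup>+p. \<integral>\<^sup>+y. f (p, y) \<partial>?K (s p) \<partial>\<gamma>)"
    if "s \<in> \<gamma> \<rightarrow>\<^sub>M borel" "f \<in> borel_measurable (\<gamma> \<Otimes>\<^sub>M borel)" for s f
    unfolding D_def using that by (intro nn_integral_density_transition[OF w g.sigma_finite_measure_axioms])
  have pD: "prob_space (D s)" if [measurable]: "s \<in> \<gamma> \<rightarrow>\<^sub>M borel" for s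
  proof
    have "emeasure (D s) (space (D s)) = (\<integral>\<^sup>+z. 1 \<partial>D s)" by simp
    also have "\<dots> = 1" by (subst nnD[OF that]) (simp_all add: prob_space.emeasure_space_1[OF K'(2)] g.emeasure_space_1)
    finally show "emeasure (D s) (space (D s)) = 1" .
  qed
  define k where "k z = w (snd (fst z)) (snd z) - w (fst (fst z)) (snd z)" for z
  have k [measurable]: "k \<in> borel_measurable (\<gamma> \<Otimes>\<^sub>M borel)"
    unfolding k_def by measurable
  have dens: "D fst = density (D snd) (\<lambda>z. ennreal (exp (k z)))"
    unfolding D_def
    by (subst density_density_eq)
      (auto simp: ennreal_mult[symmetric] exp_add[symmetric] k_def intro!: density_cong)
  have ent: "rel_entropy (D fst) (D snd) = enn2ereal (\<integral>\<^sup>+z. ennreal (k z - 1 + exp (- k z)) \<partial>D fst)"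
    unfolding dens
    by (rule rel_entropy_exp_density(2)) (use pD dens[symmetric] in auto)
  have "(\<integral>\<^sup>+z. ennreal (k z - 1 + exp (- k z)) \<partial>D fst)
      = (\<integral>\<^sup>+p. \<integral>\<^sup>+y. ennreal (k (p, y) - 1 + exp (- k (p, y))) \<partial>?K (fst p) \<partial>\<gamma>)"
    by (rule nnD) measurable
  also have "\<dots> \<le> (\<integral>\<^sup>+p. c (fst p) (snd p) \<partial>\<gamma>)"
  proof (rule nn_integral_mono)
    fix p :: "'a \<times> 'a"
    have wm: "w x \<in> borel_measurable borel" for x by measurable
    have d: "?K (fst p) = density (?K (snd p)) (\<lambda>y. ennreal (exp (k (p, y))))"
      using gibbs_transition_density[where w = w and ?x1.0 = "fst p" and ?x2.0 = "snd p", OF wm wm] by (simp add: k_def)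
    have "rel_entropy (?K (fst p)) (?K (snd p))
        = enn2ereal (\<integral>\<^sup>+y. ennreal (k (p, y) - 1 + exp (- k (p, y))) \<partial>?K (fst p))"
      using rel_entropy_exp_density(2)[of "?K (snd p)" "\<lambda>y. k (p, y)"] K'(2)
      unfolding d[symmetric] by (simp add: k_def gibbs_transition_def)
    then show "(\<integral>\<^sup>+y. ennreal (k (p, y) - 1 + exp (- k (p, y))) \<partial>?K (fst p)) \<le> c (fst p) (snd p)"
      using c[of "fst p" "snd p"] by (simp add: less_eq_ennreal.rep_eq)
  qed
  finally have le: "rel_entropy (D fst) (D snd) \<le> enn2ereal (\<integral>\<^sup>+p. c (fst p) (snd p) \<partial>\<gamma>)"
    unfolding ent by (simp add: less_eq_ennreal.rep_eq)
  \<comment> \<open>\<open>T\<close> forgets the starting point of the first transition\<close>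
  define T where "T z = (snd (fst z), snd z)" for z :: "('a \<times> 'a) \<times> 'a"
  let ?R = "distr (D snd) (borel \<Otimes>\<^sub>M borel) T"
  let ?Q1 = "distr (D fst) borel (\<lambda>z. snd (fst z))" and ?Q2 = "distr (D fst) borel snd"
  let ?\<nu>K = "Giry_Monad.bind \<nu> ?K"
  have T [measurable]: "T \<in> \<gamma> \<Otimes>\<^sub>M borel \<rightarrow>\<^sub>M borel \<Otimes>\<^sub>M borel" unfolding T_def by measurable
  have TD [measurable]: "T \<in> D s \<rightarrow>\<^sub>M borel \<Otimes>\<^sub>M borel" for s by measurable
  have R: "?R = joint \<mu> ?K"
  proof (rule measure_eqI)
    show "sets ?R = sets (joint \<mu> ?K)"
      by (simp add: sets_joint[OF K \<mu>(2)])
    fix A assume "A \<in> sets ?R"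
    then have A [measurable]: "A \<in> sets (borel \<Otimes>\<^sub>M borel)" by simp
    have [measurable]: "(\<lambda>x. \<integral>\<^sup>+y. indicator A (x, y) \<partial>?K x) \<in> borel_measurable borel"
      unfolding gibbs_transition_def
      by (subst nn_integral_density) measurable
    have "emeasure ?R A
        = (\<integral>\<^sup>+z. indicator A z \<partial>?R)" by simp
    also have "\<dots> = (\<integral>\<^sup>+z. indicator A (T z) \<partial>D snd)" by (rule nn_integral_distr) auto
    also have "\<dots> = (\<integral>\<^sup>+p. \<integral>\<^sup>+y. indicator A (T (p, y)) \<partial>?K (snd p) \<partial>\<gamma>)" by (rule nnD) measurable
    also have "\<dots> = (\<integral>\<^sup>+p. \<integral>\<^sup>+y. indicator A (snd p, y) \<partial>?K (snd p) \<partial>\<gamma>)" by (simp add: T_def)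
    also have "\<dots> = (\<integral>\<^sup>+x. \<integral>\<^sup>+y. indicator A (x, y) \<partial>?K x \<partial>\<mu>)"
      unfolding g2[symmetric] by (subst nn_integral_distr) auto
    also have "\<dots> = (\<integral>\<^sup>+z. indicator A z \<partial>joint \<mu> ?K)"
      by (subst nn_integral_joint[OF K \<mu>(2)]) auto
    also have "\<dots> = emeasure (joint \<mu> ?K) A" by (simp add: sets_joint[OF K \<mu>(2)])
    finally show "emeasure ?R A = emeasure (joint \<mu> ?K) A" .
  qed
  let ?Q = "distr (D fst) (borel \<Otimes>\<^sub>M borel) T"
  have "?Q \<in> couplings \<mu> ?\<nu>K"
    unfolding couplings_def
  proof (intro CollectI conjI)
    have d1: "distr ?Q borel fst = ?Q1"
      by (subst distr_distr) (auto simp: comp_def T_def)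
    have d2: "distr ?Q borel snd = ?Q2"
      by (subst distr_distr) (auto simp: comp_def T_def)
    show "distr ?Q borel fst = \<mu>"
      unfolding d1
    proof (rule measure_eqI)
      fix A assume "A \<in> sets ?Q1"
      then have A [measurable]: "A \<in> sets borel" by simp
      have "emeasure ?Q1 A
          = (\<integral>\<^sup>+z. indicator A z \<partial>?Q1)" by simp
      also have "\<dots> = (\<integral>\<^sup>+z. indicator A (snd (fst z)) \<partial>D fst)"
        by (rule nn_integral_distr) measurable
      also have "\<dots> = (\<integral>\<^sup>+p. \<integral>\<^sup>+y. indicator A (snd (fst (p, y))) \<partial>?K (fst p) \<partial>\<gamma>)"
        by (rule nnD) measurable
      also have "\<dots> = (\<integral>\<^sup>+p. indicator A (snd p) \<partial>\<gamma>)"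
        using prob_space.emeasure_space_1[OF K'(2)] by simp
      also have "\<dots> = (\<integral>\<^sup>+x. indicator A x \<partial>\<mu>)"
        unfolding g2[symmetric] by (subst nn_integral_distr) auto
      finally show "emeasure ?Q1 A = emeasure \<mu> A"
        using \<mu>(2) by simp
    qed (simp add: \<mu>)
    show "distr ?Q borel snd = ?\<nu>K"
      unfolding d2
    proof (rule measure_eqI)
      have ne: "space \<nu> \<noteq> {}" using prob_space.not_empty[OF \<nu>(1)] .
      show "sets ?Q2 = sets ?\<nu>K"
        using K'(3) ne by (subst sets_bind[where N = borel]) auto
      fix A assume "A \<in> sets ?Q2"
      then have A [measurable]: "A \<in> sets borel" by simp
      have [measurable]: "(\<lambda>x. emeasure (?K x) A) \<in> borel_measurable borel"
        by (rule measurable_emeasure_kernel[OF K'(1) A])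
      have "emeasure ?Q2 A = (\<integral>\<^sup>+z. indicator A z \<partial>?Q2)"
        by simp
      also have "\<dots> = (\<integral>\<^sup>+z. indicator A (snd z) \<partial>D fst)" by (rule nn_integral_distr) measurable
      also have "\<dots> = (\<integral>\<^sup>+p. \<integral>\<^sup>+y. indicator A (snd (p, y)) \<partial>?K (fst p) \<partial>\<gamma>)"
        by (rule nnD) measurable
      also have "\<dots> = (\<integral>\<^sup>+p. emeasure (?K (fst p)) A \<partial>\<gamma>)" using K'(3) by simp
      also have "\<dots> = (\<integral>\<^sup>+x. emeasure (?K x) A \<partial>\<nu>)"
        unfolding g1[symmetric] by (subst nn_integral_distr) auto
      also have "\<dots> = emeasure ?\<nu>K A"
        using K'(1) \<nu>(2) by (intro emeasure_bind[OF ne _ A, symmetric]) (simp cong: measurable_cong_sets)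
      finally show "emeasure ?Q2 A = emeasure ?\<nu>K A" .
    qed
  qed simp
  moreover have "rel_entropy ?Q (joint \<mu> ?K) \<le> rel_entropy (D fst) (D snd)"
    unfolding R[symmetric] by (rule rel_entropy_distr_le) (use pD sD in auto)
  ultimately show ?thesis using le by (meson order_trans)
qed

lemma distr_joint:
  assumes K: "markov_transition K" and \<mu>: "prob_space \<mu>" "sets \<mu> = sets borel"
  shows "distr (joint \<mu> K) borel fst = \<mu>"
    and "distr (joint \<mu> K) borel snd = Giry_Monad.bind \<mu> K"
    and "prob_space (joint \<mu> K)"
proof -
  let ?d = "distr (joint \<mu> K) borel"
  let ?f = "?d fst" and ?g = "?d snd"
  note K' = markov_transition_kernel[OF K]
  note sJ [measurable_cong] = sets_joint[OF K \<mu>(2)]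
  have nn: "emeasure (?d s) A = (\<integral>\<^sup>+x. \<integral>\<^sup>+y. indicator A (s (x, y)) \<partial>K x \<partial>\<mu>)"
    if [measurable]: "s \<in> borel \<Otimes>\<^sub>M borel \<rightarrow>\<^sub>M borel" "A \<in> sets borel" for s :: "'a \<times> 'a \<Rightarrow> 'a" and A
  proof -
    have "emeasure (?d s) A = (\<integral>\<^sup>+z. indicator A z \<partial>?d s)" by simp
    also have "\<dots> = (\<integral>\<^sup>+z. indicator A (s z) \<partial>joint \<mu> K)" by (rule nn_integral_distr) measurable
    finally show ?thesis by (subst (asm) nn_integral_joint[OF K \<mu>(2)]) auto
  qed
  show 1: "?f = \<mu>"
  proof (rule measure_eqI)
    fix A assume "A \<in> sets ?f"
    then have A [measurable]: "A \<in> sets borel" by simp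
    show "emeasure ?f A = emeasure \<mu> A"
      using prob_space.emeasure_space_1[OF K'(2)] \<mu>(2) by (simp add: nn)
  qed (simp add: \<mu>)
  show "prob_space (joint \<mu> K)"
    using 1 \<mu> by (intro prob_space_distrD[of fst "joint \<mu> K" borel]) auto
  show "?g = Giry_Monad.bind \<mu> K"
  proof (rule measure_eqI)
    have ne: "space \<mu> \<noteq> {}" using prob_space.not_empty[OF \<mu>(1)] .
    show "sets ?g = sets (Giry_Monad.bind \<mu> K)"
      using K'(3) ne by (subst sets_bind[where N = borel]) auto
    fix A assume "A \<in> sets ?g"
    then have A [measurable]: "A \<in> sets borel" by simp
    have "emeasure (Giry_Monad.bind \<mu> K) A = (\<integral>\<^sup>+x. emeasure (K x) A \<partial>\<mu>)"
      using K'(1) \<mu>(2) by (intro emeasure_bind[OF ne _ A]) (simp cong: measurable_cong_sets)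
    then show "emeasure ?g A = emeasure (Giry_Monad.bind \<mu> K) A"
      using K'(3) by (simp add: nn)
  qed
qed

lemma flip_measure_facts:
  fixes Q :: "('a::euclidean_space \<times> 'a) measure"
  assumes Q [measurable_cong]: "sets Q = sets (borel \<Otimes>\<^sub>M borel)"
  shows "flip_measure (flip_measure Q) = Q"
    and "distr (flip_measure Q) borel fst = distr Q borel snd"
    and "distr (flip_measure Q) borel snd = distr Q borel fst"
    and "sets (flip_measure Q) = sets (borel \<Otimes>\<^sub>M borel)"
    and "prob_space Q \<Longrightarrow> prob_space (flip_measure Q)"
proof -
  have swap: "prod.swap = (\<lambda>(x, y). (y, x) :: 'a \<times> 'a)" by (auto simp: fun_eq_iff)
  have [measurable]: "prod.swap \<in> borel \<Otimes>\<^sub>M borel \<rightarrow>\<^sub>M (borel \<Otimes>\<^sub>M borel :: ('a \<times> 'a) measure)"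
    unfolding swap by measurable
  then have [measurable]: "prod.swap \<in> Q \<rightarrow>\<^sub>M (borel \<Otimes>\<^sub>M borel :: ('a \<times> 'a) measure)" by measurable
  show "flip_measure (flip_measure Q) = Q"
    unfolding flip_measure_def using Q by (subst distr_distr) (auto simp: comp_def distr_id2)
  show "distr (flip_measure Q) borel fst = distr Q borel snd"
    "distr (flip_measure Q) borel snd = distr Q borel fst"
    unfolding flip_measure_def by (subst distr_distr; auto simp: comp_def)+
  show "sets (flip_measure Q) = sets (borel \<Otimes>\<^sub>M borel)" by (simp add: flip_measure_def)
  show "prob_space Q \<Longrightarrow> prob_space (flip_measure Q)"
    unfolding flip_measure_def by (rule prob_space.prob_space_distr) auto
qed

section \<open>Contraction of the Sinkhorn bridges\<close>

text \<open>Continuous log-densities of the transitions and of the marginals, with the disintegration identity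
  holding at every point.\<close>

locale sinkhorn_potentials = sinkhorn U V W K
  for U V :: "real^'d \<Rightarrow> real" and W K +
  fixes w :: "nat \<Rightarrow> real^'d \<Rightarrow> real^'d \<Rightarrow> real" and b :: "nat \<Rightarrow> real^'d \<Rightarrow> real"
  assumes K_eq: "\<And>n. K n = gibbs_transition (w n)"
    and w_continuous: "\<And>n. continuous_on UNIV (\<lambda>z. w n (fst z) (snd z))"
    and b_continuous: "\<And>n. continuous_on UNIV (b n)"
    and marginal_eq: "\<And>n. sinkhorn_marginal (gibbs U) (gibbs V) K n = gibbs (b n)"
    and potential_eq: "\<And>n x y. (if even n then U x else V x) + w n x y = b n y + w (Suc n) y x"

lemma (in sinkhorn) obtain_potentials:
  obtains w b where "sinkhorn_potentials U V W K w b"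
proof -
  obtain w where w: "\<And>n. K n = gibbs_transition (w n)" "\<And>n. smooth (\<lambda>p. w n (fst p) (snd p))"
    using regularity by blast
  note wc = smooth_imp_continuous_on[OF w(2)]
  have sets: "sets (gibbs A) = sets borel" for A :: "real^'d \<Rightarrow> real" by (simp add: gibbs_def)
  let ?A = "\<lambda>n. if even n then U else V"
  have "\<exists>b. continuous_on UNIV b \<and> Giry_Monad.bind (gibbs (?A n)) (K n) = gibbs b \<and>
      (\<forall>x y. ?A n x + w n x y = b y + w (Suc n) y x)" for n
  proof -
    have M: "markov_transition (gibbs_transition (w n))" "markov_transition (gibbs_transition (w (Suc n)))"
      using markov[of n] markov[of "Suc n"] by (simp_all add: w)
    have "joint (gibbs (?A n)) (K n) = flip_measure (joint (Giry_Monad.bind (gibbs (?A n)) (K n)) (K (Suc n)))"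
    proof (cases "even n")
      case True
      then show ?thesis using transition_odd[OF True] by (simp add: sinkhorn_bridge_def sinkhorn_marginal_def)
    next
      case False
      then have "flip_measure (flip_measure (joint (gibbs V) (K n)))
          = flip_measure (joint (Giry_Monad.bind (gibbs V) (K n)) (K (Suc n)))"
        using transition_even[of n] by (simp add: sinkhorn_bridge_def sinkhorn_marginal_def)
      then show ?thesis
        using False by (subst (asm) flip_measure_facts(1)[OF sets_joint[OF markov sets]]) auto
    qed
    moreover have "continuous_on UNIV (?A n)"
      using smooth_imp_continuous_on[OF smooth_U] smooth_imp_continuous_on[OF smooth_V] by simp
    ultimately show ?thesis
      using disintegration_potential[OF _ wc wc M, of "?A n"] by (metis w(1))
  qed
  then obtain b where "\<And>n. continuous_on UNIV (b n) \<and>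
      Giry_Monad.bind (gibbs (?A n)) (K n) = gibbs (b n) \<and>
      (\<forall>x y. ?A n x + w n x y = b n y + w (Suc n) y x)" by metis
  note b = this
  have "sinkhorn_marginal (gibbs U) (gibbs V) K n = gibbs (b n)" for n
    using b[of n] by (cases "even n") (simp_all add: sinkhorn_marginal_def)
  moreover have "(if even n then U x else V x) + w n x y = b n y + w (Suc n) y x" for n x y
    using b[of n] by (cases "even n") simp_all
  ultimately have "sinkhorn_potentials_axioms U V K w b"
    using w(1) wc b unfolding sinkhorn_potentials_axioms_def by blast
  then show ?thesis using that sinkhorn_potentials.intro[OF sinkhorn_axioms] by blast
qed

context sinkhorn_potentials
begin

text \<open>The \<open>n\<close>-th transition starts from \<open>source n\<close>; its image should have the potential \<open>target n\<close>.\<close>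

abbreviation source :: "nat \<Rightarrow> real^'d \<Rightarrow> real" where
  "source n \<equiv> (if even n then U else V)"

abbreviation target :: "nat \<Rightarrow> real^'d \<Rightarrow> real" where
  "target n \<equiv> (if even n then V else U)"

abbreviation bridge :: "nat \<Rightarrow> ((real^'d) \<times> (real^'d)) measure" where
  "bridge n \<equiv> sinkhorn_bridge (gibbs U) (gibbs V) K n"

text \<open>The coordinate of \<open>(x, y)\<close> into which the \<open>n\<close>-th transition maps; the start is the coordinate
  \<open>arrival (Suc n)\<close>.\<close>

abbreviation arrival :: "nat \<Rightarrow> (real^'d) \<times> (real^'d) \<Rightarrow> real^'d" where
  "arrival n \<equiv> (if even n then snd else fst)"

definition entropy_drop :: "nat \<Rightarrow> ereal" where
  "entropy_drop n = rel_entropy (gibbs (target n)) (gibbs (b n))"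

lemma sets_gibbs [measurable_cong]: "sets (gibbs A) = sets borel"
  by (simp add: gibbs_def)

lemma continuous_UV: "continuous_on UNIV U" "continuous_on UNIV V"
  using smooth_imp_continuous_on smooth_U smooth_V by blast+

lemma measurable_UV [measurable]: "U \<in> borel_measurable borel" "V \<in> borel_measurable borel"
  using continuous_UV by (auto intro: borel_measurable_continuous_onI)

lemma measurable_b [measurable]: "b n \<in> borel_measurable borel"
  using b_continuous by (rule borel_measurable_continuous_onI)

lemma measurable_w: "(\<lambda>z. w n (fst z) (snd z)) \<in> borel_measurable (borel \<Otimes>\<^sub>M borel)"
  using borel_measurable_continuous_onI[OF w_continuous] by (simp add: borel_prod)

lemma prob_source: "prob_space (gibbs (source n))" using prob_U prob_V by simp

lemma prob_target: "prob_space (gibbs (target n))" using prob_U prob_V by simp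

lemma bridge_joint:
  "bridge n = (if even n then joint (gibbs (source n)) (K n) else flip_measure (joint (gibbs (source n)) (K n)))"
  by (simp add: sinkhorn_bridge_def)

lemma sets_bridge [measurable_cong]: "sets (bridge n) = sets (borel \<Otimes>\<^sub>M borel)"
  using flip_measure_facts(4)[OF sets_joint[OF markov sets_gibbs]] sets_joint[OF markov sets_gibbs]
  by (auto simp: bridge_joint)

lemma prob_bridge: "prob_space (bridge n)"
  using distr_joint(3)[OF markov prob_source sets_gibbs, of n n]
    flip_measure_facts(5)[OF sets_joint[OF markov sets_gibbs], of "source n" n]
  by (auto simp: bridge_joint)

lemma bind_source: "Giry_Monad.bind (gibbs (source n)) (K n) = gibbs (b n)"
  using marginal_eq[of n] by (auto simp: sinkhorn_marginal_def)

lemma distr_bridge_arrival: "distr (bridge n) borel (arrival n) = gibbs (b n)"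
  using distr_joint(2)[OF markov prob_source sets_gibbs, of n n] bind_source[of n]
    flip_measure_facts(2)[OF sets_joint[OF markov sets_gibbs], of "source n" n]
  by (auto simp: bridge_joint)

lemma distr_bridge_source: "distr (bridge n) borel (arrival (Suc n)) = gibbs (source n)"
  using distr_joint(1)[OF markov prob_source sets_gibbs, of n n]
    flip_measure_facts(3)[OF sets_joint[OF markov sets_gibbs], of "source n" n]
  by (auto simp: bridge_joint)

lemma measurable_arrival [measurable]: "arrival n \<in> borel \<Otimes>\<^sub>M borel \<rightarrow>\<^sub>M borel" by simp

lemma prob_b: "prob_space (gibbs (b n))"
  unfolding distr_bridge_arrival[symmetric]
  by (rule prob_space.prob_space_distr[OF prob_bridge]) measurable

lemma bridge_density:
  "bridge n = density (lborel \<Otimes>\<^sub>M lborel) (\<lambda>z. ennreal (exp (-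
     (source n (arrival (Suc n) z) + w n (arrival (Suc n) z) (arrival n z)))))"
proof -
  note [measurable (raw)] = borel_measurable_compose2[OF measurable_w]
  have M: "markov_transition (gibbs_transition (w n))" using markov[of n] by (simp add: K_eq)
  have J: "joint (gibbs A) (K n) = density (lborel \<Otimes>\<^sub>M lborel)
      (\<lambda>z. ennreal (exp (- (A (fst z) + w n (fst z) (snd z)))))"
    if [measurable]: "A \<in> borel_measurable borel" for A
    unfolding K_eq gibbs_def
    by (subst joint_density[OF measurable_w M]) (auto simp: ennreal_mult[symmetric] exp_add[symmetric])
  show ?thesis
  proof (cases "even n")
    case True
    then show ?thesis using J[of U] by (simp add: bridge_joint)
  next
    case False
    have "flip_measure (density (lborel \<Otimes>\<^sub>M lborel) (\<lambda>z. ennreal (exp (- (V (fst z) + w n (fst z) (snd z))))))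
      = density (lborel \<Otimes>\<^sub>M lborel) (\<lambda>z. ennreal (exp (- (V (fst (prod.swap z)) + w n (fst (prod.swap z)) (snd (prod.swap z))))))"
      by (rule flip_measure_density) measurable
    then show ?thesis using False J[of V] by (simp add: bridge_joint)
  qed
qed

text \<open>A half step keeps the backward transition and replaces the marginal of the arrival coordinate.\<close>

lemma bridge_Suc:
  "bridge (Suc n) = density (bridge n) (\<lambda>z. ennreal (exp (b n (arrival n z) - target n (arrival n z))))"
proof -
  note [measurable (raw)] = borel_measurable_compose2[OF measurable_w]
  have e: "exp (- (source (Suc n) (arrival (Suc (Suc n)) z) + w (Suc n) (arrival (Suc (Suc n)) z) (arrival (Suc n) z)))
    = exp (- (source n (arrival (Suc n) z) + w n (arrival (Suc n) z) (arrival n z)))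
      * exp (b n (arrival n z) - target n (arrival n z))" for z
    using potential_eq[of n "arrival (Suc n) z" "arrival n z"]
    by (cases "even n") (simp_all add: exp_add[symmetric])
  have [measurable]: "arrival m \<in> borel_measurable (lborel \<Otimes>\<^sub>M lborel)" for m by simp
  have [measurable]: "source m \<in> borel_measurable borel" "target m \<in> borel_measurable borel" for m by simp_all
  have "density (bridge n) (\<lambda>z. ennreal (exp (b n (arrival n z) - target n (arrival n z))))
    = density (lborel \<Otimes>\<^sub>M lborel) (\<lambda>z. ennreal (exp (- (source n (arrival (Suc n) z) + w n (arrival (Suc n) z) (arrival n z))))
        * ennreal (exp (b n (arrival n z) - target n (arrival n z))))"
    unfolding bridge_density by (rule density_density_eq) measurable
  also have "\<dots> = bridge (Suc n)"
    unfolding bridge_density[of "Suc n"] e by (simp add: ennreal_mult)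
  finally show ?thesis by simp
qed

lemma target_density:
  "gibbs (target n) = density (gibbs (b n)) (\<lambda>y. ennreal (exp (b n y - target n y)))"
proof -
  have [measurable]: "target n \<in> borel_measurable borel" by simp
  show ?thesis
    unfolding gibbs_def
    by (subst density_density_eq) (auto simp: ennreal_mult[symmetric] exp_add[symmetric])
qed

lemma entropy_drop_eq:
  "entropy_drop n = (if integrable (gibbs (target n)) (\<lambda>y. b n y - target n y)
     then ereal (\<integral>y. b n y - target n y \<partial>gibbs (target n)) else \<infinity>)"
proof -
  have [measurable]: "target n \<in> borel_measurable borel" by simp
  show ?thesis
    unfolding entropy_drop_def
    using rel_entropy_exp_density(1)[OF prob_b[of n], where k = "\<lambda>y. b n y - target n y"]
    unfolding target_density[symmetric] by (simp add: prob_target)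
qed

lemma entropy_drop_nonneg: "0 \<le> entropy_drop n"
  unfolding entropy_drop_def by (rule rel_entropy_nonneg[OF prob_b prob_target])

abbreviation Cpl :: "((real^'d) \<times> (real^'d)) measure set" where
  "Cpl \<equiv> couplings (gibbs U) (gibbs V)"

lemma coupling_facts:
  assumes Q: "Q \<in> Cpl"
  shows "prob_space Q" "sets Q = sets (borel \<Otimes>\<^sub>M borel)" "distr Q borel (arrival n) = gibbs (target n)"
proof -
  show s [measurable_cong]: "sets Q = sets (borel \<Otimes>\<^sub>M borel)" and "distr Q borel (arrival n) = gibbs (target n)"
    using Q by (auto simp: couplings_def)
  have "distr Q borel fst = gibbs U" using Q by (auto simp: couplings_def)
  then show "prob_space Q" using prob_U by (intro prob_space_distrD[of fst Q borel]) auto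
qed

text \<open>The log-density between consecutive bridges depends on the arrival coordinate only, and all
  couplings have the same law there.\<close>

lemma entropy_step:
  assumes Q: "Q \<in> Cpl" and fin: "entropy_drop n < \<infinity>"
  shows "rel_entropy Q (bridge n) = rel_entropy Q (bridge (Suc n)) + entropy_drop n"
proof -
  note Qf = coupling_facts[OF Q]
  note [measurable_cong] = Qf(2)
  let ?k = "\<lambda>y. b n y - target n y"
  have [measurable]: "target n \<in> borel_measurable borel" by simp
  have [measurable]: "arrival n \<in> Q \<rightarrow>\<^sub>M borel" by measurable
  have i: "integrable (gibbs (target n)) ?k" and d: "entropy_drop n = ereal (\<integral>y. ?k y \<partial>gibbs (target n))"
    using fin entropy_drop_eq[of n] by (auto split: if_splits)
  have iQ: "integrable Q (\<lambda>z. ?k (arrival n z))"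
    using i unfolding Qf(3)[of n, symmetric] by (subst (asm) integrable_distr_eq) auto
  have "(\<integral>z. ?k (arrival n z) \<partial>Q) = (\<integral>y. ?k y \<partial>gibbs (target n))"
    unfolding Qf(3)[of n, symmetric] by (subst integral_distr) auto
  then show ?thesis
    using rel_entropy_shift[OF prob_bridge[of n] _ Qf(1) _ _ iQ] prob_bridge[of "Suc n"] d
    unfolding bridge_Suc[symmetric] by (simp add: sets_bridge Qf(2) del: if_distrib)
qed

lemma bridge_0: "bridge 0 = joint (gibbs U) (gibbs_transition W)"
  by (simp add: sinkhorn_bridge_def transition_0)

text \<open>Finiteness of the entropy of one coupling propagates along the iteration: data processing makes
  the drop finite, and subtracting it leaves a finite entropy.\<close>

lemma finite_coupling: "\<exists>Q\<in>Cpl. rel_entropy Q (bridge n) < \<infinity>"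
  and entropy_drop_finite: "entropy_drop n < \<infinity>"
proof -
  have dr: "entropy_drop n < \<infinity>" if Q: "Q \<in> Cpl" "rel_entropy Q (bridge n) < \<infinity>" for Q n
  proof -
    have "entropy_drop n \<le> rel_entropy Q (bridge n)"
      unfolding entropy_drop_def distr_bridge_arrival[symmetric] coupling_facts(3)[OF Q(1), symmetric]
      by (rule rel_entropy_distr_le[OF prob_bridge]) (use coupling_facts[OF Q(1)] sets_bridge in auto)
    then show ?thesis using Q(2) by (rule le_less_trans)
  qed
  have ex: "\<exists>Q\<in>Cpl. rel_entropy Q (bridge n) < \<infinity>" for n
  proof (induction n)
    case 0
    then show ?case using finite_entropy by (simp add: bridge_0)
  next
    case (Suc n)
    then obtain Q where Q: "Q \<in> Cpl" "rel_entropy Q (bridge n) < \<infinity>" by blast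
    have "rel_entropy Q (bridge (Suc n)) < \<infinity>"
      using entropy_step[OF Q(1) dr[OF Q]] Q(2) by auto
    then show ?case using Q(1) by blast
  qed
  show "\<exists>Q\<in>Cpl. rel_entropy Q (bridge n) < \<infinity>" by (rule ex)
  show "entropy_drop n < \<infinity>" using ex dr by blast
qed

lemma entropy_drop_real: obtains d where "entropy_drop n = ereal d" "d \<ge> 0"
  using entropy_drop_finite[of n] entropy_drop_nonneg[of n] by (cases "entropy_drop n") auto

abbreviation Pstar :: "((real^'d) \<times> (real^'d)) measure" where
  "Pstar \<equiv> schroedinger_bridge (gibbs U) (gibbs V) (joint (gibbs U) (gibbs_transition W))"

text \<open>The entropies relative to different bridges differ by constants on the set of couplings, so they
  have the same minimiser.\<close>

lemma schroedinger_minimal: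
  "Pstar \<in> Cpl" "Q \<in> Cpl \<Longrightarrow> rel_entropy Pstar (bridge n) \<le> rel_entropy Q (bridge n)"
  "rel_entropy Pstar (bridge n) < \<infinity>"
proof -
  interpret coupling_projection "bridge 0" "gibbs U" "gibbs V"
    by (intro coupling_projection.intro prob_bridge prob_U prob_V sets_bridge sets_gibbs)
  obtain Q0 where "Q0 \<in> Cpl" "rel_entropy Q0 (bridge 0) < \<infinity>" using finite_coupling by blast
  then have "\<exists>Q. is_arg_min (\<lambda>Q. rel_entropy Q (bridge 0)) (\<lambda>Q. Q \<in> Cpl) Q"
    using exists_minimal_entropy[of Q0] unfolding is_arg_min_def by (meson linorder_not_less)
  then have am: "is_arg_min (\<lambda>Q. rel_entropy Q (bridge 0)) (\<lambda>Q. Q \<in> Cpl) Pstar"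
    unfolding schroedinger_bridge_def arg_min_def bridge_0[symmetric] by (rule someI_ex)
  then show P: "Pstar \<in> Cpl" by (simp add: is_arg_min_def)
  have le: "rel_entropy Pstar (bridge n) \<le> rel_entropy Q (bridge n)" if Q: "Q \<in> Cpl" for Q n
  proof (induction n)
    case 0
    then show ?case using am Q by (auto simp: is_arg_min_def not_less)
  next
    case (Suc n)
    obtain d where d: "entropy_drop n = ereal d" using entropy_drop_real by blast
    have "rel_entropy Pstar (bridge (Suc n)) + ereal d \<le> rel_entropy Q (bridge (Suc n)) + ereal d"
      using Suc entropy_step[OF P entropy_drop_finite, of n] entropy_step[OF Q entropy_drop_finite, of n] d by simp
    then show ?case by (cases "rel_entropy Pstar (bridge (Suc n))"; cases "rel_entropy Q (bridge (Suc n))") auto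
  qed
  then show "Q \<in> Cpl \<Longrightarrow> rel_entropy Pstar (bridge n) \<le> rel_entropy Q (bridge n)" .
  show "rel_entropy Pstar (bridge n) < \<infinity>" using finite_coupling[of n] le by (meson le_less_trans)
qed

text \<open>The drop is also the entropy of the new bridge relative to the old one; projecting both on the
  coordinate that was correct before the step can only decrease it.\<close>

lemma marginal_entropy_le_drop:
  "rel_entropy (gibbs (b (Suc n))) (gibbs (source n)) \<le> entropy_drop n"
proof -
  let ?k = "\<lambda>y. b n y - target n y"
  have [measurable]: "target n \<in> borel_measurable borel" by simp
  have dT: "distr (bridge (Suc n)) borel (arrival n) = gibbs (target n)"
    using distr_bridge_source[of "Suc n"] by (cases "even n") auto
  have "rel_entropy (bridge (Suc n)) (bridge n) = (if integrable (bridge (Suc n)) (\<lambda>z. ?k (arrival n z))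
      then ereal (\<integral>z. ?k (arrival n z) \<partial>bridge (Suc n)) else \<infinity>)"
    using rel_entropy_exp_density(1)[OF prob_bridge[of n], where k = "\<lambda>z. ?k (arrival n z)"]
    unfolding bridge_Suc[symmetric] by (simp add: prob_bridge)
  also have "\<dots> = entropy_drop n"
    unfolding entropy_drop_eq dT[symmetric] by (simp add: integrable_distr_eq integral_distr)
  finally have e: "rel_entropy (bridge (Suc n)) (bridge n) = entropy_drop n" .
  show ?thesis
    unfolding e[symmetric] distr_bridge_arrival[of "Suc n", symmetric] distr_bridge_source[of n, symmetric]
    by (rule rel_entropy_distr_le[OF prob_bridge prob_bridge]) (use sets_bridge in auto)
qed

text \<open>The bridge of odd index \<open>n\<close> has the right second marginal, so letting the next transition act
  on its first marginal produces \<open>gibbs V\<close>, and \<open>coupled_transition_entropy\<close> yields a competitor.\<close>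

lemma bridge_entropy_le_transport:
  assumes n: "odd n" and C: "C > 0"
    and ent: "\<And>x1 x2. rel_entropy (K (Suc n) x1) (K (Suc n) x2) \<le> ereal (C / 2 * (norm (x1 - x2))\<^sup>2)"
    and \<gamma>: "\<gamma> \<in> couplings (gibbs (b n)) (gibbs U)"
  shows "rel_entropy Pstar (bridge (Suc n))
    \<le> enn2ereal (ennreal (C / 2) * (\<integral>\<^sup>+p. ennreal ((norm (fst p - snd p))\<^sup>2) \<partial>\<gamma>))"
proof -
  have M: "markov_transition (gibbs_transition (w (Suc n)))" using markov[of "Suc n"] by (simp add: K_eq)
  have J: "bridge n = joint (gibbs (b n)) (K (Suc n))"
    using transition_even[OF n] marginal_eq[of n] by simp
  have B: "Giry_Monad.bind (gibbs (b n)) (K (Suc n)) = gibbs V"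
    using distr_joint(2)[OF markov prob_b sets_gibbs, of n "Suc n"] distr_bridge_source[of n] n
    by (simp add: J)
  have c: "rel_entropy (gibbs_transition (w (Suc n)) x1) (gibbs_transition (w (Suc n)) x2)
      \<le> enn2ereal (ennreal (C / 2 * (norm (x1 - x2))\<^sup>2))" for x1 x2
    using ent[of x1 x2] C by (simp add: K_eq enn2ereal_ennreal)
  obtain Q where Q: "Q \<in> Cpl" "rel_entropy Q (bridge (Suc n))
      \<le> enn2ereal (\<integral>\<^sup>+p. ennreal (C / 2 * (norm (fst p - snd p))\<^sup>2) \<partial>\<gamma>)"
    using coupled_transition_entropy[OF measurable_w M prob_b sets_gibbs prob_U sets_gibbs \<gamma> c]
      B n by (auto simp: bridge_joint K_eq)
  have s [measurable_cong]: "sets \<gamma> = sets (borel \<Otimes>\<^sub>M borel)" using \<gamma> by (simp add: couplings_def)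
  have "(\<integral>\<^sup>+p. ennreal (C / 2 * (norm (fst p - snd p))\<^sup>2) \<partial>\<gamma>)
      = (\<integral>\<^sup>+p. ennreal (C / 2) * ennreal ((norm (fst p - snd p))\<^sup>2) \<partial>\<gamma>)"
    using C by (intro nn_integral_cong ennreal_mult) auto
  also have "\<dots> = ennreal (C / 2) * (\<integral>\<^sup>+p. ennreal ((norm (fst p - snd p))\<^sup>2) \<partial>\<gamma>)"
    by (rule nn_integral_cmult) measurable
  finally have e: "(\<integral>\<^sup>+p. ennreal (C / 2 * (norm (fst p - snd p))\<^sup>2) \<partial>\<gamma>)
      = ennreal (C / 2) * (\<integral>\<^sup>+p. ennreal ((norm (fst p - snd p))\<^sup>2) \<partial>\<gamma>)" .
  show ?thesis
    using order_trans[OF schroedinger_minimal(2)[OF Q(1), of "Suc n"] Q(2)] unfolding e .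
qed

lemma bridge_entropy_le_drop:
  assumes n: "even n" and C: "C > 0" and r: "r > 0" and T2: "talagrand2 (gibbs U) r"
    and ent: "\<And>x1 x2. rel_entropy (K (Suc (Suc n)) x1) (K (Suc (Suc n)) x2)
      \<le> ereal (C / 2 * (norm (x1 - x2))\<^sup>2)"
  shows "rel_entropy Pstar (bridge (Suc (Suc n))) \<le> ereal (C * r) * entropy_drop n"
proof -
  let ?\<nu> = "gibbs (b (Suc n))"
  obtain d where d: "entropy_drop n = ereal d" using entropy_drop_real by blast
  obtain h where h: "rel_entropy ?\<nu> (gibbs U) = ereal h" "h \<le> d"
    using marginal_entropy_le_drop[of n] rel_entropy_nonneg[OF prob_U prob_b, of "Suc n"] n d
    by (cases "rel_entropy ?\<nu> (gibbs U)") auto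
  have T: "ereal (1 / 2) * (wasserstein2 ?\<nu> (gibbs U))\<^sup>2 \<le> ereal (r * h)"
    using T2 prob_b[of "Suc n"] h(1) by (auto simp: talagrand2_def sets_gibbs)
  have fin: "transport_cost2 ?\<nu> (gibbs U) \<noteq> \<infinity>"
    using T by (auto simp: wasserstein2_def power2_eq_square)
  define t where "t = enn2real (transport_cost2 ?\<nu> (gibbs U))"
  have t: "transport_cost2 ?\<nu> (gibbs U) = ennreal t" "t \<ge> 0" using fin by (auto simp: t_def less_top)
  have th: "t / 2 \<le> r * h" using T fin t(2) by (simp add: wasserstein2_def t_def[symmetric] power2_eq_square)
  obtain p where p: "rel_entropy Pstar (bridge (Suc (Suc n))) = ereal p"
    using schroedinger_minimal(3)[of "Suc (Suc n)"]
      rel_entropy_nonneg[OF prob_bridge[of "Suc (Suc n)"] coupling_facts(1)[OF schroedinger_minimal(1)]]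
    by (cases "rel_entropy Pstar (bridge (Suc (Suc n)))") auto
  have "p \<le> C / 2 * t + e" if e: "e > 0" for e
  proof -
    have pos: "e / (C / 2) > 0" using e C by simp
    \<comment> \<open>a nearly optimal coupling suffices, as \<open>e\<close> is arbitrary\<close>
    have "transport_cost2 ?\<nu> (gibbs U) < ennreal (t + e / (C / 2))"
      unfolding t(1) using pos t(2) by (intro ennreal_lessI) linarith+
    then obtain \<gamma> where \<gamma>: "\<gamma> \<in> couplings ?\<nu> (gibbs U)"
      "(\<integral>\<^sup>+p. ennreal ((norm (fst p - snd p))\<^sup>2) \<partial>\<gamma>) < ennreal (t + e / (C / 2))"
      unfolding transport_cost2_def by (auto simp: INF_less_iff)
    have "ereal p \<le> enn2ereal (ennreal (C / 2) * (\<integral>\<^sup>+p. ennreal ((norm (fst p - snd p))\<^sup>2) \<partial>\<gamma>))"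
      using bridge_entropy_le_transport[OF _ C ent \<gamma>(1)] n p by simp
    also have "\<dots> \<le> enn2ereal (ennreal (C / 2) * ennreal (t + e / (C / 2)))"
      using \<gamma>(2) unfolding less_eq_ennreal.rep_eq[symmetric] by (intro mult_left_mono) auto
    also have "\<dots> = ereal (C / 2 * (t + e / (C / 2)))"
    proof -
      have "0 \<le> t + e / (C / 2)" "0 \<le> C / 2" using pos t(2) C by linarith+
      then have "ennreal (C / 2) * ennreal (t + e / (C / 2)) = ennreal (C / 2 * (t + e / (C / 2)))"
        and "0 \<le> C / 2 * (t + e / (C / 2))"
        by (rule ennreal_mult[symmetric, rotated], intro mult_nonneg_nonneg)
      then show ?thesis by (simp only: enn2ereal_ennreal)
    qed
    also have "C / 2 * (t + e / (C / 2)) = C / 2 * t + e" using C by (simp add: field_simps)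
    finally show ?thesis by simp
  qed
  then have "p \<le> C / 2 * t" by (rule field_le_epsilon)
  also have "\<dots> \<le> C * (r * h)" using th C by simp
  also have "\<dots> \<le> C * (r * d)" using h(2) C r by simp
  finally show ?thesis using p d by (simp add: mult.assoc)
qed

text \<open>A bound by a multiple of the first of the two drops that separate the even bridges is a
  contraction.\<close>

theorem bridge_entropy_contraction:
  assumes n: "n \<ge> 1" and C: "C > 0" and r: "r > 0" and T2: "talagrand2 (gibbs U) r"
    and ent: "\<And>x1 x2. rel_entropy (K (2 * n) x1) (K (2 * n) x2)
      \<le> ereal (C / 2 * (norm (x1 - x2))\<^sup>2)"
  shows "rel_entropy Pstar (bridge (2 * n))
    \<le> ereal (inverse (1 + inverse (C * r))) * rel_entropy Pstar (bridge (2 * (n - 1)))"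
proof -
  define m where "m = 2 * (n - 1)"
  have m: "even m" "2 * n = Suc (Suc m)" using n by (auto simp: m_def)
  obtain d where d: "entropy_drop m = ereal d" "d \<ge> 0" by (rule entropy_drop_real)
  obtain d' where d': "entropy_drop (Suc m) = ereal d'" "d' \<ge> 0" by (rule entropy_drop_real)
  obtain p where p: "rel_entropy Pstar (bridge (2 * n)) = ereal p"
    using schroedinger_minimal(3)[of "2 * n"]
      rel_entropy_nonneg[OF prob_bridge[of "2 * n"] coupling_facts(1)[OF schroedinger_minimal(1)]]
    by (cases "rel_entropy Pstar (bridge (2 * n))") auto
  have pd: "p \<le> C * r * d"
    using bridge_entropy_le_drop[OF m(1) C r T2] ent p d unfolding m(2) by simp
  have "rel_entropy Pstar (bridge m) = ereal (p + d' + d)"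
    using entropy_step[OF schroedinger_minimal(1) entropy_drop_finite, of m]
      entropy_step[OF schroedinger_minimal(1) entropy_drop_finite, of "Suc m"] p d d' m(2) by simp
  moreover have "p \<le> inverse (1 + inverse (C * r)) * (p + d' + d)"
  proof -
    have e: "C * r > 0" using C r by simp
    have "p * (1 + inverse (C * r)) = p + p / (C * r)" by (simp add: field_simps)
    also have "p / (C * r) \<le> d" using pd e by (simp add: divide_le_eq mult.commute)
    also have "p + d \<le> p + d' + d" using d' by simp
    finally have "p * (1 + inverse (C * r)) \<le> p + d' + d" by simp
    moreover have "1 + inverse (C * r) > 0" using positive_imp_inverse_positive[OF e] by linarith
    ultimately show ?thesis by (simp add: field_simps)
  qed
  ultimately show ?thesis unfolding p m_def[symmetric] by simp
qed

end

section \<open>Gaussian concentration from two-point growth\<close>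

lemma nn_integral_lborel_affine:
  fixes f :: "'a::euclidean_space \<Rightarrow> ennreal"
  assumes [measurable]: "f \<in> borel_measurable borel" and c: "c \<noteq> 0"
  shows "(\<integral>\<^sup>+x. f x \<partial>lborel) = ennreal (\<bar>c\<bar> ^ DIM('a)) * (\<integral>\<^sup>+x. f (t + c *\<^sub>R x) \<partial>lborel)"
  by (subst lborel_affine[OF c, of t])
     (simp add: nn_integral_density nn_integral_distr nn_integral_cmult)

text \<open>The substitution \<open>y = s + r\<close>, \<open>y' = s - r\<close>, done one variable at a time: scaling by \<open>-2\<close>
  in \<open>y'\<close>, then a translation in \<open>y\<close>.\<close>

lemma nn_integral_midpoint_coordinates:
  fixes f :: "'a::euclidean_space \<Rightarrow> 'a \<Rightarrow> ennreal"
  assumes f: "(\<lambda>z. f (fst z) (snd z)) \<in> borel_measurable (borel \<Otimes>\<^sub>M borel)"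
  shows "(\<integral>\<^sup>+y. \<integral>\<^sup>+y'. f y y' \<partial>lborel \<partial>lborel)
       = ennreal (2 ^ DIM('a)) * (\<integral>\<^sup>+s. \<integral>\<^sup>+r. f (s + r) (s - r) \<partial>lborel \<partial>lborel)"
proof -
  note [measurable (raw)] = borel_measurable_compose2[OF f]
  have "(\<integral>\<^sup>+y. \<integral>\<^sup>+y'. f y y' \<partial>lborel \<partial>lborel)
      = (\<integral>\<^sup>+y. ennreal (2 ^ DIM('a)) * (\<integral>\<^sup>+r. f y (y - 2 *\<^sub>R r) \<partial>lborel) \<partial>lborel)"
  proof (rule nn_integral_cong)
    fix y show "(\<integral>\<^sup>+y'. f y y' \<partial>lborel) = ennreal (2 ^ DIM('a)) * (\<integral>\<^sup>+r. f y (y - 2 *\<^sub>R r) \<partial>lborel)"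
      using nn_integral_lborel_affine[of "f y" "-2" y] by simp
  qed
  also have "\<dots> = ennreal (2 ^ DIM('a)) * (\<integral>\<^sup>+y. \<integral>\<^sup>+r. f y (y - 2 *\<^sub>R r) \<partial>lborel \<partial>lborel)"
    by (rule nn_integral_cmult) measurable
  also have "(\<integral>\<^sup>+y. \<integral>\<^sup>+r. f y (y - 2 *\<^sub>R r) \<partial>lborel \<partial>lborel)
      = (\<integral>\<^sup>+r. \<integral>\<^sup>+y. f y (y - 2 *\<^sub>R r) \<partial>lborel \<partial>lborel)"
    by (rule lborel_pair.Fubini') measurable
  also have "\<dots> = (\<integral>\<^sup>+r. \<integral>\<^sup>+s. f (s + r) (s - r) \<partial>lborel \<partial>lborel)"
  proof (rule nn_integral_cong)
    fix r :: 'a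
    have "r + 1 *\<^sub>R s = s + r" "(s + r) - 2 *\<^sub>R r = s - r" for s by (simp_all add: scaleR_2)
    then show "(\<integral>\<^sup>+y. f y (y - 2 *\<^sub>R r) \<partial>lborel) = (\<integral>\<^sup>+s. f (s + r) (s - r) \<partial>lborel)"
      using nn_integral_lborel_affine[of "\<lambda>y. f y (y - 2 *\<^sub>R r)" 1 r]
      by (simp only: power_one abs_one ennreal_1 mult_1 simp_thms)
        (simp add: measurable_compose)
  qed
  also have "\<dots> = (\<integral>\<^sup>+s. \<integral>\<^sup>+r. f (s + r) (s - r) \<partial>lborel \<partial>lborel)"
    by (rule lborel_pair.Fubini') measurable
  finally show ?thesis .
qed

text \<open>For fixed midpoint \<open>s\<close> replace \<open>r\<close> by \<open>2 r\<close>.  The growth condition pays for the exponential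
  weight and returns the unweighted integrand at \<open>r\<close>; the Jacobian accounts for the power of \<open>2\<close>.  The
  exponent \<open>a / 8\<close> becomes \<open>2 a |r|\<^sup>2\<close> at the point \<open>2 r\<close>, which leaves \<open>- a |r|\<^sup>2\<close> to absorb the
  linear term.\<close>

lemma two_point_exponential_moment:
  fixes w :: "'a::euclidean_space \<Rightarrow> real"
  assumes w [measurable]: "w \<in> borel_measurable borel" and a: "a > 0"
    and growth: "\<And>s r. w (s + r) + w (s - r) + 3 * a * (norm r)\<^sup>2 - 2 * D * norm r
      \<le> w (s + 2 *\<^sub>R r) + w (s - 2 *\<^sub>R r)"
  shows "(\<integral>\<^sup>+y. \<integral>\<^sup>+y'. ennreal (exp (a / 8 * (norm (y - y'))\<^sup>2) * exp (- w y) * exp (- w y')) \<partial>lborel \<partial>lborel)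
    \<le> ennreal (2 ^ DIM('a) * exp (D\<^sup>2 / a)) *
      (\<integral>\<^sup>+y. \<integral>\<^sup>+y'. ennreal (exp (- w y) * exp (- w y')) \<partial>lborel \<partial>lborel)"
proof -
  let ?F = "\<lambda>y y'. ennreal (exp (a / 8 * (norm (y - y'))\<^sup>2) * exp (- w y) * exp (- w y'))"
  let ?G = "\<lambda>y y'. ennreal (exp (- w y) * exp (- w y'))"
  let ?c = "ennreal (2 ^ DIM('a))" and ?e = "ennreal (exp (D\<^sup>2 / a))"
  have pw: "exp (a / 8 * (norm ((s + 2 *\<^sub>R r) - (s - 2 *\<^sub>R r)))\<^sup>2) * exp (- w (s + 2 *\<^sub>R r)) * exp (- w (s - 2 *\<^sub>R r))
      \<le> exp (D\<^sup>2 / a) * (exp (- w (s + r)) * exp (- w (s - r)))" for s r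
  proof -
    have "(s + 2 *\<^sub>R r) - (s - 2 *\<^sub>R r) = 4 *\<^sub>R r"
      by (simp add: scaleR_add_left[symmetric])
    then have n: "(norm ((s + 2 *\<^sub>R r) - (s - 2 *\<^sub>R r)))\<^sup>2 = 16 * (norm r)\<^sup>2"
      by (simp add: power_mult_distrib)
    have "0 \<le> (a * norm r - D)\<^sup>2 / a" using a by simp
    also have "\<dots> = a * (norm r)\<^sup>2 - 2 * D * norm r + D\<^sup>2 / a"
      using a by (simp add: power2_eq_square field_simps)
    finally have "a / 8 * (16 * (norm r)\<^sup>2) - w (s + 2 *\<^sub>R r) - w (s - 2 *\<^sub>R r)
        \<le> D\<^sup>2 / a - w (s + r) - w (s - r)"
      using growth[of s r] by argo
    then show ?thesis unfolding n by (simp add: exp_add[symmetric])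
  qed
  have "(\<integral>\<^sup>+y. \<integral>\<^sup>+y'. ?F y y' \<partial>lborel \<partial>lborel)
    = ?c * (\<integral>\<^sup>+s. \<integral>\<^sup>+r. ?F (s + r) (s - r) \<partial>lborel \<partial>lborel)"
    by (rule nn_integral_midpoint_coordinates) measurable
  also have "(\<integral>\<^sup>+s. \<integral>\<^sup>+r. ?F (s + r) (s - r) \<partial>lborel \<partial>lborel)
    \<le> (\<integral>\<^sup>+s. ?c * (?e * (\<integral>\<^sup>+r. ?G (s + r) (s - r) \<partial>lborel)) \<partial>lborel)"
  proof (rule nn_integral_mono)
    fix s :: 'a
    have "(\<integral>\<^sup>+r. ?F (s + r) (s - r) \<partial>lborel)
      = ?c * (\<integral>\<^sup>+r. ?F (s + 2 *\<^sub>R r) (s - 2 *\<^sub>R r) \<partial>lborel)"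
      by (subst nn_integral_lborel_affine[of _ 2 0]) simp_all
    also have "\<dots> \<le> ?c * (\<integral>\<^sup>+r. ?e * ?G (s + r) (s - r) \<partial>lborel)"
      using pw[of s] by (intro mult_left_mono nn_integral_mono) (simp_all add: ennreal_mult[symmetric] ennreal_leI)
    also have "\<dots> = ?c * (?e * (\<integral>\<^sup>+r. ?G (s + r) (s - r) \<partial>lborel))"
      by (subst nn_integral_cmult) auto
    finally show "(\<integral>\<^sup>+r. ?F (s + r) (s - r) \<partial>lborel)
      \<le> ?c * (?e * (\<integral>\<^sup>+r. ?G (s + r) (s - r) \<partial>lborel))" .
  qed
  also have "\<dots> = (?c * ?e) * (\<integral>\<^sup>+s. \<integral>\<^sup>+r. ?G (s + r) (s - r) \<partial>lborel \<partial>lborel)"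
    unfolding mult.assoc[symmetric] by (rule nn_integral_cmult) measurable
  also have "?c * ((?c * ?e) * (\<integral>\<^sup>+s. \<integral>\<^sup>+r. ?G (s + r) (s - r) \<partial>lborel \<partial>lborel))
    = (?c * ?e) * (?c * (\<integral>\<^sup>+s. \<integral>\<^sup>+r. ?G (s + r) (s - r) \<partial>lborel \<partial>lborel))"
    by (simp only: mult_ac)
  also have "?c * (\<integral>\<^sup>+s. \<integral>\<^sup>+r. ?G (s + r) (s - r) \<partial>lborel \<partial>lborel)
    = (\<integral>\<^sup>+y. \<integral>\<^sup>+y'. ?G y y' \<partial>lborel \<partial>lborel)"
    by (rule nn_integral_midpoint_coordinates[symmetric]) measurable
  also have "?c * ?e = ennreal (2 ^ DIM('a) * exp (D\<^sup>2 / a))" by (simp add: ennreal_mult)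
  finally show ?thesis by (simp add: mult_left_mono)
qed

text \<open>Hoeffding's lemma for a fair sign.\<close>

lemma cosh_le_exp_half_square: "exp z + exp (- z) \<le> 2 * exp (z\<^sup>2 / 2)" for z :: real
proof -
  have nn: "exp z + exp (- z) \<le> 2 * exp (z\<^sup>2 / 2)" if "z \<ge> 0" for z :: real
  proof -
    have pos: "0 < 1 + 1 / 2 * (exp (2 * z) - 1)" using exp_gt_zero[of "2 * z"] by argo
    have "- (2 * z) * (1 / 2) + ln (1 + 1 / 2 * (exp (2 * z) - 1)) \<le> (2 * z)\<^sup>2 / 8"
      by (rule Hoeffdings_lemma_aux) (use that in auto)
    then have "ln (1 + 1 / 2 * (exp (2 * z) - 1)) \<le> z\<^sup>2 / 2 + z" by (simp add: power2_eq_square)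
    then have "1 + 1 / 2 * (exp (2 * z) - 1) \<le> exp (z\<^sup>2 / 2 + z)"
      using pos by (metis exp_le_cancel_iff exp_ln)
    then have "(1 + 1 / 2 * (exp (2 * z) - 1)) * exp (- z) \<le> exp (z\<^sup>2 / 2 + z) * exp (- z)"
      by (intro mult_right_mono) auto
    also have "exp (z\<^sup>2 / 2 + z) * exp (- z) = exp (z\<^sup>2 / 2)" by (simp add: exp_add[symmetric])
    also have "(1 + 1 / 2 * (exp (2 * z) - 1)) * exp (- z) = (exp (- z) + exp (2 * z) * exp (- z)) / 2"
      by (simp add: algebra_simps)
    also have "exp (2 * z) * exp (- z) = exp z" by (simp add: exp_add[symmetric])
    finally show ?thesis by simp
  qed
  show ?thesis using nn[of z] nn[of "- z"] by (cases "z \<ge> 0") (auto simp: add.commute)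
qed

text \<open>A tangent-line form of Jensen's inequality for the concave power \<open>t powr p\<close> at \<open>t = M\<close>.\<close>

lemma exp_scaled_le:
  fixes M :: real
  assumes "0 \<le> p" "p \<le> 1" "M \<ge> 1"
  shows "exp (p * z) \<le> exp (p * ln M) * (p * exp z / M + (1 - p))"
proof -
  have "convex_on UNIV (exp :: real \<Rightarrow> real)" by (rule exp_convex)
  then have "exp ((1 - p) * 0 + p * (z - ln M)) \<le> (1 - p) * exp 0 + p * exp (z - ln M)"
    using assms by (auto dest: convex_onD[of UNIV exp p 0 "z - ln M"])
  then have "exp (p * (z - ln M)) \<le> p * exp z / M + (1 - p)"
    using assms by (simp add: exp_diff)
  then have "exp (p * ln M) * exp (p * (z - ln M)) \<le> exp (p * ln M) * (p * exp z / M + (1 - p))"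
    by (rule mult_left_mono) simp
  then show ?thesis by (simp add: exp_add[symmetric] algebra_simps)
qed

text \<open>If \<open>L\<close> is small, symmetrising replaces the exponential by a hyperbolic cosine, which is quadratic
  near \<open>0\<close>, and Jensen's inequality lowers the exponent of the moment.  If \<open>L\<close> is large, the linear
  term is absorbed by completing the square, and the factor \<open>M\<close> by the size of \<open>L\<close>.\<close>

lemma symmetrized_exponential_bound:
  fixes \<nu> :: "'a::euclidean_space measure"
  assumes \<nu>: "prob_space \<nu>" and s [measurable_cong]: "sets \<nu> = sets borel"
    and h [measurable]: "h \<in> borel_measurable borel"
    and lip: "\<And>y y'. \<bar>h y - h y'\<bar> \<le> L * norm (y - y')"
    and L: "L \<ge> 0" and \<alpha>: "\<alpha> > 0" and M: "M \<ge> 1"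
    and moment: "(\<integral>\<^sup>+y. \<integral>\<^sup>+y'. ennreal (exp (\<alpha> * (norm (y - y'))\<^sup>2)) \<partial>\<nu> \<partial>\<nu>) \<le> ennreal M"
  shows "(\<integral>\<^sup>+y. \<integral>\<^sup>+y'. ennreal (exp (2 * (h y - h y'))) \<partial>\<nu> \<partial>\<nu>)
    \<le> ennreal (exp ((1 + 2 * ln M) / \<alpha> * L\<^sup>2))"
proof -
  let ?X = "\<lambda>y y'. ennreal (exp (\<alpha> * (norm (y - y'))\<^sup>2))"
  let ?B = "ennreal (exp ((1 + 2 * ln M) / \<alpha> * L\<^sup>2))" and ?c = "\<lambda>p. ennreal (2 * exp (p * ln M))"
  interpret prob_space \<nu> by fact
  interpret pair: pair_sigma_finite \<nu> \<nu> ..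
  let ?E = "\<integral>\<^sup>+y. \<integral>\<^sup>+y'. ennreal (exp (2 * (h y - h y'))) \<partial>\<nu> \<partial>\<nu>"
  have lnM: "ln M \<ge> 0" using M by simp
  show ?thesis
  proof (cases "2 * L\<^sup>2 \<le> \<alpha>")
    case True
    define p where "p = 2 * L\<^sup>2 / \<alpha>"
    have p: "0 \<le> p" "p \<le> 1" using True \<alpha> by (auto simp: p_def)
    have sym: "?E = (\<integral>\<^sup>+y. \<integral>\<^sup>+y'. ennreal (exp (2 * (h y' - h y))) \<partial>\<nu> \<partial>\<nu>)"
      by (rule pair.Fubini') measurable
    have pw: "exp (2 * (h y - h y')) + exp (2 * (h y' - h y))
        \<le> 2 * (exp (p * ln M) * (p * exp (\<alpha> * (norm (y - y'))\<^sup>2) / M + (1 - p)))" for y y'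
    proof -
      let ?z = "2 * (h y - h y')"
      have "exp ?z + exp (- ?z) \<le> 2 * exp (?z\<^sup>2 / 2)" by (rule cosh_le_exp_half_square)
      also have "?z\<^sup>2 / 2 = 2 * \<bar>h y - h y'\<bar>\<^sup>2" by (simp only: power_mult_distrib power2_abs) simp
      also have "2 * exp (2 * \<bar>h y - h y'\<bar>\<^sup>2) \<le> 2 * exp (2 * (L * norm (y - y'))\<^sup>2)"
        using power_mono[OF lip[of y y'], of 2] by (simp del: power2_abs)
      also have "2 * (L * norm (y - y'))\<^sup>2 = p * (\<alpha> * (norm (y - y'))\<^sup>2)"
        using \<alpha> by (simp add: p_def power_mult_distrib)
      also have "2 * exp (p * (\<alpha> * (norm (y - y'))\<^sup>2))
          \<le> 2 * (exp (p * ln M) * (p * exp (\<alpha> * (norm (y - y'))\<^sup>2) / M + (1 - p)))"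
        using exp_scaled_le[OF p M] by simp
      finally show ?thesis by simp
    qed
    have "?E + ?E = (\<integral>\<^sup>+y. \<integral>\<^sup>+y'. ennreal (exp (2 * (h y - h y')) + exp (2 * (h y' - h y))) \<partial>\<nu> \<partial>\<nu>)"
      by (subst (2) sym) (simp add: nn_integral_add[symmetric] ennreal_plus)
    also have "\<dots> \<le> (\<integral>\<^sup>+y. \<integral>\<^sup>+y'. ?c p *
        (ennreal (p / M) * ?X y y' + ennreal (1 - p)) \<partial>\<nu> \<partial>\<nu>)"
    proof (intro nn_integral_mono)
      fix y y' :: 'a
      have "?c p *
        (ennreal (p / M) * ?X y y' + ennreal (1 - p))
        = ennreal (2 * (exp (p * ln M) * (p * exp (\<alpha> * (norm (y - y'))\<^sup>2) / M + (1 - p))))"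
        using p M by (simp add: ennreal_mult[symmetric] ennreal_plus[symmetric] del: ennreal_plus)
      then show "ennreal (exp (2 * (h y - h y')) + exp (2 * (h y' - h y)))
        \<le> ?c p *
        (ennreal (p / M) * ?X y y' + ennreal (1 - p))"
        using pw[of y y'] by (simp only: ennreal_leI)
    qed
    also have "\<dots> = ?c p * (ennreal (p / M) *
        (\<integral>\<^sup>+y. \<integral>\<^sup>+y'. ?X y y' \<partial>\<nu> \<partial>\<nu>) + ennreal (1 - p))"
      by (simp add: nn_integral_cmult nn_integral_add emeasure_space_1)
    also have "\<dots> \<le> ?c p * (ennreal (p / M) * ennreal M + ennreal (1 - p))"
      by (intro mult_left_mono add_right_mono moment) auto
    also have "\<dots> = ennreal (exp (p * ln M)) + ennreal (exp (p * ln M))"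
      using p M by (simp add: ennreal_mult[symmetric] ennreal_plus[symmetric] del: ennreal_plus)
    finally have "2 * ?E \<le> 2 * ennreal (exp (p * ln M))" by (simp only: mult_2)
    then have "?E \<le> ennreal (exp (p * ln M))" by (simp add: ennreal_mult_le_mult_iff)
    also have "\<dots> \<le> ?B"
    proof -
      have "p * ln M \<le> (1 + 2 * ln M) / \<alpha> * L\<^sup>2"
        using \<alpha> L by (simp add: p_def field_simps)
      then show ?thesis by (intro ennreal_leI) simp
    qed
    finally show ?thesis .
  next
    case False
    have pw: "exp (2 * (h y - h y')) \<le> exp (L\<^sup>2 / \<alpha>) * exp (\<alpha> * (norm (y - y'))\<^sup>2)" for y y'
    proof -
      have "2 * (h y - h y') \<le> 2 * L * norm (y - y')" using lip[of y y'] by simp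
      also have "\<dots> \<le> L\<^sup>2 / \<alpha> + \<alpha> * (norm (y - y'))\<^sup>2"
      proof -
        have "0 \<le> (\<alpha> * norm (y - y') - L)\<^sup>2 / \<alpha>" using \<alpha> by simp
        then show ?thesis using \<alpha> by (simp add: power2_eq_square field_simps)
      qed
      finally show ?thesis by (simp add: exp_add[symmetric])
    qed
    have "?E \<le> (\<integral>\<^sup>+y. \<integral>\<^sup>+y'. ennreal (exp (L\<^sup>2 / \<alpha>)) * ?X y y' \<partial>\<nu> \<partial>\<nu>)"
      using pw by (intro nn_integral_mono) (simp add: ennreal_mult[symmetric] ennreal_leI)
    also have "\<dots> = ennreal (exp (L\<^sup>2 / \<alpha>)) * (\<integral>\<^sup>+y. \<integral>\<^sup>+y'. ?X y y' \<partial>\<nu> \<partial>\<nu>)"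
      by (simp add: nn_integral_cmult)
    also have "\<dots> \<le> ennreal (exp (L\<^sup>2 / \<alpha>)) * ennreal M" by (intro mult_left_mono moment) auto
    also have "\<dots> = ennreal (exp (L\<^sup>2 / \<alpha> + ln M))" using M by (simp add: ennreal_mult[symmetric] exp_add)
    also have "\<dots> \<le> ?B"
    proof -
      have "ln M * \<alpha> \<le> ln M * (2 * L\<^sup>2)" using False lnM by (intro mult_left_mono) auto
      then have "L\<^sup>2 / \<alpha> + ln M \<le> (1 + 2 * ln M) / \<alpha> * L\<^sup>2"
        using \<alpha> by (simp add: field_simps)
      then show ?thesis by (intro ennreal_leI) simp
    qed
    finally show ?thesis .
  qed
qed

text \<open>The entropy of the tilt is the mean of \<open>h\<close> under it, at most the logarithm of the mean of
  \<open>exp (2 h)\<close> under \<open>\<nu>\<close>.  Since \<open>exp h\<close> has mean \<open>1\<close>, the mean of \<open>exp (- 2 h)\<close> is at least \<open>1\<close>, so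
  that the two-point quantity of the previous lemma dominates.\<close>

lemma lipschitz_tilt_entropy:
  fixes \<nu> :: "'a::euclidean_space measure"
  assumes \<nu>: "prob_space \<nu>" and s [measurable_cong]: "sets \<nu> = sets borel"
    and h [measurable]: "h \<in> borel_measurable borel"
    and lip: "\<And>y y'. \<bar>h y - h y'\<bar> \<le> L * norm (y - y')"
    and L: "L \<ge> 0" and \<alpha>: "\<alpha> > 0" and M: "M \<ge> 1"
    and moment: "(\<integral>\<^sup>+y. \<integral>\<^sup>+y'. ennreal (exp (\<alpha> * (norm (y - y'))\<^sup>2)) \<partial>\<nu> \<partial>\<nu>) \<le> ennreal M"
    and tilt: "prob_space (density \<nu> (\<lambda>y. ennreal (exp (h y))))"
  shows "rel_entropy (density \<nu> (\<lambda>y. ennreal (exp (h y)))) \<nu>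
    \<le> ereal ((1 + 2 * ln M) / \<alpha> * L\<^sup>2)"
proof -
  let ?a = "\<lambda>y. ennreal ((h y - 1 + exp (- h y)) * exp (h y))" and ?b = "\<lambda>y. ennreal (2 * exp (h y))"
  interpret prob_space \<nu> by fact
  define g where "g = (1 + 2 * ln M) / \<alpha> * L\<^sup>2"
  have g0: "g \<ge> 0" using \<alpha> M by (simp add: g_def)
  let ?I = "\<lambda>c. \<integral>\<^sup>+y. ennreal (exp (c * h y)) \<partial>\<nu>"
  have I1: "(\<integral>\<^sup>+y. ennreal (exp (h y)) \<partial>\<nu>) = 1"
    using prob_space.emeasure_space_1[OF tilt]
    by (simp add: emeasure_density cong: nn_integral_cong)
  have Im: "1 \<le> ?I (-2)"
  proof -
    \<comment> \<open>the tangent at \<open>0\<close> of each exponential\<close>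
    have pw: "3 \<le> exp (- 2 * t) + 2 * exp t" for t :: real
      using exp_ge_add_one_self[of "- 2 * t"] exp_ge_add_one_self[of t] by linarith
    have "3 = (\<integral>\<^sup>+y. ennreal 3 \<partial>\<nu>)" by (simp add: emeasure_space_1)
    also have "\<dots> \<le> (\<integral>\<^sup>+y. ennreal (exp (- 2 * h y)) + 2 * ennreal (exp (h y)) \<partial>\<nu>)"
    proof (rule nn_integral_mono)
      fix y :: 'a
      have "ennreal (exp (- 2 * h y)) + 2 * ennreal (exp (h y)) = ennreal (exp (- 2 * h y) + 2 * exp (h y))"
        by (simp add: ennreal_plus ennreal_mult)
      then show "ennreal 3 \<le> ennreal (exp (- 2 * h y)) + 2 * ennreal (exp (h y))"
        using pw[of "h y"] by (simp only: ennreal_leI)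
    qed
    also have "\<dots> = ?I (-2) + 2"
      by (subst nn_integral_add) (auto simp: nn_integral_cmult I1)
    finally have "2 + 1 \<le> 2 + ?I (-2)" by (simp add: add.commute)
    then show ?thesis by (subst (asm) ennreal_add_left_cancel_le) auto
  qed
  have "(\<integral>\<^sup>+y. \<integral>\<^sup>+y'. ennreal (exp (2 * (h y - h y'))) \<partial>\<nu> \<partial>\<nu>)
      = (\<integral>\<^sup>+y. \<integral>\<^sup>+y'. ennreal (exp (2 * h y)) * ennreal (exp (-2 * h y')) \<partial>\<nu> \<partial>\<nu>)"
    by (intro nn_integral_cong) (simp add: ennreal_mult[symmetric] exp_add[symmetric] algebra_simps)
  also have "\<dots> = ?I 2 * ?I (-2)"
    by (simp add: nn_integral_cmult nn_integral_multc)
  finally have "?I 2 * ?I (-2) \<le> ennreal (exp g)"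
    using symmetrized_exponential_bound[OF \<nu> s h lip L \<alpha> M moment] by (simp add: g_def)
  moreover have "?I 2 * 1 \<le> ?I 2 * ?I (-2)" by (intro mult_left_mono Im) auto
  ultimately have I2: "?I 2 \<le> ennreal (exp g)" by simp
  \<comment> \<open>\<open>t \<le> exp (t - g) + g - 1\<close>; the summand \<open>2 * exp t\<close> avoids subtraction in \<open>ennreal\<close>\<close>
  have pw: "(t - 1 + exp (- t)) * exp t + 2 * exp t \<le> exp (2 * t) * exp (- g) + g * exp t + 1" for t :: real
  proof -
    have "1 + (t - g) \<le> exp (t - g)" by (rule exp_ge_add_one_self)
    then have "(1 + (t - g)) * exp t \<le> exp (t - g) * exp t" by (intro mult_right_mono) auto
    also have "exp (t - g) * exp t = exp (2 * t) * exp (- g)" by (simp add: exp_add[symmetric])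
    finally show ?thesis by (simp add: algebra_simps exp_add[symmetric])
  qed
  have nonneg: "0 \<le> t - 1 + exp (- t)" for t :: real using exp_ge_add_one_self[of "- t"] by simp
  let ?H = "\<integral>\<^sup>+y. ennreal (h y - 1 + exp (- h y)) \<partial>density \<nu> (\<lambda>y. ennreal (exp (h y)))"
  have "?H + 2 = (\<integral>\<^sup>+y. ennreal ((h y - 1 + exp (- h y)) * exp (h y) + 2 * exp (h y)) \<partial>\<nu>)"
  proof -
    have "?H = (\<integral>\<^sup>+y. ?a y \<partial>\<nu>)"
      by (subst nn_integral_density) (auto simp: ennreal_mult[symmetric] nonneg mult.commute intro!: nn_integral_cong)
    moreover have "2 = (\<integral>\<^sup>+y. ?b y \<partial>\<nu>)"
      using I1 by (simp add: ennreal_mult nn_integral_cmult)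
    ultimately have "?H + 2 = (\<integral>\<^sup>+y. ?a y \<partial>\<nu>)
        + (\<integral>\<^sup>+y. ?b y \<partial>\<nu>)" by metis
    also have "\<dots> = (\<integral>\<^sup>+y. ?a y + ?b y \<partial>\<nu>)"
      by (rule nn_integral_add[symmetric]) auto
    finally show ?thesis using nonneg by (simp add: ennreal_plus)
  qed
  also have "\<dots> \<le> (\<integral>\<^sup>+y. ennreal (exp (2 * h y) * exp (- g) + g * exp (h y) + 1) \<partial>\<nu>)"
    using pw by (intro nn_integral_mono ennreal_leI) simp
  also have "\<dots> = (\<integral>\<^sup>+y. ennreal (exp (2 * h y)) * ennreal (exp (- g)) + ennreal g * ennreal (exp (h y)) + 1 \<partial>\<nu>)"
    using g0 by (intro nn_integral_cong) (simp add: ennreal_plus ennreal_mult)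
  also have "\<dots> = ?I 2 * ennreal (exp (- g)) + ennreal g + 1"
    by (simp add: nn_integral_add nn_integral_cmult nn_integral_multc I1 emeasure_space_1)
  also have "\<dots> \<le> ennreal (exp g) * ennreal (exp (- g)) + ennreal g + 1"
    by (intro add_right_mono mult_right_mono I2) auto
  also have "\<dots> = ennreal g + 2"
    by (simp add: ennreal_mult[symmetric] exp_add[symmetric] add_ac)
  finally have "2 + ?H \<le> 2 + ennreal g" by (simp add: add.commute)
  then have "?H \<le> ennreal g" by (subst (asm) ennreal_add_left_cancel_le) auto
  moreover have "rel_entropy (density \<nu> (\<lambda>y. ennreal (exp (h y)))) \<nu> = enn2ereal ?H"
    by (rule rel_entropy_exp_density(2)[OF \<nu> tilt]) measurable
  ultimately show ?thesis
    using g0 unfolding g_def[symmetric] by (simp add: less_eq_ennreal.rep_eq enn2ereal_ennreal)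
qed

text \<open>Only the convex hull of the exceptional points, an interval of length at most \<open>l\<close>, can contribute
  a decrease.\<close>

lemma derivative_increment_except_short:
  fixes D D' :: "real \<Rightarrow> real"
  assumes uv: "u \<le> v" and D: "\<And>t. (D has_real_derivative D' t) (at t)"
    and out: "\<And>t. t \<notin> S \<Longrightarrow> 0 \<le> D' t" and inside: "\<And>t. - c \<le> D' t" and c: "0 \<le> c"
    and short: "\<And>t t'. t \<in> S \<Longrightarrow> t' \<in> S \<Longrightarrow> \<bar>t - t'\<bar> \<le> l" and l: "0 \<le> l"
  shows "D u - c * l \<le> D v"
proof -
  have cont: "continuous_on A D" for A
    using D by (intro continuous_at_imp_continuous_on ballI DERIV_isCont) blast
  define B where "B = S \<inter> {u..v}"
  have mono: "D x \<le> D y" if "x \<le> y" "{x<..<y} \<inter> S = {}" for x y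
  proof (rule DERIV_nonneg_imp_increasing_open[OF that(1) _ cont])
    fix t assume "x < t" "t < y"
    then have "0 \<le> D' t" using that(2) by (intro out) auto
    then show "\<exists>d. (D has_real_derivative d) (at t) \<and> 0 \<le> d" using D by blast
  qed
  have cl: "0 \<le> c * l" using c l by simp
  show ?thesis
  proof (cases "B = {}")
    case True
    then have "D u \<le> D v" using uv by (intro mono) (auto simp: B_def)
    then show ?thesis using cl by simp
  next
    case False
    have bdd: "bdd_below B" "bdd_above B" by (auto simp: B_def)
    obtain t0 where t0: "t0 \<in> B" using False by blast
    define p q where "p = Inf B" and "q = Sup B"
    have p: "u \<le> p" "p \<le> t0" and q: "t0 \<le> q" "q \<le> v"
      unfolding p_def q_def using t0 bdd False
      by (auto intro!: cInf_greatest cInf_lower cSup_least cSup_upper simp: B_def)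
    have up: "D u \<le> D p"
    proof (rule mono[OF p(1)])
      show "{u<..<p} \<inter> S = {}"
      proof (rule ccontr)
        assume "{u<..<p} \<inter> S \<noteq> {}"
        then obtain t where t: "u < t" "t < p" "t \<in> S" by auto
        then have "t \<in> B" using p q by (auto simp: B_def)
        then show False using cInf_lower[OF _ bdd(1)] t(2) by (force simp: p_def)
      qed
    qed
    have qv: "D q \<le> D v"
    proof (rule mono[OF q(2)])
      show "{q<..<v} \<inter> S = {}"
      proof (rule ccontr)
        assume "{q<..<v} \<inter> S \<noteq> {}"
        then obtain t where t: "q < t" "t < v" "t \<in> S" by auto
        then have "t \<in> B" using p q by (auto simp: B_def)
        then show False using cSup_upper[OF _ bdd(2)] t(1) by (force simp: q_def)
      qed
    qed
    have "q \<le> p + l"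
    proof -
      have "t \<le> p + l" if "t \<in> B" for t
      proof -
        have "t - l \<le> p" unfolding p_def
        proof (rule cInf_greatest[OF False])
          fix t' assume "t' \<in> B"
          then show "t - l \<le> t'" using short[of t t'] \<open>t \<in> B\<close> by (auto simp: B_def)
        qed
        then show ?thesis by simp
      qed
      then show ?thesis unfolding q_def by (intro cSup_least[OF False])
    qed
    then have "c * (q - p) \<le> c * l" using c by (intro mult_left_mono) auto
    moreover have "D p + c * p \<le> D q + c * q"
    proof (rule DERIV_nonneg_imp_nondecreasing[of p q "\<lambda>t. D t + c * t"])
      show "p \<le> q" using p q by simp
      fix t
      have "((\<lambda>t. D t + c * t) has_real_derivative D' t + c) (at t)"
        by (auto intro!: derivative_eq_intros D)
      then show "\<exists>y. ((\<lambda>t. D t + c * t) has_real_derivative y) (at t) \<and> 0 \<le> y"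
        using inside[of t] by (intro exI[of _ "D' t + c"]) simp
    qed
    ultimately show ?thesis using up qv by (simp add: algebra_simps)
  qed
qed

text \<open>Along the line through \<open>s\<close> in direction \<open>r\<close> the function \<open>f (s + t r) + f (s - t r)\<close> is even in
  \<open>t\<close>, so its derivative is an integral of the second derivative over the symmetric interval.  The
  ball is met in a set of diameter at most \<open>2 \<delta> / |r|\<close>, which costs at most \<open>2 (a + b) \<delta> |r|\<close>,
  whatever the position of \<open>s\<close>.\<close>

lemma two_point_growth:
  fixes f :: "'a::euclidean_space \<Rightarrow> real"
  assumes a: "a > 0" and b: "b \<ge> 0" and \<delta>: "\<delta> \<ge> 0"
    and f': "\<And>t. ((\<lambda>t. f (s + t *\<^sub>R r)) has_real_derivative f' t) (at t)"
    and f'': "\<And>t. (f' has_real_derivative f'' t) (at t)"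
    and out: "\<And>t. \<delta> \<le> norm (s + t *\<^sub>R r) \<Longrightarrow> a * (norm r)\<^sup>2 \<le> f'' t"
    and inside: "\<And>t. - b * (norm r)\<^sup>2 \<le> f'' t"
  shows "f (s + r) + f (s - r) + 3 * a * (norm r)\<^sup>2 - 2 * ((a + b) * \<delta>) * norm r
    \<le> f (s + 2 *\<^sub>R r) + f (s - 2 *\<^sub>R r)"
proof (cases "r = 0")
  case False
  define n where "n = norm r"
  have n: "n > 0" using False by (simp add: n_def)
  define \<phi> where "\<phi> t = f (s + t *\<^sub>R r)" for t
  have \<phi>: "(\<phi> has_real_derivative f' t) (at t)" for t using f' by (simp add: \<phi>_def[abs_def])
  define c where "c = (a + b) * n\<^sup>2"
  have c: "0 \<le> c" using a b by (simp add: c_def)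
  \<comment> \<open>says that the derivative of \<open>G\<close> below is nonnegative for positive \<open>t\<close>\<close>
  have key: "2 * a * n\<^sup>2 * t - 2 * (a + b) * \<delta> * n \<le> f' t - f' (- t)" if t: "t \<ge> 0" for t
  proof -
    have "(f' (- t) - a * n\<^sup>2 * (- t)) - c * (2 * \<delta> / n) \<le> f' t - a * n\<^sup>2 * t"
    proof (rule derivative_increment_except_short[where D = "\<lambda>t. f' t - a * n\<^sup>2 * t"
          and D' = "\<lambda>t. f'' t - a * n\<^sup>2" and S = "{t. norm (s + t *\<^sub>R r) < \<delta>}"])
      show "- t \<le> t" using t by simp
      show "((\<lambda>t. f' t - a * n\<^sup>2 * t) has_real_derivative f'' t - a * n\<^sup>2) (at t)" for t
        by (auto intro!: derivative_eq_intros f'')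
      show "0 \<le> f'' t - a * n\<^sup>2" if "t \<notin> {t. norm (s + t *\<^sub>R r) < \<delta>}" for t
        using out[of t] that by (simp add: n_def)
      show "- c \<le> f'' t - a * n\<^sup>2" for t
        using inside[of t] by (simp add: c_def n_def algebra_simps)
      show "0 \<le> c" by (rule c)
      show "0 \<le> 2 * \<delta> / n" using \<delta> n by simp
      fix t t' assume tt: "t \<in> {t. norm (s + t *\<^sub>R r) < \<delta>}" "t' \<in> {t. norm (s + t *\<^sub>R r) < \<delta>}"
      have "\<bar>t - t'\<bar> * n = norm ((s + t *\<^sub>R r) - (s + t' *\<^sub>R r))"
        by (simp add: n_def scaleR_diff_left[symmetric])
      also have "\<dots> \<le> norm (s + t *\<^sub>R r) + norm (s + t' *\<^sub>R r)" by (rule norm_triangle_ineq4)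
      also have "\<dots> \<le> 2 * \<delta>" using tt by simp
      finally show "\<bar>t - t'\<bar> \<le> 2 * \<delta> / n" using n by (simp add: field_simps)
    qed
    moreover have "c * (2 * \<delta> / n) = 2 * (a + b) * \<delta> * n"
      using n by (simp add: c_def power2_eq_square)
    ultimately show ?thesis by (simp add: algebra_simps)
  qed
  define G where "G t = \<phi> t + \<phi> (- t) - a * n\<^sup>2 * t\<^sup>2 + 2 * (a + b) * \<delta> * n * t" for t
  have "G 1 \<le> G 2"
  proof (rule DERIV_nonneg_imp_nondecreasing[of 1 2 G])
    fix t :: real assume t: "1 \<le> t"
    have "((\<lambda>t. \<phi> (- t)) has_real_derivative f' (- t) * (- 1)) (at t)"
      by (rule DERIV_chain2[OF \<phi>]) (auto intro!: derivative_eq_intros)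
    then have "(G has_real_derivative f' t + f' (- t) * (- 1) - a * n\<^sup>2 * (2 * t) + 2 * (a + b) * \<delta> * n) (at t)"
      unfolding G_def by (auto intro!: derivative_eq_intros \<phi>)
    then show "\<exists>y. (G has_real_derivative y) (at t) \<and> 0 \<le> y"
      using key[of t] t by (intro exI conjI) (assumption, simp add: algebra_simps)
  qed simp
  then show ?thesis by (simp add: G_def \<phi>_def n_def[symmetric] algebra_simps)
qed simp

section \<open>Second-order calculus and convexity\<close>

lemma smooth_iterated_dderiv:
  assumes "smooth f" shows "smooth (iterated_dderiv vs f)"
proof -
  have "iterated_dderiv us (iterated_dderiv vs f) = iterated_dderiv (us @ vs) f" for us
    by (induction us) simp_all
  then show ?thesis using assms by (simp add: smooth_def)
qed

lemma smooth_differentiable: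
  assumes "smooth f" shows "f differentiable (at x)"
  using assms[unfolded smooth_def, rule_format, of "[]" x] by simp

lemma gradient_eq:
  fixes f :: "'a::euclidean_space \<Rightarrow> real"
  assumes "f differentiable (at x)"
  shows "gradient f x = (\<Sum>i\<in>Basis. frechet_derivative f (at x) i *\<^sub>R i)"
    and "(f has_derivative (\<lambda>h. h \<bullet> gradient f x)) (at x)"
proof -
  let ?g = "\<Sum>i\<in>Basis. frechet_derivative f (at x) i *\<^sub>R i"
  let ?F = "frechet_derivative f (at x)"
  have F: "(f has_derivative ?F) (at x)" using assms frechet_derivative_works by blast
  then have lin: "linear ?F" by (rule has_derivative_linear)
  have "?F h = h \<bullet> ?g" for h
  proof -
    have "?F h = (\<Sum>i\<in>Basis. (h \<bullet> i) *\<^sub>R ?F i)"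
      using Linear_Algebra.linear_componentwise[OF lin, of h 1] by simp
    then show ?thesis by (simp add: inner_sum_right mult.commute)
  qed
  then have "?F = (\<lambda>h. h \<bullet> ?g)" by (rule ext)
  define G where "G = ?g"
  have "?F = (\<lambda>h. h \<bullet> G)" unfolding G_def by fact
  with F have g: "GDERIV f x :> G" unfolding gderiv_def by (rule has_derivative_eq_rhs)
  have uniq: "D = G" if "GDERIV f x :> D" for D
  proof -
    have "(\<lambda>h. h \<bullet> D) = (\<lambda>h. h \<bullet> G)"
      using that g unfolding gderiv_def by (rule has_derivative_unique)
    then have "h \<bullet> D = h \<bullet> G" for h by (rule fun_cong)
    then have "(D - G) \<bullet> (D - G) = 0" by (simp add: inner_diff_right)
    then show ?thesis by simp
  qed
  have "gradient f x = G" unfolding gradient_def using g uniq by (rule the_equality)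
  then show "gradient f x = ?g" and "(f has_derivative (\<lambda>h. h \<bullet> gradient f x)) (at x)"
    using g unfolding gderiv_def by (simp_all only: G_def)
qed

lemma gradient_differentiable:
  assumes f: "smooth f"
  shows "gradient f differentiable (at x)"
proof -
  have "gradient f = (\<lambda>x. \<Sum>i\<in>Basis. iterated_dderiv [i] f x *\<^sub>R i)"
    using gradient_eq(1)[OF smooth_differentiable[OF f]] by (simp add: fun_eq_iff)
  moreover have "(\<lambda>x. \<Sum>i\<in>Basis. iterated_dderiv [i] f x *\<^sub>R i) differentiable (at x)"
    by (intro differentiable_sum ballI differentiable_scaleR differentiable_const finite_Basis
        smooth_differentiable[OF smooth_iterated_dderiv[OF f]])
  ultimately show ?thesis by simp
qed

lemma line_derivatives:
  fixes f :: "real^'d \<Rightarrow> real"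
  assumes f: "smooth f"
  shows "((\<lambda>t. f (s + t *\<^sub>R r)) has_real_derivative r \<bullet> gradient f (s + t *\<^sub>R r)) (at t)"
    and "((\<lambda>t. r \<bullet> gradient f (s + t *\<^sub>R r)) has_real_derivative
          r \<bullet> (hessian f (s + t *\<^sub>R r) *v r)) (at t)"
proof -
  have l: "((\<lambda>t. s + t *\<^sub>R r) has_derivative (\<lambda>h. h *\<^sub>R r)) (at t)" for t
    by (auto intro!: derivative_eq_intros)
  have "((\<lambda>t. f (s + t *\<^sub>R r)) has_derivative (\<lambda>h. (h *\<^sub>R r) \<bullet> gradient f (s + t *\<^sub>R r))) (at t)"
    by (rule has_derivative_compose[OF l gradient_eq(2)[OF smooth_differentiable[OF f]]])
  then show "((\<lambda>t. f (s + t *\<^sub>R r)) has_real_derivative r \<bullet> gradient f (s + t *\<^sub>R r)) (at t)"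
    unfolding has_field_derivative_def by (rule has_derivative_eq_rhs) (simp add: fun_eq_iff)
  have "(gradient f has_derivative (\<lambda>h. hessian f (s + t *\<^sub>R r) *v h)) (at (s + t *\<^sub>R r))"
    using gradient_differentiable[OF f] unfolding hessian_def by (simp add: jacobian_works)
  then have "((\<lambda>t. gradient f (s + t *\<^sub>R r)) has_derivative (\<lambda>h. hessian f (s + t *\<^sub>R r) *v (h *\<^sub>R r))) (at t)"
    by (rule has_derivative_compose[OF l])
  then have "((\<lambda>t. r \<bullet> gradient f (s + t *\<^sub>R r)) has_derivative
      (\<lambda>h. r \<bullet> (hessian f (s + t *\<^sub>R r) *v (h *\<^sub>R r)))) (at t)"
    by (rule has_derivative_inner_right)
  then show "((\<lambda>t. r \<bullet> gradient f (s + t *\<^sub>R r)) has_real_derivative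
      r \<bullet> (hessian f (s + t *\<^sub>R r) *v r)) (at t)"
    unfolding has_field_derivative_def
    by (rule has_derivative_eq_rhs) (simp add: fun_eq_iff matrix_vector_mult_scaleR)
qed

text \<open>Iterated derivatives of a slice are iterated derivatives of the whole function in the directions
  \<open>(0, v)\<close>.\<close>

lemma smooth_slice:
  fixes F :: "'a::euclidean_space \<Rightarrow> 'b::euclidean_space \<Rightarrow> real"
  assumes F: "smooth (\<lambda>p. F (fst p) (snd p))"
  shows "smooth (F x)"
proof -
  let ?F = "\<lambda>p. F (fst p) (snd p)"
  have diff: "(\<lambda>y. iterated_dderiv us ?F (x, y)) differentiable (at y)
    \<and> frechet_derivative (\<lambda>y. iterated_dderiv us ?F (x, y)) (at y) v
      = frechet_derivative (iterated_dderiv us ?F) (at (x, y)) (0, v)" for us y v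
  proof -
    have p: "((\<lambda>y. (x, y)) has_derivative (\<lambda>h. (0, h))) (at y)"
      by (auto intro!: derivative_eq_intros)
    have "(iterated_dderiv us ?F has_derivative frechet_derivative (iterated_dderiv us ?F) (at (x, y))) (at (x, y))"
      using smooth_differentiable[OF smooth_iterated_dderiv[OF F]] frechet_derivative_works by blast
    then have d: "((\<lambda>y. iterated_dderiv us ?F (x, y)) has_derivative
        (\<lambda>h. frechet_derivative (iterated_dderiv us ?F) (at (x, y)) (0, h))) (at y)"
      by (rule has_derivative_compose[OF p])
    show ?thesis
      using differentiableI[OF d] fun_cong[OF frechet_derivative_at[OF d, symmetric], of v] by (rule conjI)
  qed
  have eq: "iterated_dderiv vs (F x) = (\<lambda>y. iterated_dderiv (map (Pair 0) vs) ?F (x, y))" for vs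
  proof (induction vs)
    case (Cons v vs)
    then show ?case using conjunct2[OF diff] by simp
  qed simp
  have "iterated_dderiv vs (F x) differentiable (at y)" for vs y
    unfolding eq by (rule conjunct1[OF diff])
  then show ?thesis unfolding smooth_def by (intro allI)
qed

lemma convex_on_hessian:
  fixes u :: "real^'d \<Rightarrow> real"
  assumes u': "\<And>s r t. ((\<lambda>t. u (s + t *\<^sub>R r)) has_real_derivative u' s r t) (at t)"
    and u'': "\<And>s r t. (u' s r has_real_derivative u'' s r t) (at t)"
    and nonneg: "\<And>s r t. 0 \<le> u'' s r t"
  shows "convex_on UNIV u"
proof
  fix t :: real and x y :: "real^'d" assume t: "0 < t" "t < 1"
  have "convex_on UNIV (\<lambda>t. u (x + t *\<^sub>R (y - x)))"
    using u' u'' nonneg by (intro f''_ge0_imp_convex[of UNIV _ "u' x (y - x)" "u'' x (y - x)"]) auto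
  from convex_onD[OF this, of t 0 1] t
  have "u (x + t *\<^sub>R (y - x)) \<le> (1 - t) * u x + t * u y" by simp
  moreover have "x + t *\<^sub>R (y - x) = (1 - t) *\<^sub>R x + t *\<^sub>R y" by (simp add: algebra_simps)
  ultimately show "u ((1 - t) *\<^sub>R x + t *\<^sub>R y) \<le> (1 - t) * u x + t * u y" by simp
qed simp

text \<open>Hoelder's inequality for exponentials, in normalised form: after division by the values at the two
  end points it is the convexity of the exponential function under the integral.\<close>

lemma convex_on_log_integral_exp:
  fixes \<psi> :: "'b \<Rightarrow> 'a::real_vector \<Rightarrow> real"
  assumes m: "\<And>y. (\<lambda>x. \<psi> x y) \<in> borel_measurable M"
    and cvx: "\<And>x. convex_on UNIV (\<psi> x)"
    and L: "\<And>y. (\<integral>\<^sup>+x. ennreal (exp (\<psi> x y)) \<partial>M) = ennreal (exp (L y))"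
  shows "convex_on UNIV L"
proof
  fix t :: real and a b :: 'a assume t: "0 < t" "t < 1"
  note [measurable] = m
  let ?A = "\<lambda>x. ennreal ((1 - t) * exp (- L a)) * ennreal (exp (\<psi> x a))"
  let ?B = "\<lambda>x. ennreal (t * exp (- L b)) * ennreal (exp (\<psi> x b))"
  define c where "c = (1 - t) * L a + t * L b"
  let ?z = "(1 - t) *\<^sub>R a + t *\<^sub>R b"
  have pw: "exp (\<psi> x ?z) \<le> exp c * ((1 - t) * exp (- L a) * exp (\<psi> x a) + t * exp (- L b) * exp (\<psi> x b))" for x
  proof -
    have "\<psi> x ?z \<le> (1 - t) * \<psi> x a + t * \<psi> x b" using convex_onD[OF cvx] t by simp
    also have "\<dots> = c + ((1 - t) * (\<psi> x a - L a) + t * (\<psi> x b - L b))" by (simp add: c_def algebra_simps)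
    finally have "exp (\<psi> x ?z) \<le> exp c * exp ((1 - t) * (\<psi> x a - L a) + t * (\<psi> x b - L b))"
      by (simp add: exp_add[symmetric])
    also have "exp ((1 - t) * (\<psi> x a - L a) + t * (\<psi> x b - L b))
        \<le> (1 - t) * exp (\<psi> x a - L a) + t * exp (\<psi> x b - L b)"
      using convex_onD[OF exp_convex, of t "\<psi> x a - L a" "\<psi> x b - L b"] t by simp
    also have "\<dots> = (1 - t) * exp (- L a) * exp (\<psi> x a) + t * exp (- L b) * exp (\<psi> x b)"
      by (simp add: exp_add[symmetric] mult.assoc)
    finally show ?thesis by simp
  qed
  have "ennreal (exp (L ?z)) = (\<integral>\<^sup>+x. ennreal (exp (\<psi> x ?z)) \<partial>M)" by (simp add: L)
  also have "\<dots> \<le> (\<integral>\<^sup>+x. ennreal (exp c) * (?A x + ?B x) \<partial>M)"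
  proof (rule nn_integral_mono)
    fix x
    have "ennreal (exp c) * (?A x + ?B x)
      = ennreal (exp c * ((1 - t) * exp (- L a) * exp (\<psi> x a) + t * exp (- L b) * exp (\<psi> x b)))"
      using t by (simp add: ennreal_mult[symmetric] ennreal_plus[symmetric] del: ennreal_plus)
    then show "ennreal (exp (\<psi> x ?z)) \<le> ennreal (exp c) * (?A x + ?B x)"
      using pw[of x] by (simp only: ennreal_leI)
  qed
  also have "\<dots> = ennreal (exp c) * (ennreal ((1 - t) * exp (- L a)) * ennreal (exp (L a))
      + ennreal (t * exp (- L b)) * ennreal (exp (L b)))"
    by (simp add: nn_integral_cmult nn_integral_add L)
  also have "\<dots> = ennreal (exp c)"
  proof -
    have "ennreal ((1 - t) * exp (- L a)) * ennreal (exp (L a)) = ennreal (1 - t)"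
      "ennreal (t * exp (- L b)) * ennreal (exp (L b)) = ennreal t"
      using t by (simp_all add: ennreal_mult[symmetric] mult.assoc exp_add[symmetric])
    then show ?thesis using t by (simp add: ennreal_plus[symmetric] del: ennreal_plus)
  qed
  finally show "L ?z \<le> (1 - t) * L a + t * L b" by (simp add: c_def)
qed simp

lemma convex_on_two_point:
  fixes L :: "'a::real_vector \<Rightarrow> real"
  assumes "convex_on UNIV L"
  shows "L (s + r) + L (s - r) \<le> L (s + 2 *\<^sub>R r) + L (s - 2 *\<^sub>R r)"
proof -
  have half: "(3 / 2) *\<^sub>R r = r + (1 / 2) *\<^sub>R r"
    using scaleR_left_distrib[of 1 "1 / 2" r] by simp
  have "s + r = (1 - 1/4) *\<^sub>R (s + 2 *\<^sub>R r) + (1/4) *\<^sub>R (s - 2 *\<^sub>R r)"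
    "s - r = (1 - 3/4) *\<^sub>R (s + 2 *\<^sub>R r) + (3/4) *\<^sub>R (s - 2 *\<^sub>R r)"
    by (simp_all add: algebra_simps scaleR_add_left[symmetric] half del: scaleR_add_left)
  then have "L (s + r) \<le> (1 - 1/4) * L (s + 2 *\<^sub>R r) + 1/4 * L (s - 2 *\<^sub>R r)"
    "L (s - r) \<le> (1 - 3/4) * L (s + 2 *\<^sub>R r) + 3/4 * L (s - 2 *\<^sub>R r)"
    using convex_onD[OF assms, of "1/4" "s + 2 *\<^sub>R r" "s - 2 *\<^sub>R r"]
      convex_onD[OF assms, of "3/4" "s + 2 *\<^sub>R r" "s - 2 *\<^sub>R r"] by simp_all
  then show ?thesis by argo
qed

section \<open>Quadratic forms\<close>

lemma symmetric_inner:
  fixes A :: "real^'d^'d"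
  assumes "transpose A = A" shows "x \<bullet> (A *v y) = (A *v x) \<bullet> y"
  using assms by (metis dot_lmul_matrix transpose_matrix_vector)

lemma pos_def_inverse:
  fixes A :: "real^'d^'d"
  assumes A: "pos_def A"
  shows "A *v (matrix_inv A *v x) = x"
    and "x \<bullet> (matrix_inv A *v y) = (matrix_inv A *v x) \<bullet> y"
proof -
  have "x = 0" if "A *v x = 0" for x
    using A that unfolding pos_def_def by (metis inner_zero_right less_irrefl)
  then have "\<exists>B. B ** A = mat 1" by (simp add: matrix_left_invertible_ker)
  then have "invertible A" by (simp add: invertible_left_inverse)
  then have inv: "A ** matrix_inv A = mat 1"
    unfolding invertible_def matrix_inv_def by (rule someI2_ex) simp
  show 1: "A *v (matrix_inv A *v x) = x" for x
    by (simp add: matrix_vector_mul_assoc inv)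
  have "x \<bullet> (matrix_inv A *v y) = (A *v (matrix_inv A *v x)) \<bullet> (matrix_inv A *v y)" by (simp add: 1)
  also have "\<dots> = (matrix_inv A *v x) \<bullet> (A *v (matrix_inv A *v y))"
    using A by (simp add: symmetric_inner pos_def_def)
  finally show "x \<bullet> (matrix_inv A *v y) = (matrix_inv A *v x) \<bullet> y" by (simp add: 1)
qed

lemma pos_def_add: "pos_def A \<Longrightarrow> pos_def B \<Longrightarrow> pos_def (A + B)"
proof -
  assume "pos_def A" "pos_def B"
  moreover have "transpose (A + B) = transpose A + transpose B"
    by (simp add: transpose_def vec_eq_iff)
  ultimately show ?thesis
    by (auto simp: pos_def_def matrix_vector_mult_add_rdistrib inner_add_right intro!: add_pos_pos)
qed

text \<open>The quadratic form of the inverse of \<open>A\<close> at \<open>x\<close> is the supremum of \<open>2 z \<bullet> x - z \<bullet> A z\<close>; insert the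
  maximiser \<open>z\<close> for \<open>B\<close>.\<close>

lemma matrix_inv_antimono_strict:
  fixes A B :: "real^'d^'d"
  assumes A: "pos_def A" and AB: "loewner_less A B" and x: "x \<noteq> 0"
  shows "x \<bullet> (matrix_inv B *v x) < x \<bullet> (matrix_inv A *v x)"
proof -
  have D: "pos_def (B - A)" using AB by (simp add: loewner_less_def)
  have B: "pos_def B" using pos_def_add[OF A D] by simp
  define z where "z = matrix_inv B *v x"
  define y where "y = matrix_inv A *v x"
  have Bz: "B *v z = x" and Ay: "A *v y = x"
    using pos_def_inverse(1)[OF B] pos_def_inverse(1)[OF A] by (simp_all add: z_def y_def)
  have z: "z \<noteq> 0" using Bz x by auto
  have sA: "transpose A = A" using A by (simp add: pos_def_def)
  have "0 \<le> (y - z) \<bullet> (A *v (y - z))"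
    using A by (cases "y - z = 0") (auto simp: pos_def_def less_imp_le)
  also have "\<dots> = y \<bullet> x - 2 * (z \<bullet> x) + z \<bullet> (A *v z)"
    using symmetric_inner[OF sA, of y z]
    by (simp add: matrix_vector_mult_diff_distrib Ay algebra_simps inner_diff_left inner_diff_right inner_commute)
  finally have 1: "2 * (z \<bullet> x) - z \<bullet> (A *v z) \<le> y \<bullet> x" by simp
  have "0 < z \<bullet> ((B - A) *v z)" using D z by (simp add: pos_def_def)
  also have "\<dots> = z \<bullet> x - z \<bullet> (A *v z)"
    by (simp add: matrix_vector_mult_diff_rdistrib inner_diff_right Bz)
  finally show ?thesis using 1 by (simp add: z_def y_def inner_commute)
qed

text \<open>Compactness of the unit sphere.\<close>

lemma quadratic_form_coercive:
  fixes G :: "real^'d^'d"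
  assumes pos: "\<And>x. x \<noteq> 0 \<Longrightarrow> 0 < x \<bullet> (G *v x)"
  obtains a where "a > 0" "\<And>x. a * (norm x)\<^sup>2 \<le> x \<bullet> (G *v x)"
proof -
  let ?S = "sphere (0 :: real^'d) 1"
  have ne: "?S \<noteq> {}" by simp
  have "continuous_on ?S (\<lambda>x. x \<bullet> (G *v x))"
    by (intro continuous_intros linear_continuous_on matrix_vector_mul_bounded_linear)
  then obtain x0 where x0: "x0 \<in> ?S" "\<And>x. x \<in> ?S \<Longrightarrow> x0 \<bullet> (G *v x0) \<le> x \<bullet> (G *v x)"
    using continuous_attains_inf[OF compact_sphere ne] by blast
  have "x0 \<bullet> (G *v x0) * (norm x)\<^sup>2 \<le> x \<bullet> (G *v x)" for x
  proof (cases "x = 0")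
    case False
    define y where "y = inverse (norm x) *\<^sub>R x"
    have "y \<in> ?S" using False by (simp add: y_def)
    then have "x0 \<bullet> (G *v x0) * (norm x)\<^sup>2 \<le> (y \<bullet> (G *v y)) * (norm x)\<^sup>2"
      by (intro mult_right_mono x0) auto
    also have "\<dots> = x \<bullet> (G *v x) * (inverse (norm x) * norm x)\<^sup>2"
      by (simp add: y_def matrix_vector_mult_scaleR power2_eq_square)
    also have "inverse (norm x) * norm x = 1" using False by simp
    finally show ?thesis by simp
  qed simp
  moreover have "0 < x0 \<bullet> (G *v x0)" using x0(1) by (intro pos) auto
  ultimately show ?thesis using that by blast
qed

lemma quadratic_form_bounded:
  fixes G :: "real^'d^'d"
  shows "x \<bullet> (G *v x) \<le> spectral_norm G * (norm x)\<^sup>2"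
proof -
  have "x \<bullet> (G *v x) \<le> norm x * norm (G *v x)" by (rule norm_cauchy_schwarz)
  also have "\<dots> \<le> norm x * (spectral_norm G * norm x)"
    unfolding spectral_norm_def by (intro mult_left_mono onorm) auto
  finally show ?thesis by (simp add: power2_eq_square algebra_simps)
qed

lemma spectral_norm_nonneg: "0 \<le> spectral_norm (G :: real^'d^'d)"
  unfolding spectral_norm_def by (rule onorm_pos_le) simp

lemma spectral_norm_pos:
  fixes A :: "real^'d^'d"
  assumes "pos_def A" shows "0 < spectral_norm A"
proof -
  have "axis undefined 1 \<noteq> (0 :: real^'d)" by (simp add: axis_eq_0_iff)
  then have "A *v axis undefined 1 \<noteq> 0"
    using assms unfolding pos_def_def by (metis inner_zero_right less_irrefl)
  then show ?thesis unfolding spectral_norm_def by (subst onorm_pos_lt) auto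
qed

section \<open>Even Sinkhorn transitions under curvature conditions\<close>

text \<open>Transfers the quadratic form of \<open>H\<close> from \<open>V\<close> to \<open>L\<close>: the remainder of \<open>V\<close> satisfies the
  hypotheses of \<open>two_point_growth\<close>, and the convex part of the potential only helps.\<close>

lemma two_point_growth_hessian:
  fixes V :: "real^'d \<Rightarrow> real" and H A B :: "real^'d^'d"
  assumes V: "smooth V" and a: "a > 0" and b: "b \<ge> 0" and \<delta>: "\<delta> \<ge> 0"
    and hess: "\<And>y. loewner_le (indicat_real {z. norm z \<ge> \<delta>} y *\<^sub>R A
        - indicat_real {z. norm z < \<delta>} y *\<^sub>R B) (hessian V y)"
    and H: "\<And>x y. x \<bullet> (H *v y) = (H *v x) \<bullet> y"
    and A: "\<And>r. a * (norm r)\<^sup>2 \<le> r \<bullet> (A *v r) - r \<bullet> (H *v r)"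
    and B: "\<And>r. r \<bullet> (B *v r) + r \<bullet> (H *v r) \<le> b * (norm r)\<^sup>2"
    and L: "convex_on UNIV (\<lambda>y. L y + y \<bullet> (H *v y) / 2)"
    and w: "\<And>y. w y = V y + L y"
  shows "w (s + r) + w (s - r) + 3 * a * (norm r)\<^sup>2 - 2 * ((a + b) * \<delta>) * norm r
    \<le> w (s + 2 *\<^sub>R r) + w (s - 2 *\<^sub>R r)"
proof -
  let ?Q = "\<lambda>y. y \<bullet> (H *v y) / 2"
  let ?p = "\<lambda>t. s + t *\<^sub>R r"
  note d = line_derivatives[OF V, where s = s and r = r]
  have Q: "((\<lambda>t. ?Q (?p t)) has_real_derivative r \<bullet> (H *v ?p t)) (at t)" for t
  proof -
    have e: "?Q (?p t) = ?Q s + t * (r \<bullet> (H *v s)) + t\<^sup>2 * (r \<bullet> (H *v r)) / 2" for t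
      using H[of s r] by (simp add: matrix_vector_right_distrib matrix_vector_mult_scaleR
          inner_add_left inner_add_right power2_eq_square algebra_simps inner_commute)
    have e': "r \<bullet> (H *v ?p t) = r \<bullet> (H *v s) + t * (r \<bullet> (H *v r))"
      by (simp add: matrix_vector_right_distrib matrix_vector_mult_scaleR inner_add_right)
    show ?thesis unfolding e e' by (auto intro!: derivative_eq_intros)
  qed
  have Q': "((\<lambda>t. r \<bullet> (H *v ?p t)) has_real_derivative r \<bullet> (H *v r)) (at t)" for t
  proof -
    have "r \<bullet> (H *v ?p t) = r \<bullet> (H *v s) + t * (r \<bullet> (H *v r))" for t
      by (simp add: matrix_vector_right_distrib matrix_vector_mult_scaleR inner_add_right)
    then show ?thesis by (auto intro!: derivative_eq_intros)
  qed
  have hq: "indicat_real {z. norm z \<ge> \<delta>} y * (r \<bullet> (A *v r)) - indicat_real {z. norm z < \<delta>} y * (r \<bullet> (B *v r))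
      \<le> r \<bullet> (hessian V y *v r)" for y
    using hess[of y] unfolding loewner_le_def pos_semidef_def
    by (simp add: matrix_vector_mult_diff_rdistrib inner_diff_right scaleR_matrix_vector_assoc[symmetric])
  have out: "a * (norm r)\<^sup>2 \<le> r \<bullet> (hessian V y *v r) - r \<bullet> (H *v r)" if "\<delta> \<le> norm y" for y
    using hq[of y] A[of r] that by (simp add: indicator_def)
  have "(V (s + r) - ?Q (s + r)) + (V (s - r) - ?Q (s - r)) + 3 * a * (norm r)\<^sup>2 - 2 * ((a + b) * \<delta>) * norm r
    \<le> (V (s + 2 *\<^sub>R r) - ?Q (s + 2 *\<^sub>R r)) + (V (s - 2 *\<^sub>R r) - ?Q (s - 2 *\<^sub>R r))"
  proof (rule two_point_growth[OF a b \<delta>, where f = "\<lambda>y. V y - ?Q y"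
        and f' = "\<lambda>t. r \<bullet> gradient V (?p t) - r \<bullet> (H *v ?p t)"
        and f'' = "\<lambda>t. r \<bullet> (hessian V (?p t) *v r) - r \<bullet> (H *v r)"])
    show "((\<lambda>t. V (?p t) - ?Q (?p t)) has_real_derivative
        r \<bullet> gradient V (?p t) - r \<bullet> (H *v ?p t)) (at t)" for t
      by (rule DERIV_diff[OF d(1) Q])
    show "((\<lambda>t. r \<bullet> gradient V (?p t) - r \<bullet> (H *v ?p t)) has_real_derivative
        r \<bullet> (hessian V (?p t) *v r) - r \<bullet> (H *v r)) (at t)" for t
      using DERIV_diff[OF d(2)[of t] Q'[of t]] .
    show "a * (norm r)\<^sup>2 \<le> r \<bullet> (hessian V (?p t) *v r) - r \<bullet> (H *v r)"
      if "\<delta> \<le> norm (?p t)" for t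
      using out[OF that] .
    show "- b * (norm r)\<^sup>2 \<le> r \<bullet> (hessian V (?p t) *v r) - r \<bullet> (H *v r)" for t
    proof (cases "\<delta> \<le> norm (?p t)")
      case True
      have "- b * (norm r)\<^sup>2 \<le> 0" "0 \<le> a * (norm r)\<^sup>2" using a b by simp_all
      then show ?thesis using out[OF True] by linarith
    next
      case False
      then show ?thesis using hq[of "?p t"] B[of r]
        by (simp add: indicator_def)
    qed
  qed
  moreover note convex_on_two_point[OF L, of s r]
  ultimately show ?thesis unfolding w by argo
qed

lemma tilted_transition_entropy:
  fixes w :: "real^'d \<Rightarrow> real^'d \<Rightarrow> real"
  assumes w: "continuous_on UNIV (\<lambda>z. w (fst z) (snd z))"
    and K: "markov_transition (gibbs_transition w)"
    and a: "a > 0"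
    and growth: "\<And>x s r. w x (s + r) + w x (s - r) + 3 * a * (norm r)\<^sup>2 - 2 * D * norm r
      \<le> w x (s + 2 *\<^sub>R r) + w x (s - 2 *\<^sub>R r)"
    and lip: "\<And>x1 x2 y y'. \<bar>(w x2 y - w x1 y) - (w x2 y' - w x1 y')\<bar> \<le> \<kappa> * norm (x1 - x2) * norm (y - y')"
    and \<kappa>: "\<kappa> > 0"
  shows "rel_entropy (gibbs_transition w x1) (gibbs_transition w x2)
    \<le> ereal ((1 + 2 * ln (2 ^ CARD('d) * exp (D\<^sup>2 / a))) / (a / 8) * (\<kappa> * norm (x1 - x2))\<^sup>2)"
proof -
  note K' = markov_transition_kernel[OF K]
  have wm: "w x \<in> borel_measurable borel" for x
    using continuous_on_compose2[OF w, of UNIV "\<lambda>y. (x, y)"]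
    by (intro borel_measurable_continuous_onI) (simp add: continuous_on_Pair)
  note [measurable] = wm
  define M where "M = 2 ^ CARD('d) * exp (D\<^sup>2 / a)"
  have M: "M \<ge> 1"
  proof -
    have "1 * 1 \<le> (2::real) ^ CARD('d) * exp (D\<^sup>2 / a)"
      using a by (intro mult_mono) auto
    then show ?thesis by (simp add: M_def)
  qed
  let ?\<nu> = "gibbs_transition w x2"
  have nn1: "(\<integral>\<^sup>+y. \<integral>\<^sup>+y'. ennreal (exp (- w x2 y) * exp (- w x2 y')) \<partial>lborel \<partial>lborel) = 1"
    using nn_integral_exp_transition[OF K wm, of x2]
    by (simp add: ennreal_mult nn_integral_cmult nn_integral_multc)
  have "(\<integral>\<^sup>+y. \<integral>\<^sup>+y'. ennreal (exp (a / 8 * (norm (y - y'))\<^sup>2)) \<partial>?\<nu> \<partial>?\<nu>)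
      = (\<integral>\<^sup>+y. ennreal (exp (- w x2 y)) * (\<integral>\<^sup>+y'. ennreal (exp (- w x2 y')) * ennreal (exp (a / 8 * (norm (y - y'))\<^sup>2)) \<partial>lborel) \<partial>lborel)"
    unfolding gibbs_transition_def by (simp add: nn_integral_density)
  also have "\<dots> = (\<integral>\<^sup>+y. \<integral>\<^sup>+y'. ennreal (exp (a / 8 * (norm (y - y'))\<^sup>2) * exp (- w x2 y) * exp (- w x2 y')) \<partial>lborel \<partial>lborel)"
    by (intro nn_integral_cong) (subst nn_integral_cmult[symmetric], measurable, simp add: ennreal_mult[symmetric] ac_simps)
  also have "\<dots> \<le> ennreal M"
    using two_point_exponential_moment[OF wm a growth, of x2] by (simp add: nn1 M_def)
  finally have moment: "(\<integral>\<^sup>+y. \<integral>\<^sup>+y'. ennreal (exp (a / 8 * (norm (y - y'))\<^sup>2)) \<partial>?\<nu> \<partial>?\<nu>) \<le> ennreal M" .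
  have dens: "gibbs_transition w x1 = density ?\<nu> (\<lambda>y. ennreal (exp (w x2 y - w x1 y)))"
    by (rule gibbs_transition_density[OF wm wm])
  have "rel_entropy (density ?\<nu> (\<lambda>y. ennreal (exp (w x2 y - w x1 y)))) ?\<nu>
      \<le> ereal ((1 + 2 * ln M) / (a / 8) * (\<kappa> * norm (x1 - x2))\<^sup>2)"
  proof (rule lipschitz_tilt_entropy[OF K'(2,3)])
    show "(\<lambda>y. w x2 y - w x1 y) \<in> borel_measurable borel" by measurable
    show "0 \<le> \<kappa> * norm (x1 - x2)" using \<kappa> by simp
    show "0 < a / 8" using a by simp
    show "prob_space (density ?\<nu> (\<lambda>y. ennreal (exp (w x2 y - w x1 y))))"
      using K'(2)[of x1] dens by simp
  qed (use lip M moment in auto)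
  then show ?thesis unfolding dens[symmetric] M_def .
qed

lemma lipschitz_slice_difference:
  fixes F :: "real^'d \<Rightarrow> real^'d \<Rightarrow> real"
  assumes F: "\<And>x. smooth (F x)"
    and grad: "\<And>y. norm (gradient (F x1) y - gradient (F x2) y) \<le> c"
  shows "\<bar>(F x1 y - F x2 y) - (F x1 y' - F x2 y')\<bar> \<le> c * norm (y - y')"
proof -
  have "norm ((F x1 y - F x2 y) - (F x1 y' - F x2 y')) \<le> c * norm (y - y')"
  proof (rule differentiable_bound[of UNIV "\<lambda>y. F x1 y - F x2 y"
        "\<lambda>z h. h \<bullet> gradient (F x1) z - h \<bullet> gradient (F x2) z"])
    fix z :: "real^'d"
    show "((\<lambda>y. F x1 y - F x2 y) has_derivative
        (\<lambda>h. h \<bullet> gradient (F x1) z - h \<bullet> gradient (F x2) z)) (at z within UNIV)"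
      by (intro has_derivative_diff gradient_eq(2) smooth_differentiable F)
    show "onorm (\<lambda>h. h \<bullet> gradient (F x1) z - h \<bullet> gradient (F x2) z) \<le> c"
    proof (rule onorm_le)
      fix h :: "real^'d"
      have "\<bar>h \<bullet> (gradient (F x1) z - gradient (F x2) z)\<bar> \<le> norm h * norm (gradient (F x1) z - gradient (F x2) z)"
        by (rule Cauchy_Schwarz_ineq2)
      also have "\<dots> \<le> norm h * c" by (intro mult_left_mono grad) simp
      finally show "norm (h \<bullet> gradient (F x1) z - h \<bullet> gradient (F x2) z) \<le> c * norm h"
        by (simp add: inner_diff_right mult.commute)
    qed
  qed auto
  then show ?thesis by simp
qed

context sinkhorn_potentials
begin

text \<open>The initial transition determines its log-density pointwise, by continuity.\<close>

lemma w_0: "w 0 = W"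
proof (intro ext)
  fix x y
  have W: "continuous_on UNIV (\<lambda>z. W (fst z) (snd z))" by (rule smooth_imp_continuous_on[OF smooth_W])
  have c: "continuous_on UNIV (\<lambda>y. W x y)" "continuous_on UNIV (\<lambda>y. w 0 x y)"
    using continuous_on_compose2[OF W, of UNIV "\<lambda>y. (x, y)"]
      continuous_on_compose2[OF w_continuous, of UNIV "\<lambda>y. (x, y)" 0]
    by (simp_all add: continuous_on_Pair)
  have [measurable]: "W x \<in> borel_measurable borel" "w 0 x \<in> borel_measurable borel"
    using c by (auto intro: borel_measurable_continuous_onI)
  have "gibbs_transition (w 0) x = gibbs_transition W x" using K_eq[of 0] transition_0 by simp
  then have "density lborel (\<lambda>y. ennreal (exp (- w 0 x y))) = density lborel (\<lambda>y. ennreal (exp (- W x y)))"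
    unfolding gibbs_transition_def .
  then have "AE y in lborel. ennreal (exp (- w 0 x y)) = ennreal (exp (- W x y))"
    by (subst (asm) sigma_finite_measure.density_unique_iff[OF sigma_finite_lborel]) auto
  then have "AE y in lborel. w 0 x y = W x y" by eventually_elim simp
  then show "w 0 x y = W x y" by (rule AE_lborel_continuous_eq[OF c(2,1)])
qed

text \<open>A full step changes the log-density of the bridge by a function of \<open>x\<close> plus a function of \<open>y\<close>.\<close>

lemma potential_split_even:
  assumes "even n"
  shows "\<exists>f g. \<forall>x y. U x + w n x y = W x y + f x + g y"
  using assms
proof (induction n rule: less_induct)
  case (less n)
  show ?case
  proof (cases "n = 0")
    case True
    then show ?thesis by (intro exI[of _ U] exI[of _ "\<lambda>_. 0"]) (simp add: w_0)
  next
    case False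
    then obtain m where m: "n = Suc (Suc m)" "even m"
      using less.prems by (metis even_Suc not0_implies_Suc odd_Suc_minus_one)
    obtain f g where fg: "\<And>x y. U x + w m x y = W x y + f x + g y" using less.IH[of m] m by auto
    have "U x + w n x y = W x y + (f x - b (Suc m) x + U x) + (g y - b m y + V y)" for x y
      using potential_eq[of m x y] potential_eq[of "Suc m" y x] fg[of x y] m by simp
    then show ?thesis by (intro exI[of _ "\<lambda>x. f x - b (Suc m) x + U x"] exI[of _ "\<lambda>y. g y - b m y + V y"]) simp
  qed
qed

lemma transition_slice: "w n x \<in> borel_measurable borel"
  using continuous_on_compose2[OF w_continuous, of UNIV "\<lambda>y. (x, y)" n]
  by (intro borel_measurable_continuous_onI) (simp add: continuous_on_Pair)

lemma nn_integral_exp_source: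
  "(\<integral>\<^sup>+x. ennreal (exp (- (source n x + w n x y))) \<partial>lborel) = ennreal (exp (- b n y))"
proof -
  note [measurable] = transition_slice
  have M: "markov_transition (gibbs_transition (w (Suc n)))" using markov[of "Suc n"] by (simp add: K_eq)
  have "(\<integral>\<^sup>+x. ennreal (exp (- (source n x + w n x y))) \<partial>lborel)
      = (\<integral>\<^sup>+x. ennreal (exp (- b n y)) * ennreal (exp (- w (Suc n) y x)) \<partial>lborel)"
  proof (rule nn_integral_cong)
    fix x
    have "source n x + w n x y = b n y + w (Suc n) y x"
      using potential_eq[of n x y] by (cases "even n") simp_all
    then have "exp (- (source n x + w n x y)) = exp (- b n y) * exp (- w (Suc n) y x)"
      by (simp only: exp_add[symmetric]) simp
    then show "ennreal (exp (- (source n x + w n x y))) = ennreal (exp (- b n y)) * ennreal (exp (- w (Suc n) y x))"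
      by (simp only: ennreal_mult[OF exp_ge_zero exp_ge_zero])
  qed
  also have "\<dots> = ennreal (exp (- b n y))"
    using nn_integral_exp_transition[OF M transition_slice] by (simp add: nn_integral_cmult)
  finally show ?thesis .
qed

text \<open>By \<open>potential_split_even\<close> the normalisation of the previous odd transition is an integral of
  \<open>exp (- W x' y)\<close> with a weight in \<open>x'\<close> and a factor in \<open>y\<close>; the latter cancels against the same
  factor in the numerator.  Only the differences \<open>W x y - W x' y\<close> remain.\<close>

lemma even_transition_structure:
  assumes "even m"
  shows "\<exists>L c. (\<forall>x y. w (Suc (Suc m)) x y = V y + L x y) \<and>
    (\<forall>x y. ennreal (exp (L x y)) = (\<integral>\<^sup>+x'. ennreal (exp (W x y - W x' y + c x x')) \<partial>lborel)) \<and>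
    (\<forall>x1 x2. \<exists>k. \<forall>y. L x2 y - L x1 y = W x2 y - W x1 y + k) \<and>
    (\<forall>x y. (\<lambda>x'. W x y - W x' y + c x x') \<in> borel_measurable lborel)"
proof -
  obtain f g where fg: "\<And>x y. U x + w m x y = W x y + f x + g y"
    using potential_split_even[OF assms] by blast
  define L where "L x y = W x y + f x + g y - b m y - b (Suc m) x" for x y
  define c where "c x x' = f x - f x' - b (Suc m) x" for x x'
  have eq: "W x y - W x' y + c x x' = (W x y + f x + g y - b (Suc m) x) - (U x' + w m x' y)" for x y x'
    by (simp add: c_def fg algebra_simps)
  have [measurable]: "(\<lambda>x'. w m x' y) \<in> borel_measurable borel" for y
    using continuous_on_compose2[OF w_continuous, of UNIV "\<lambda>x. (x, y)" m]
    by (intro borel_measurable_continuous_onI) (simp add: continuous_on_Pair)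
  show ?thesis
  proof (rule exI[of _ L], rule exI[of _ c], intro conjI allI)
    show "w (Suc (Suc m)) x y = V y + L x y" for x y
      using potential_eq[of m x y] potential_eq[of "Suc m" y x] fg[of x y] assms by (simp add: L_def)
    show "(\<lambda>x'. W x y - W x' y + c x x') \<in> borel_measurable lborel" for x y
      unfolding eq by measurable
    show "\<exists>k. \<forall>y. L x2 y - L x1 y = W x2 y - W x1 y + k" for x1 x2
      by (intro exI[of _ "f x2 - f x1 - b (Suc m) x2 + b (Suc m) x1"]) (simp add: L_def)
    show "ennreal (exp (L x y)) = (\<integral>\<^sup>+x'. ennreal (exp (W x y - W x' y + c x x')) \<partial>lborel)" for x y
    proof -
      have "(\<integral>\<^sup>+x'. ennreal (exp (W x y - W x' y + c x x')) \<partial>lborel)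
          = (\<integral>\<^sup>+x'. ennreal (exp (W x y + f x + g y - b (Suc m) x)) * ennreal (exp (- (U x' + w m x' y))) \<partial>lborel)"
        unfolding eq by (simp add: ennreal_mult[symmetric] exp_add[symmetric] algebra_simps)
      also have "\<dots> = ennreal (exp (W x y + f x + g y - b (Suc m) x)) * ennreal (exp (- b m y))"
        using nn_integral_exp_source[of m y] assms by (subst nn_integral_cmult) simp_all
      also have "\<dots> = ennreal (exp (L x y))"
        by (simp add: ennreal_mult[symmetric] exp_add[symmetric] L_def algebra_simps)
      finally show ?thesis by simp
    qed
  qed
qed

end

text \<open>The Hessian of the difference is bounded below by minus \<open>H\<close>.\<close>

lemma convex_on_potential_difference:
  fixes F :: "real^'d \<Rightarrow> real^'d \<Rightarrow> real" and H :: "real^'d^'d"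
  assumes F: "\<And>x. smooth (F x)"
    and hess: "\<And>y. loewner_le (hessian (F x') y - hessian (F x) y) H"
    and H: "\<And>x y. x \<bullet> (H *v y) = (H *v x) \<bullet> y"
  shows "convex_on UNIV (\<lambda>y. F x y - F x' y + k + y \<bullet> (H *v y) / 2)"
proof (rule convex_on_hessian)
  fix s r :: "real^'d" and t :: real
  let ?p = "\<lambda>t. s + t *\<^sub>R r"
  note d = line_derivatives[OF F, where s = s and r = r]
  have e: "?p t \<bullet> (H *v ?p t) / 2 = s \<bullet> (H *v s) / 2 + t * (r \<bullet> (H *v s)) + t\<^sup>2 * (r \<bullet> (H *v r)) / 2" for t
    using H[of s r] by (simp add: matrix_vector_right_distrib matrix_vector_mult_scaleR
        inner_add_left inner_add_right power2_eq_square algebra_simps inner_commute)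
  show "((\<lambda>t. F x (?p t) - F x' (?p t) + k + ?p t \<bullet> (H *v ?p t) / 2) has_real_derivative
      r \<bullet> gradient (F x) (?p t) - r \<bullet> gradient (F x') (?p t) + (r \<bullet> (H *v s) + t * (r \<bullet> (H *v r)))) (at t)"
    unfolding e by (auto intro!: derivative_eq_intros d(1))
  show "((\<lambda>t. r \<bullet> gradient (F x) (?p t) - r \<bullet> gradient (F x') (?p t) + (r \<bullet> (H *v s) + t * (r \<bullet> (H *v r))))
      has_real_derivative
      r \<bullet> (hessian (F x) (?p t) *v r) - r \<bullet> (hessian (F x') (?p t) *v r) + r \<bullet> (H *v r)) (at t)"
    by (auto intro!: derivative_eq_intros d(2))
  show "0 \<le> r \<bullet> (hessian (F x) (?p t) *v r) - r \<bullet> (hessian (F x') (?p t) *v r) + r \<bullet> (H *v r)"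
  proof -
    have "0 \<le> r \<bullet> ((H - (hessian (F x') (?p t) - hessian (F x) (?p t))) *v r)"
      using hess[of "?p t"] unfolding loewner_le_def pos_semidef_def by blast
    then show ?thesis by (simp add: matrix_vector_mult_diff_rdistrib inner_diff_right)
  qed
qed

text \<open>The bound is uniform in \<open>n\<close>: the iteration enters the potential only through the weight
  in \<open>x'\<close>, on which neither the convexity nor the Lipschitz constant depends.\<close>

lemma (in sinkhorn_potentials) even_transition_entropy:
  assumes a: "a > 0" and c: "c \<ge> 0" and \<delta>: "\<delta> \<ge> 0" and n: "n \<ge> 1"
    and v_hat: "pos_def v_hat"
    and coercive: "\<And>r. a * (norm r)\<^sup>2 \<le> r \<bullet> (matrix_inv v_plus *v r) - r \<bullet> (matrix_inv v_hat *v r)"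
    and bounded: "\<And>r. r \<bullet> (v_bar *v r) + r \<bullet> (matrix_inv v_hat *v r) \<le> c * (norm r)\<^sup>2"
    and CW: "cond_W W \<kappa> u_hat v_hat"
    and CC: "cond_C_minus U V u_plus v_plus v_bar \<delta>"
  shows "rel_entropy (K (2 * n) x1) (K (2 * n) x2)
    \<le> ereal ((1 + 2 * ln (2 ^ CARD('d) * exp (((a + c) * \<delta>)\<^sup>2 / a))) / (a / 8) * (\<kappa> * norm (x1 - x2))\<^sup>2)"
proof -
  define m where "m = 2 * (n - 1)"
  have m: "even m" "2 * n = Suc (Suc m)" using n by (auto simp: m_def)
  let ?w = "w (Suc (Suc m))" and ?H = "matrix_inv v_hat"
  note H = pos_def_inverse(2)[OF v_hat]
  have W: "smooth (W x)" for x by (rule smooth_slice[OF smooth_W])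
  have fl: "(\<lambda>z. flip W z x) = W x" for x by (auto simp: flip_def)
  have \<kappa>: "\<kappa> > 0" and grad: "\<And>x1 x2 y. norm (gradient (W x1) y - gradient (W x2) y) \<le> \<kappa> * norm (x1 - x2)"
    and hessW: "\<And>y x1 x2. loewner_le (hessian (W x1) y - hessian (W x2) y) ?H"
    using CW unfolding cond_W_def fl by blast+
  have hessV: "\<And>y. loewner_le (indicat_real {z. norm z \<ge> \<delta>} y *\<^sub>R matrix_inv v_plus
      - indicat_real {z. norm z < \<delta>} y *\<^sub>R v_bar) (hessian V y)"
    using CC unfolding cond_C_minus_def by blast
  obtain L k where wL: "\<And>x y. ?w x y = V y + L x y"
    and expL: "\<And>x y. ennreal (exp (L x y)) = (\<integral>\<^sup>+x'. ennreal (exp (W x y - W x' y + k x x')) \<partial>lborel)"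
    and dL: "\<And>x1 x2. \<exists>k. \<forall>y. L x2 y - L x1 y = W x2 y - W x1 y + k"
    and mL: "\<And>x y. (\<lambda>x'. W x y - W x' y + k x x') \<in> borel_measurable lborel"
    using even_transition_structure[OF m(1)] by blast
  have cvx: "convex_on UNIV (\<lambda>y. L x y + y \<bullet> (?H *v y) / 2)" for x
  proof (rule convex_on_log_integral_exp[where M = lborel
        and \<psi> = "\<lambda>x' y. W x y - W x' y + k x x' + y \<bullet> (?H *v y) / 2"])
    show "(\<lambda>x'. W x y - W x' y + k x x' + y \<bullet> (?H *v y) / 2) \<in> borel_measurable lborel" for y
      using mL by simp
    show "convex_on UNIV (\<lambda>y. W x y - W x' y + k x x' + y \<bullet> (?H *v y) / 2)" for x'
      by (rule convex_on_potential_difference[OF W hessW H])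
    show "(\<integral>\<^sup>+x'. ennreal (exp (W x y - W x' y + k x x' + y \<bullet> (?H *v y) / 2)) \<partial>lborel)
        = ennreal (exp (L x y + y \<bullet> (?H *v y) / 2))" for y
    proof -
      have "(\<integral>\<^sup>+x'. ennreal (exp (W x y - W x' y + k x x' + y \<bullet> (?H *v y) / 2)) \<partial>lborel)
          = (\<integral>\<^sup>+x'. ennreal (exp (W x y - W x' y + k x x')) * ennreal (exp (y \<bullet> (?H *v y) / 2)) \<partial>lborel)"
        by (simp add: exp_add ennreal_mult)
      also have "\<dots> = ennreal (exp (L x y)) * ennreal (exp (y \<bullet> (?H *v y) / 2))"
        using mL[of x y] by (subst nn_integral_multc) (auto simp: expL)
      also have "\<dots> = ennreal (exp (L x y + y \<bullet> (?H *v y) / 2))"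
        by (simp add: exp_add ennreal_mult)
      finally show ?thesis .
    qed
  qed
  have M: "markov_transition (gibbs_transition ?w)" using markov[of "Suc (Suc m)"] by (simp add: K_eq)
  have "rel_entropy (gibbs_transition ?w x1) (gibbs_transition ?w x2)
    \<le> ereal ((1 + 2 * ln (2 ^ CARD('d) * exp (((a + c) * \<delta>)\<^sup>2 / a))) / (a / 8) * (\<kappa> * norm (x1 - x2))\<^sup>2)"
  proof (rule tilted_transition_entropy[OF w_continuous M a _ _ \<kappa>])
    show "?w x (s + r) + ?w x (s - r) + 3 * a * (norm r)\<^sup>2 - 2 * ((a + c) * \<delta>) * norm r
      \<le> ?w x (s + 2 *\<^sub>R r) + ?w x (s - 2 *\<^sub>R r)" for x s r
      by (rule two_point_growth_hessian[OF smooth_V a c \<delta> hessV H coercive bounded cvx wL])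
    show "\<bar>(?w x2 y - ?w x1 y) - (?w x2 y' - ?w x1 y')\<bar> \<le> \<kappa> * norm (x1 - x2) * norm (y - y')"
      for x1 x2 y y'
    proof -
      obtain k' where "\<And>y. L x2 y - L x1 y = W x2 y - W x1 y + k'" using dL by blast
      then have e: "?w x2 y - ?w x1 y = W x2 y - W x1 y + k'" for y using wL by (simp add: algebra_simps)
      show ?thesis
        using lipschitz_slice_difference[of W x2 x1 "\<kappa> * norm (x1 - x2)" y y', OF W] grad[of x2 _ x1]
        unfolding e by (simp add: norm_minus_commute)
    qed
  qed
  then show ?thesis unfolding m(2) K_eq .
qed

section \<open>The contraction theorem\<close>

theorem theorem6p7:
  shows
   "(\<forall>(U :: real^'d \<Rightarrow> real) V W K (u_plus :: real^'d^'d) (\<kappa> :: nat \<Rightarrow> real) (\<rho> :: nat \<Rightarrow> real).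
       sinkhorn U V W K \<and>
       (\<forall>n\<ge>1. cond_A0 (K (2 * n)) (\<kappa> (2 * n)) (\<rho> (2 * n))) \<and>
       pos_def u_plus \<and> talagrand2 (gibbs U) (spectral_norm u_plus) \<longrightarrow>
       (\<forall>n\<ge>1. let \<epsilon> = (\<kappa> (2 * n))\<^sup>2 * \<rho> (2 * n) * spectral_norm u_plus;
                   P = schroedinger_bridge (gibbs U) (gibbs V)
                         (joint (gibbs U) (gibbs_transition W))
               in rel_entropy P (sinkhorn_bridge (gibbs U) (gibbs V) K (2 * n))
                  \<le> ereal (inverse (1 + inverse \<epsilon>)) *
                     rel_entropy P (sinkhorn_bridge (gibbs U) (gibbs V) K (2 * (n - 1)))))
    \<and>
    (\<forall>(v_plus :: real^'d^'d) v_hat v_bar (\<delta> :: real).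
       pos_def v_plus \<and> loewner_less v_plus v_hat \<and> pos_semidef v_bar \<and> \<delta> \<ge> 0 \<longrightarrow>
       (\<exists>\<rho>_tilde > (0::real).
          \<forall>(U :: real^'d \<Rightarrow> real) V W K (\<kappa> :: real) u_hat u_plus.
            sinkhorn U V W K \<and>
            cond_W W \<kappa> u_hat v_hat \<and>
            pos_def u_plus \<and> cond_C_minus U V u_plus v_plus v_bar \<delta> \<longrightarrow>
            (\<forall>n\<ge>1. let \<epsilon> = \<kappa>\<^sup>2 * \<rho>_tilde * spectral_norm u_plus;
                        P = schroedinger_bridge (gibbs U) (gibbs V)
                              (joint (gibbs U) (gibbs_transition W))
                    in rel_entropy P (sinkhorn_bridge (gibbs U) (gibbs V) K (2 * n))
                       \<le> ereal (inverse (1 + inverse \<epsilon>)) *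
                          rel_entropy P (sinkhorn_bridge (gibbs U) (gibbs V) K (2 * (n - 1))))))"
proof (intro conjI allI impI, goal_cases)
  case (1 U V W K u_plus \<kappa> \<rho> n)
  note asm = 1(1) and n = 1(2)
  interpret sinkhorn U V W K using asm by blast
  obtain w b where "sinkhorn_potentials U V W K w b" by (rule obtain_potentials)
  then interpret sinkhorn_potentials U V W K w b .
  have A0: "cond_A0 (K (2 * n)) (\<kappa> (2 * n)) (\<rho> (2 * n))" using asm n by blast
  have pos: "(\<kappa> (2 * n))\<^sup>2 * \<rho> (2 * n) > 0" using A0 by (simp add: cond_A0_def)
  have ent: "rel_entropy (K (2 * n) x1) (K (2 * n) x2)
      \<le> ereal ((\<kappa> (2 * n))\<^sup>2 * \<rho> (2 * n) / 2 * (norm (x1 - x2))\<^sup>2)" for x1 x2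
  proof -
    have "rel_entropy (K (2 * n) x1) (K (2 * n) x2)
        \<le> ereal (\<rho> (2 * n) / 2) * fisher_information (K (2 * n) x1) (K (2 * n) x2)"
      using A0 by (simp add: cond_A0_def)
    also have "\<dots> \<le> ereal (\<rho> (2 * n) / 2) * ereal ((\<kappa> (2 * n))\<^sup>2 * (norm (x1 - x2))\<^sup>2)"
      using A0 by (intro ereal_mult_left_mono) (simp_all add: cond_A0_def)
    finally show ?thesis by (simp add: algebra_simps)
  qed
  show ?case
    unfolding Let_def
    using asm by (intro bridge_entropy_contraction[OF n pos _ _ ent] spectral_norm_pos) auto
next
  case (2 v_plus v_hat v_bar \<delta>)
  note asm = 2
  have v_hat: "pos_def v_hat"
    using asm pos_def_add[of v_plus "v_hat - v_plus"] by (simp add: loewner_less_def)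
  have "0 < x \<bullet> ((matrix_inv v_plus - matrix_inv v_hat) *v x)" if "x \<noteq> 0" for x
    using asm that matrix_inv_antimono_strict[of v_plus v_hat]
    by (simp add: matrix_vector_mult_diff_rdistrib inner_diff_right)
  from quadratic_form_coercive[OF this] obtain a where a: "a > 0"
    and "\<And>r. a * (norm r)\<^sup>2 \<le> r \<bullet> ((matrix_inv v_plus - matrix_inv v_hat) *v r)"
    by blast
  then have coercive: "a * (norm r)\<^sup>2 \<le> r \<bullet> (matrix_inv v_plus *v r) - r \<bullet> (matrix_inv v_hat *v r)" for r
    by (simp add: matrix_vector_mult_diff_rdistrib inner_diff_right)
  \<comment> \<open>bounds the Hessian from below inside the ball\<close>
  define c where "c = spectral_norm v_bar + spectral_norm (matrix_inv v_hat)"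
  have c: "c \<ge> 0" unfolding c_def by (intro add_nonneg_nonneg spectral_norm_nonneg)
  have bounded: "r \<bullet> (v_bar *v r) + r \<bullet> (matrix_inv v_hat *v r) \<le> c * (norm r)\<^sup>2" for r
    using quadratic_form_bounded[of r v_bar] quadratic_form_bounded[of r "matrix_inv v_hat"]
    by (simp add: c_def algebra_simps)
  define l where "l = (1 + 2 * ln (2 ^ CARD('d) * exp (((a + c) * \<delta>)\<^sup>2 / a))) / (a / 8)"
  have l: "l > 0"
  proof -
    have "ln (2 ^ CARD('d) * exp (((a + c) * \<delta>)\<^sup>2 / a)) \<ge> 0"
      using a by (simp add: ln_mult ln_realpow)
    then show ?thesis unfolding l_def using a by (intro divide_pos_pos) linarith+
  qed
  show ?case
  proof (intro exI[of _ "2 * l"] conjI allI impI, goal_cases)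
    case 1
    show ?case using l by simp
  next
    case (2 U V W K \<kappa> u_hat u_plus n)
    note asm' = 2(1) and n = 2(2)
    interpret sinkhorn U V W K using asm' by blast
    obtain w b where "sinkhorn_potentials U V W K w b" by (rule obtain_potentials)
    then interpret sinkhorn_potentials U V W K w b .
    have CW: "cond_W W \<kappa> u_hat v_hat" and CC: "cond_C_minus U V u_plus v_plus v_bar \<delta>"
      using asm' by blast+
    have pos: "\<kappa>\<^sup>2 * (2 * l) > 0" using CW l by (simp add: cond_W_def)
    have ent: "rel_entropy (K (2 * n) x1) (K (2 * n) x2)
        \<le> ereal (\<kappa>\<^sup>2 * (2 * l) / 2 * (norm (x1 - x2))\<^sup>2)" for x1 x2
    proof -
      have "rel_entropy (K (2 * n) x1) (K (2 * n) x2) \<le> ereal (l * (\<kappa> * norm (x1 - x2))\<^sup>2)"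
        using even_transition_entropy[OF a c _ n v_hat coercive bounded CW CC, of x1 x2] asm
        unfolding l_def[symmetric] by blast
      also have "l * (\<kappa> * norm (x1 - x2))\<^sup>2 = \<kappa>\<^sup>2 * (2 * l) / 2 * (norm (x1 - x2))\<^sup>2"
        by (simp add: power_mult_distrib)
      finally show ?thesis .
    qed
    show ?case
      unfolding Let_def
      using asm' by (intro bridge_entropy_contraction[OF n pos _ _ ent] spectral_norm_pos)
        (auto simp: cond_C_minus_def)
  qed
qed

end
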